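(* Let $\mathcal C$ be a small $\mathbb C$-linear category, let $p\in[1,\infty)$, and let $(\mathscr H,\mathcal F)$ be a $p$-summable even Fredholm module over $\mathcal C$. Let $m\ge 0$ be an integer with $2m\geq p-1$. Then the tuple $(\Omega'\mathcal C,\partial',\hat{Tr}_s,\rho')$ is a $2m$-dimensional cycle over $\mathcal C$. Moreover, the element $\phi^{2m}\in CN^{2m}(\mathcal C)$ defined by $$\phi^{2m}(f^0\otimes f^1\otimes\cdots\otimes f^{2m}):=Tr_s\left(\mathscr H(f^0)[\mathcal F,f^1][\mathcal F,f^2]\cdots[\mathcal F,f^{2m}]\right)$$ for $f^0\otimes f^1\otimes\cdots\otimes f^{2m}\in Hom_{\mathcal C}(X_1,X)\otimes Hom_{\mathcal C}(X_2,X_1)\otimes\cdots\otimes Hom_{\mathcal C}(X,X_{2m})$ is a cyclic cocycle over $\mathcal C$.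
   Context: **Operators.** For separable Hilbert spaces, $\mathcal B(\mathcal H_1,\mathcal H_2)$ denotes bounded linear operators and $\mathcal B^q(\mathcal H_1,\mathcal H_2)$ the $q$-th Schatten class (operators whose singular values $\mu_n$ satisfy $\sum\mu_n^q<\infty$); $Tr$ is the usual trace on $\mathcal B^1(\mathcal H,\mathcal H)$. $SHilb_{\mathbb Z_2}$ is the category of $\mathbb Z_2$-graded separable Hilbert spaces and bounded linear maps; $\epsilon$ is the grading operator ($+1$ on the even part, $-1$ on the odd part). **Even Fredholm modules.** A $p$-summable even Fredholm module over $\mathcal C$ is a pair $(\mathscr H,\mathcal F)$, where $\mathscr H:\mathcal C\to SHilb_{\mathbb Z_2}$ is a $\mathbb C$-linear functor with every $\mathscr H(f)$ of degree $0$, and $\mathcal F=\{\mathcal F_X:\mathscr H(X)\to\mathscr H(X)\}_{X\in Ob(\mathcal C)}$ is a family of bounded operators of degree $1$ with $\mathcal F_X^2=id$, such that $[\mathcal F,f]:=\mathcal F_Y\mathscr H(f)-\mathscr H(f)\mathcal F_X\in\mathcal B^p(\mathscr H(X),\mathscr H(Y))$ for every $f\in Hom_{\mathcal C}(X,Y)$. **DG-semicategories and cycles.** A semicategory is a category without the requirement of identity morphisms; a semifunctor preserves composition only. A DG-semicategory $(\mathcal S,\hat\partial)$ is a $\mathbb C$-linear semicategory whose morphism spaces are cochain complexes $(Hom^n_{\mathcal S}(X,Y),\hat\partial)_{n\ge0}$ such that composition adds degrees and $\hat\partial(gf)=\hat\partial(g)f+(-1)^{|g|}g\hat\partial(f)$.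 $\mathcal S^0$ is the semicategory of degree $0$ morphisms. A closed graded trace of dimension $n$ on $\mathcal S$ is a family of linear maps $\hat T_X:Hom^n_{\mathcal S}(X,X)\to\mathbb C$ with $\hat T_X(\hat\partial f)=0$ for $f\in Hom^{n-1}_{\mathcal S}(X,X)$ and $\hat T_X(gg')=(-1)^{ij}\hat T_Y(g'g)$ for $g\in Hom^i_{\mathcal S}(Y,X)$, $g'\in Hom^j_{\mathcal S}(X,Y)$, $i+j=n$. An $n$-dimensional cycle over $\mathcal C$ is a tuple $(\mathcal S,\hat\partial,\hat T,\rho)$ with $(\mathcal S,\hat\partial)$ a DG-semicategory such that $\mathcal S^0$ is an ordinary category, $\hat T$ an $n$-dimensional closed graded trace on $\mathcal S$, and $\rho:\mathcal C\to\mathcal S^0$ a $\mathbb C$-linear semifunctor. **The tuple.** $\Omega'\mathcal C$ has the objects of $\mathcal C$, and $Hom^j_{\Omega'\mathcal C}(X,Y)\subseteq\mathcal B(\mathscr H(X),\mathscr H(Y))$ is the linear span of the operators $\mathscr H(\tilde f^0)[\mathcal F,f^1]\cdots[\mathcal F,f^j]$, where $f^1\in Hom_{\mathcal C}(X_2,X_1),\dots,f^j\in Hom_{\mathcal C}(X,X_j)$ are composable morphisms, $\tilde f^0=f^0+\mu$ with $f^0\in Hom_{\mathcal C}(X_1,Y)$ and $\mu\in\mathbb C$ ($\mu=0$ unless $X_1=Y$), and $\mathscr H(\tilde f^0)=\mathscr H(f^0)+\mu\cdot id$ (for $j=0$, $X_1=X$). Composition is composition of operators. For $T\in Hom^j_{\Omega'\mathcal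 C}(X,Y)$, $\partial'T=[\mathcal F,T]:=\mathcal F_YT-(-1)^jT\mathcal F_X$. The semifunctor $\rho':\mathcal C\to\Omega'^0\mathcal C$ is the identity on objects and sends $f$ to $\mathscr H(f)$. For $T\in\mathcal B(\mathscr H(X),\mathscr H(X))$ homogeneous with $[\mathcal F,T]=\mathcal F_XT-(-1)^{|T|}T\mathcal F_X$ trace class, $Tr_s(T):=\frac12Tr(\epsilon\mathcal F_X[\mathcal F,T])$; $\hat{Tr}_s$ is the collection of the maps $Tr_s:Hom^{2m}_{\Omega'\mathcal C}(X,X)\to\mathbb C$, $X\in Ob(\mathcal C)$. **Cyclic cocycles.** $CN_n(\mathcal C)=\bigoplus_{(X_0,\dots,X_n)}Hom_{\mathcal C}(X_1,X_0)\otimes Hom_{\mathcal C}(X_2,X_1)\otimes\cdots\otimes Hom_{\mathcal C}(X_0,X_n)$ and $CN^n(\mathcal C)$ is its linear dual. For $\phi\in CN^n(\mathcal C)$, $(b\phi)(f^0\otimes\cdots\otimes f^{n+1})=\sum_{i=0}^n(-1)^i\phi(f^0\otimes\cdots\otimes f^if^{i+1}\otimes\cdots\otimes f^{n+1})+(-1)^{n+1}\phi(f^{n+1}f^0\otimes f^1\otimes\cdots\otimes f^n)$ and $(\lambda\phi)(f^0\otimes\cdots\otimes f^n)=(-1)^n\phi(f^n\otimes f^0\otimes\cdots\otimes f^{n-1})$. $\phi$ is a cyclic cocycle if $b\phi=0$ and $\lambda\phi=\phi$. *)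

theory Defs
  imports "HOL-Analysis.Analysis" "HOL-Algebra.Module"
begin

section \<open>Complex vector spaces\<close>

text \<open>Complex vector spaces are modules (in the sense of HOL-Algebra) over the following copy of
  the field of complex numbers.  It is itself a module record, so it also serves as the
  one-dimensional vector space.  The multiplication and unit that every module record inherits
  from the ring record play no role in the module axioms.\<close>

definition cfield :: "(complex, complex) module" where
  "cfield = \<lparr>carrier = UNIV, mult = (*), one = 1, zero = 0, add = (+), smult = (*)\<rparr>"

definition linear_map ::
  "(complex, 'a, 'r) module_scheme \<Rightarrow> (complex, 'b, 's) module_scheme \<Rightarrow> ('a \<Rightarrow> 'b) \<Rightarrow> bool" where
  "linear_map V W f \<longleftrightarrow>
     f \<in> carrier V \<rightarrow> carrier W \<and>
     (\<forall>x\<in>carrier V. \<forall>y\<in>carrier V. f (x \<oplus>\<^bsub>V\<^esub> y) = f x \<oplus>\<^bsub>W\<^esub> f y) \<and>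
     (\<forall>c. \<forall>x\<in>carrier V. f (c \<odot>\<^bsub>V\<^esub> x) = c \<odot>\<^bsub>W\<^esub> f x)"

definition lin_span :: "(complex, 'a, 'r) module_scheme \<Rightarrow> 'a set \<Rightarrow> 'a set" where
  "lin_span V S = (\<lambda>N. submodule N cfield V) hull S"


section \<open>Separable Hilbert spaces\<close>

record 'v hilb = "(complex, 'v) module" +
  hinner :: "'v \<Rightarrow> 'v \<Rightarrow> complex"

definition hnorm :: "('v, 'r) hilb_scheme \<Rightarrow> 'v \<Rightarrow> real" where
  "hnorm H x = sqrt (Re (hinner H x x))"

text \<open>The inner product is linear in the first argument.\<close>

definition hilbert_space :: "('v, 'r) hilb_scheme \<Rightarrow> bool" where
  "hilbert_space H \<longleftrightarrow>
     module cfield H \<and>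
     (\<forall>y\<in>carrier H. linear_map H cfield (\<lambda>x. hinner H x y)) \<and>
     (\<forall>x\<in>carrier H. \<forall>y\<in>carrier H. hinner H y x = cnj (hinner H x y)) \<and>
     (\<forall>x\<in>carrier H. x \<noteq> \<zero>\<^bsub>H\<^esub> \<longrightarrow> Re (hinner H x x) > 0) \<and>
     (\<forall>s. (\<forall>n. s n \<in> carrier H) \<and>
          (\<forall>e>0. \<exists>N. \<forall>m\<ge>N. \<forall>n\<ge>N. hnorm H (s m \<ominus>\<^bsub>H\<^esub> s n) < e) \<longrightarrow>
          (\<exists>l\<in>carrier H. (\<lambda>n. hnorm H (s n \<ominus>\<^bsub>H\<^esub> l)) \<longlonglongrightarrow> 0))"

definition separable :: "('v, 'r) hilb_scheme \<Rightarrow> bool" where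
  "separable H \<longleftrightarrow>
     (\<exists>D. countable D \<and> D \<subseteq> carrier H \<and>
          (\<forall>x\<in>carrier H. \<forall>e>0. \<exists>d\<in>D. hnorm H (x \<ominus>\<^bsub>H\<^esub> d) < e))"

definition orthonormal_basis :: "('v, 'r) hilb_scheme \<Rightarrow> 'v set \<Rightarrow> bool" where
  "orthonormal_basis H E \<longleftrightarrow>
     E \<subseteq> carrier H \<and>
     (\<forall>e\<in>E. \<forall>e'\<in>E. hinner H e e' = (if e = e' then 1 else 0)) \<and>
     (\<forall>x\<in>carrier H. (\<forall>e\<in>E. hinner H x e = 0) \<longrightarrow> x = \<zero>\<^bsub>H\<^esub>)"


section \<open>Bounded operators, Schatten classes, trace\<close>

text \<open>Operators are extensional functions (equal to \<open>undefined\<close> outside the source space), so that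
  equality of operators is equality in HOL; composition is accordingly \<^const>\<open>compose\<close>.\<close>

definition bop ::
  "('v, 'r) hilb_scheme \<Rightarrow> ('w, 's) hilb_scheme \<Rightarrow> (complex, 'v \<Rightarrow> 'w) module" where
  "bop H K = \<lparr>carrier = {T \<in> carrier H \<rightarrow>\<^sub>E carrier K. linear_map H K T \<and>
                           (\<exists>B. \<forall>x\<in>carrier H. hnorm K (T x) \<le> B * hnorm H x)},
              mult = undefined, one = undefined,
              zero = (\<lambda>x\<in>carrier H. \<zero>\<^bsub>K\<^esub>),
              add = (\<lambda>S T. \<lambda>x\<in>carrier H. S x \<oplus>\<^bsub>K\<^esub> T x),
              smult = (\<lambda>c T. \<lambda>x\<in>carrier H. c \<odot>\<^bsub>K\<^esub> T x)\<rparr>"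

definition id_op :: "('v, 'r) hilb_scheme \<Rightarrow> 'v \<Rightarrow> 'v" where
  "id_op H = (\<lambda>x\<in>carrier H. x)"

definition adjoint_op ::
  "('v, 'r) hilb_scheme \<Rightarrow> ('w, 's) hilb_scheme \<Rightarrow> ('v \<Rightarrow> 'w) \<Rightarrow> ('w \<Rightarrow> 'v)" where
  "adjoint_op H K T =
     (THE S. S \<in> carrier (bop K H) \<and>
             (\<forall>x\<in>carrier H. \<forall>y\<in>carrier K. hinner K (T x) y = hinner H x (S y)))"

text \<open>The singular values of \<open>T\<close> are the square roots of the eigenvalues of \<open>T* T\<close>, counted with
  multiplicity: \<open>\<mu> e\<close> for \<open>e\<close> in an orthonormal eigenbasis \<open>E\<close> of \<open>T* T\<close>.  Such a basis exists
  whenever \<open>T\<close> is compact, and conversely summability of the \<open>\<mu> e powr q\<close> forces compactness.\<close>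

definition schatten ::
  "real \<Rightarrow> ('v, 'r) hilb_scheme \<Rightarrow> ('w, 's) hilb_scheme \<Rightarrow> ('v \<Rightarrow> 'w) set" where
  "schatten q H K =
     {T \<in> carrier (bop H K). \<exists>E \<mu>. orthonormal_basis H E \<and>
        (\<forall>e\<in>E. \<mu> e \<ge> 0 \<and>
               adjoint_op H K T (T e) = complex_of_real ((\<mu> e)\<^sup>2) \<odot>\<^bsub>H\<^esub> e) \<and>
        (\<lambda>e. \<mu> e powr q) summable_on E}"

text \<open>Meaningful on \<open>schatten 1 H H\<close>, where the sum is the same for all orthonormal bases.\<close>

definition op_trace :: "('v, 'r) hilb_scheme \<Rightarrow> ('v \<Rightarrow> 'v) \<Rightarrow> complex" where
  "op_trace H T =
     (THE t. \<forall>E. orthonormal_basis H E \<longrightarrow> ((\<lambda>e. hinner H (T e) e) has_sum t) E)"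


section \<open>Graded Hilbert spaces\<close>

record 'v ghilb = "'v hilb" +
  even_part :: "'v set"
  odd_part :: "'v set"

text \<open>The two parts are automatically closed, each being the orthogonal complement of the other.\<close>

definition graded_separable_hilbert :: "'v ghilb \<Rightarrow> bool" where
  "graded_separable_hilbert H \<longleftrightarrow>
     hilbert_space H \<and> separable H \<and>
     submodule (even_part H) cfield H \<and> submodule (odd_part H) cfield H \<and>
     (\<forall>a\<in>even_part H. \<forall>b\<in>odd_part H. hinner H a b = 0) \<and>
     (\<forall>x\<in>carrier H. \<exists>a\<in>even_part H. \<exists>b\<in>odd_part H. x = a \<oplus>\<^bsub>H\<^esub> b)"

definition grading_op :: "'v ghilb \<Rightarrow> 'v \<Rightarrow> 'v" where
  "grading_op H =
     (\<lambda>x\<in>carrier H. THE y. \<exists>a\<in>even_part H. \<exists>b\<in>odd_part H. x = a \<oplus>\<^bsub>H\<^esub> b \<and> y = a \<ominus>\<^bsub>H\<^esub> b)"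

definition degree0_op :: "'v ghilb \<Rightarrow> 'v ghilb \<Rightarrow> ('v \<Rightarrow> 'v) \<Rightarrow> bool" where
  "degree0_op H K T \<longleftrightarrow> T ` even_part H \<subseteq> even_part K \<and> T ` odd_part H \<subseteq> odd_part K"

definition degree1_op :: "'v ghilb \<Rightarrow> 'v ghilb \<Rightarrow> ('v \<Rightarrow> 'v) \<Rightarrow> bool" where
  "degree1_op H K T \<longleftrightarrow> T ` even_part H \<subseteq> odd_part K \<and> T ` odd_part H \<subseteq> even_part K"


section \<open>Linear (semi)categories and (semi)functors\<close>

text \<open>\<open>Hom C X Y\<close> is the space of morphisms from \<open>X\<close> to \<open>Y\<close>, and \<open>Comp C X Y Z g f\<close> is the composite
  \<open>g f\<close> of \<open>f\<close> from \<open>X\<close> to \<open>Y\<close> and \<open>g\<close> from \<open>Y\<close> to \<open>Z\<close>.  Morphism spaces need not be disjoint, hence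
  the object arguments of the composition.\<close>

record ('o, 'm) semicat =
  Ob :: "'o set"
  Hom :: "'o \<Rightarrow> 'o \<Rightarrow> (complex, 'm) module"
  Comp :: "'o \<Rightarrow> 'o \<Rightarrow> 'o \<Rightarrow> 'm \<Rightarrow> 'm \<Rightarrow> 'm"

definition linear_semicategory :: "('o, 'm) semicat \<Rightarrow> bool" where
  "linear_semicategory C \<longleftrightarrow>
     (\<forall>X\<in>Ob C. \<forall>Y\<in>Ob C. module cfield (Hom C X Y)) \<and>
     (\<forall>X\<in>Ob C. \<forall>Y\<in>Ob C. \<forall>Z\<in>Ob C.
        (\<forall>g\<in>carrier (Hom C Y Z). linear_map (Hom C X Y) (Hom C X Z) (\<lambda>f. Comp C X Y Z g f)) \<and>
        (\<forall>f\<in>carrier (Hom C X Y). linear_map (Hom C Y Z) (Hom C X Z) (\<lambda>g. Comp C X Y Z g f))) \<and>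
     (\<forall>W\<in>Ob C. \<forall>X\<in>Ob C. \<forall>Y\<in>Ob C. \<forall>Z\<in>Ob C.
        \<forall>f\<in>carrier (Hom C W X). \<forall>g\<in>carrier (Hom C X Y). \<forall>h\<in>carrier (Hom C Y Z).
          Comp C W Y Z h (Comp C W X Y g f) = Comp C W X Z (Comp C X Y Z h g) f)"

definition is_identity :: "('o, 'm) semicat \<Rightarrow> 'o \<Rightarrow> 'm \<Rightarrow> bool" where
  "is_identity C X i \<longleftrightarrow>
     i \<in> carrier (Hom C X X) \<and>
     (\<forall>Y\<in>Ob C. (\<forall>f\<in>carrier (Hom C Y X). Comp C Y X X i f = f) \<and>
               (\<forall>g\<in>carrier (Hom C X Y). Comp C X X Y g i = g))"

definition linear_category :: "('o, 'm) semicat \<Rightarrow> bool" where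
  "linear_category C \<longleftrightarrow> linear_semicategory C \<and> (\<forall>X\<in>Ob C. \<exists>i. is_identity C X i)"

definition linear_semifunctor ::
  "('o, 'm) semicat \<Rightarrow> ('p, 'n) semicat \<Rightarrow> ('o \<Rightarrow> 'p) \<Rightarrow> ('o \<Rightarrow> 'o \<Rightarrow> 'm \<Rightarrow> 'n) \<Rightarrow> bool" where
  "linear_semifunctor C D G0 G1 \<longleftrightarrow>
     G0 \<in> Ob C \<rightarrow> Ob D \<and>
     (\<forall>X\<in>Ob C. \<forall>Y\<in>Ob C. linear_map (Hom C X Y) (Hom D (G0 X) (G0 Y)) (G1 X Y)) \<and>
     (\<forall>X\<in>Ob C. \<forall>Y\<in>Ob C. \<forall>Z\<in>Ob C. \<forall>f\<in>carrier (Hom C X Y). \<forall>g\<in>carrier (Hom C Y Z).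
        G1 X Z (Comp C X Y Z g f) = Comp D (G0 X) (G0 Y) (G0 Z) (G1 Y Z g) (G1 X Y f))"

definition linear_functor ::
  "('o, 'm) semicat \<Rightarrow> ('p, 'n) semicat \<Rightarrow> ('o \<Rightarrow> 'p) \<Rightarrow> ('o \<Rightarrow> 'o \<Rightarrow> 'm \<Rightarrow> 'n) \<Rightarrow> bool" where
  "linear_functor C D G0 G1 \<longleftrightarrow>
     linear_semifunctor C D G0 G1 \<and>
     (\<forall>X\<in>Ob C. \<forall>i. is_identity C X i \<longrightarrow> is_identity D (G0 X) (G1 X X i))"

definition SHilb :: "('v ghilb, 'v \<Rightarrow> 'v) semicat" where
  "SHilb = \<lparr>Ob = {H. graded_separable_hilbert H},
            Hom = bop,
            Comp = (\<lambda>H K L T S. compose (carrier H) T S)\<rparr>"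


section \<open>DG-semicategories and cycles\<close>

text \<open>\<open>gHom S n X Y\<close> is the space of degree \<open>n\<close> morphisms; \<open>gComp S i j X Y Z g f\<close> is the composite of
  \<open>f\<close> of degree \<open>j\<close> from \<open>X\<close> to \<open>Y\<close> and \<open>g\<close> of degree \<open>i\<close> from \<open>Y\<close> to \<open>Z\<close>.\<close>

record ('o, 'm) gsemicat =
  gOb :: "'o set"
  gHom :: "nat \<Rightarrow> 'o \<Rightarrow> 'o \<Rightarrow> (complex, 'm) module"
  gComp :: "nat \<Rightarrow> nat \<Rightarrow> 'o \<Rightarrow> 'o \<Rightarrow> 'o \<Rightarrow> 'm \<Rightarrow> 'm \<Rightarrow> 'm"

definition dg_semicategory ::
  "('o, 'm) gsemicat \<Rightarrow> (nat \<Rightarrow> 'o \<Rightarrow> 'o \<Rightarrow> 'm \<Rightarrow> 'm) \<Rightarrow> bool" where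
  "dg_semicategory S d \<longleftrightarrow>
     (\<forall>n. \<forall>X\<in>gOb S. \<forall>Y\<in>gOb S.
        module cfield (gHom S n X Y) \<and>
        linear_map (gHom S n X Y) (gHom S (Suc n) X Y) (d n X Y) \<and>
        (\<forall>f\<in>carrier (gHom S n X Y). d (Suc n) X Y (d n X Y f) = \<zero>\<^bsub>gHom S (Suc (Suc n)) X Y\<^esub>)) \<and>
     (\<forall>i j. \<forall>X\<in>gOb S. \<forall>Y\<in>gOb S. \<forall>Z\<in>gOb S.
        (\<forall>g\<in>carrier (gHom S i Y Z).
           linear_map (gHom S j X Y) (gHom S (i + j) X Z) (\<lambda>f. gComp S i j X Y Z g f)) \<and>
        (\<forall>f\<in>carrier (gHom S j X Y).
           linear_map (gHom S i Y Z) (gHom S (i + j) X Z) (\<lambda>g. gComp S i j X Y Z g f)) \<and>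
        (\<forall>g\<in>carrier (gHom S i Y Z). \<forall>f\<in>carrier (gHom S j X Y).
           d (i + j) X Z (gComp S i j X Y Z g f) =
             gComp S (Suc i) j X Y Z (d i Y Z g) f
             \<oplus>\<^bsub>gHom S (Suc (i + j)) X Z\<^esub>
             (-1) ^ i \<odot>\<^bsub>gHom S (Suc (i + j)) X Z\<^esub> gComp S i (Suc j) X Y Z g (d j X Y f))) \<and>
     (\<forall>i j k. \<forall>W\<in>gOb S. \<forall>X\<in>gOb S. \<forall>Y\<in>gOb S. \<forall>Z\<in>gOb S.
        \<forall>f\<in>carrier (gHom S k W X). \<forall>g\<in>carrier (gHom S j X Y). \<forall>h\<in>carrier (gHom S i Y Z).
          gComp S i (j + k) W Y Z h (gComp S j k W X Y g f) =
          gComp S (i + j) k W X Z (gComp S i j X Y Z h g) f)"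

definition degree0_part :: "('o, 'm) gsemicat \<Rightarrow> ('o, 'm) semicat" where
  "degree0_part S = \<lparr>Ob = gOb S, Hom = gHom S 0, Comp = gComp S 0 0\<rparr>"

definition closed_graded_trace ::
  "nat \<Rightarrow> ('o, 'm) gsemicat \<Rightarrow> (nat \<Rightarrow> 'o \<Rightarrow> 'o \<Rightarrow> 'm \<Rightarrow> 'm) \<Rightarrow> ('o \<Rightarrow> 'm \<Rightarrow> complex) \<Rightarrow> bool" where
  "closed_graded_trace n S d T \<longleftrightarrow>
     (\<forall>X\<in>gOb S. linear_map (gHom S n X X) cfield (T X)) \<and>
     (\<forall>X\<in>gOb S. \<forall>k. Suc k = n \<longrightarrow> (\<forall>f\<in>carrier (gHom S k X X). T X (d k X X f) = 0)) \<and>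
     (\<forall>X\<in>gOb S. \<forall>Y\<in>gOb S. \<forall>i j. i + j = n \<longrightarrow>
        (\<forall>g\<in>carrier (gHom S i Y X). \<forall>g'\<in>carrier (gHom S j X Y).
           T X (gComp S i j X Y X g g') = (-1) ^ (i * j) * T Y (gComp S j i Y X Y g' g)))"

definition cycle_over ::
  "nat \<Rightarrow> ('o, 'm) semicat \<Rightarrow>
   ('p, 'n) gsemicat \<Rightarrow> (nat \<Rightarrow> 'p \<Rightarrow> 'p \<Rightarrow> 'n \<Rightarrow> 'n) \<Rightarrow> ('p \<Rightarrow> 'n \<Rightarrow> complex) \<Rightarrow>
   ('o \<Rightarrow> 'p) \<Rightarrow> ('o \<Rightarrow> 'o \<Rightarrow> 'm \<Rightarrow> 'n) \<Rightarrow> bool" where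
  "cycle_over n C S d T \<rho>0 \<rho>1 \<longleftrightarrow>
     dg_semicategory S d \<and> linear_category (degree0_part S) \<and>
     closed_graded_trace n S d T \<and> linear_semifunctor C (degree0_part S) \<rho>0 \<rho>1"


section \<open>Even Fredholm modules\<close>

record ('o, 'm, 'v) fredholm =
  fob :: "'o \<Rightarrow> 'v ghilb"
  fmor :: "'o \<Rightarrow> 'o \<Rightarrow> 'm \<Rightarrow> 'v \<Rightarrow> 'v"
  fop :: "'o \<Rightarrow> 'v \<Rightarrow> 'v"

text \<open>The graded commutator of \<open>F\<close> with an operator of degree \<open>k\<close>.\<close>

definition gcomm ::
  "('o, 'm, 'v) fredholm \<Rightarrow> nat \<Rightarrow> 'o \<Rightarrow> 'o \<Rightarrow> ('v \<Rightarrow> 'v) \<Rightarrow> ('v \<Rightarrow> 'v)" where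
  "gcomm M k X Y T =
     (let B = bop (fob M X) (fob M Y)
      in compose (carrier (fob M X)) (fop M Y) T
           \<ominus>\<^bsub>B\<^esub> (-1) ^ k \<odot>\<^bsub>B\<^esub> compose (carrier (fob M X)) T (fop M X))"

definition mcomm :: "('o, 'm, 'v) fredholm \<Rightarrow> 'o \<Rightarrow> 'o \<Rightarrow> 'm \<Rightarrow> ('v \<Rightarrow> 'v)" where
  "mcomm M X Y f = gcomm M 0 X Y (fmor M X Y f)"

definition even_fredholm_module ::
  "real \<Rightarrow> ('o, 'm) semicat \<Rightarrow> ('o, 'm, 'v) fredholm \<Rightarrow> bool" where
  "even_fredholm_module p C M \<longleftrightarrow>
     linear_functor C SHilb (fob M) (fmor M) \<and>
     (\<forall>X\<in>Ob C. \<forall>Y\<in>Ob C. \<forall>f\<in>carrier (Hom C X Y).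
        degree0_op (fob M X) (fob M Y) (fmor M X Y f)) \<and>
     (\<forall>X\<in>Ob C. fop M X \<in> carrier (bop (fob M X) (fob M X)) \<and>
        degree1_op (fob M X) (fob M X) (fop M X) \<and>
        compose (carrier (fob M X)) (fop M X) (fop M X) = id_op (fob M X)) \<and>
     (\<forall>X\<in>Ob C. \<forall>Y\<in>Ob C. \<forall>f\<in>carrier (Hom C X Y).
        mcomm M X Y f \<in> schatten p (fob M X) (fob M Y))"


section \<open>The cycle of an even Fredholm module\<close>

text \<open>\<open>comm_prod M X f j\<close> is the product of the commutators of \<open>F\<close> with \<open>f 1, \<dots>, f j\<close>, where
  \<open>f i\<close> goes from \<open>X (i + 1)\<close> to \<open>X i\<close>; it is an operator from the space of \<open>X (j + 1)\<close> to that of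
  \<open>X 1\<close>.\<close>

primrec comm_prod ::
  "('o, 'm, 'v) fredholm \<Rightarrow> (nat \<Rightarrow> 'o) \<Rightarrow> (nat \<Rightarrow> 'm) \<Rightarrow> nat \<Rightarrow> ('v \<Rightarrow> 'v)" where
  "comm_prod M X f 0 = id_op (fob M (X 1))"
| "comm_prod M X f (Suc j) =
     compose (carrier (fob M (X (j + 2)))) (comm_prod M X f j)
       (mcomm M (X (j + 2)) (X (j + 1)) (f (j + 1)))"

text \<open>The operator of \<open>f + \<mu>\<close>; the scalar enters only for endomorphisms.\<close>

definition unital_mor ::
  "('o, 'm, 'v) fredholm \<Rightarrow> 'o \<Rightarrow> 'o \<Rightarrow> 'm \<Rightarrow> complex \<Rightarrow> ('v \<Rightarrow> 'v)" where
  "unital_mor M X Y f \<mu> =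
     (let B = bop (fob M X) (fob M Y)
      in if X = Y then fmor M X Y f \<oplus>\<^bsub>B\<^esub> \<mu> \<odot>\<^bsub>B\<^esub> id_op (fob M X) else fmor M X Y f)"

definition omega_generators ::
  "('o, 'm) semicat \<Rightarrow> ('o, 'm, 'v) fredholm \<Rightarrow> nat \<Rightarrow> 'o \<Rightarrow> 'o \<Rightarrow> ('v \<Rightarrow> 'v) set" where
  "omega_generators C M j X Y =
     {compose (carrier (fob M X)) (unital_mor M (Z 1) Y f0 \<mu>) (comm_prod M Z f j) | Z f f0 \<mu>.
        (\<forall>i\<in>{1..j + 1}. Z i \<in> Ob C) \<and> Z (j + 1) = X \<and>
        (\<forall>i\<in>{1..j}. f i \<in> carrier (Hom C (Z (i + 1)) (Z i))) \<and>
        f0 \<in> carrier (Hom C (Z 1) Y)}"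

definition Omega ::
  "('o, 'm) semicat \<Rightarrow> ('o, 'm, 'v) fredholm \<Rightarrow> ('o, 'v \<Rightarrow> 'v) gsemicat" where
  "Omega C M =
     \<lparr>gOb = Ob C,
      gHom = (\<lambda>j X Y. (bop (fob M X) (fob M Y))
                \<lparr>carrier := lin_span (bop (fob M X) (fob M Y)) (omega_generators C M j X Y)\<rparr>),
      gComp = (\<lambda>i j X Y Z T S. compose (carrier (fob M X)) T S)\<rparr>"

text \<open>\<open>Tr_s\<close> on operators of degree \<open>k\<close>; meaningful when \<open>gcomm M k X X T\<close> is trace class.\<close>

definition supertrace :: "('o, 'm, 'v) fredholm \<Rightarrow> nat \<Rightarrow> 'o \<Rightarrow> ('v \<Rightarrow> 'v) \<Rightarrow> complex" where
  "supertrace M k X T =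
     1 / 2 * op_trace (fob M X)
       (compose (carrier (fob M X)) (grading_op (fob M X))
          (compose (carrier (fob M X)) (fop M X) (gcomm M k X X T)))"


section \<open>Cyclic cocycles\<close>

text \<open>An elementary tensor \<open>f 0 \<otimes> \<dots> \<otimes> f n\<close> is a list of morphisms together with the list of objects
  \<open>X 0, \<dots>, X n\<close>, where \<open>f i\<close> goes from \<open>X (i + 1)\<close> to \<open>X i\<close> and \<open>X (n + 1)\<close> is \<open>X 0\<close>.  By the universal
  properties of tensor products and direct sums, a linear functional on the direct sum over
  \<open>(X 0, \<dots>, X n)\<close> of these tensor products is a family of multilinear forms, and an identity
  between functionals holds if and only if it holds on all elementary tensors.\<close>

definition cyclic_chain :: "nat \<Rightarrow> ('o, 'm) semicat \<Rightarrow> 'o list \<Rightarrow> 'm list \<Rightarrow> bool" where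
  "cyclic_chain n C Xs fs \<longleftrightarrow>
     length Xs = n + 1 \<and> length fs = n + 1 \<and> set Xs \<subseteq> Ob C \<and>
     (\<forall>i\<le>n. fs ! i \<in> carrier (Hom C (Xs ! ((i + 1) mod (n + 1))) (Xs ! i)))"

definition cochain :: "nat \<Rightarrow> ('o, 'm) semicat \<Rightarrow> ('o list \<Rightarrow> 'm list \<Rightarrow> complex) \<Rightarrow> bool" where
  "cochain n C \<phi> \<longleftrightarrow>
     (\<forall>Xs fs. cyclic_chain n C Xs fs \<longrightarrow>
        (\<forall>i\<le>n. linear_map (Hom C (Xs ! ((i + 1) mod (n + 1))) (Xs ! i)) cfield
                  (\<lambda>g. \<phi> Xs (fs[i := g]))))"

text \<open>The coboundary of an \<open>n\<close>-cochain, evaluated on an elementary tensor of \<open>n + 2\<close> morphisms.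
  Composing \<open>f i\<close> with \<open>f (i + 1)\<close> removes the object \<open>X (i + 1)\<close>; composing \<open>f (n + 1)\<close> with \<open>f 0\<close>
  removes \<open>X 0\<close> and leaves the objects \<open>X (n + 1), X 1, \<dots>, X n\<close>.\<close>

definition hochschild_b ::
  "nat \<Rightarrow> ('o, 'm) semicat \<Rightarrow> ('o list \<Rightarrow> 'm list \<Rightarrow> complex) \<Rightarrow>
   'o list \<Rightarrow> 'm list \<Rightarrow> complex" where
  "hochschild_b n C \<phi> Xs fs =
     (\<Sum>i\<le>n. (-1) ^ i *
        \<phi> (take (i + 1) Xs @ drop (i + 2) Xs)
          (take i fs
            @ [Comp C (Xs ! ((i + 2) mod (n + 2))) (Xs ! (i + 1)) (Xs ! i) (fs ! i) (fs ! (i + 1))]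
            @ drop (i + 2) fs))
     + (-1) ^ (n + 1) *
        \<phi> ((Xs ! (n + 1)) # drop 1 (take (n + 1) Xs))
          (Comp C (Xs ! 1) (Xs ! 0) (Xs ! (n + 1)) (fs ! (n + 1)) (fs ! 0)
            # drop 1 (take (n + 1) fs))"

definition cyclic_op ::
  "nat \<Rightarrow> ('o list \<Rightarrow> 'm list \<Rightarrow> complex) \<Rightarrow> 'o list \<Rightarrow> 'm list \<Rightarrow> complex" where
  "cyclic_op n \<phi> Xs fs =
     (-1) ^ n * \<phi> ((Xs ! n) # take n Xs) ((fs ! n) # take n fs)"

definition cyclic_cocycle ::
  "nat \<Rightarrow> ('o, 'm) semicat \<Rightarrow> ('o list \<Rightarrow> 'm list \<Rightarrow> complex) \<Rightarrow> bool" where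
  "cyclic_cocycle n C \<phi> \<longleftrightarrow>
     cochain n C \<phi> \<and>
     (\<forall>Xs fs. cyclic_chain (n + 1) C Xs fs \<longrightarrow> hochschild_b n C \<phi> Xs fs = 0) \<and>
     (\<forall>Xs fs. cyclic_chain n C Xs fs \<longrightarrow> cyclic_op n \<phi> Xs fs = \<phi> Xs fs)"

definition fredholm_cocycle ::
  "('o, 'm, 'v) fredholm \<Rightarrow> nat \<Rightarrow> 'o list \<Rightarrow> 'm list \<Rightarrow> complex" where
  "fredholm_cocycle M n Xs fs =
     (let X = (\<lambda>i. Xs ! (i mod (n + 1)))
      in supertrace M n (X 0)
           (compose (carrier (fob M (X 0))) (fmor M (X 1) (X 0) (fs ! 0))
              (comm_prod M X (\<lambda>i. fs ! i) n)))"

end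

theory Submission
  imports Defs
begin

text \<open>Schatten classes are handled through Gelfand numbers: \<open>T\<close> has Gelfand numbers at most
  \<open>C * u n powr \<theta>\<close> for a summable decreasing \<open>u\<close>.  Such bounds add up along sums and their exponents
  \<open>\<theta>\<close> add under composition, which replaces Hoelder's inequality: a product of \<open>j\<close> commutators in the
  \<open>p\<close>-th Schatten class has exponent \<open>j / p\<close>, hence is of trace class once \<open>j \<ge> p\<close>.  The spectral
  theorem for \<open>T* T\<close> translates between this and the definition by eigenbases.  For the trace property
  \<open>Tr (A B) = Tr (B A)\<close>, both sides are compared term by term in an eigenbasis of \<open>A* A\<close>.

  The cycle is then algebraic: \<open>[F, f] g = [F, f g] - f [F, g]\<close> closes the spaces of forms under
  composition, and \<open>F\<close> and the grading both commute with \<open>[F, T]\<close> up to the same sign.  The Hochschild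
  coboundary of the cocycle telescopes by the Leibniz rule down to a trace of a commutator, and its
  cyclicity is the closedness of the trace at \<open>f n f 0 [F, f 1] \<dots> [F, f (n - 1)]\<close>.\<close>

text \<open>The spaces are records with explicit carriers, so vector identities are settled by
  testing against an arbitrary vector (\<open>hs_eqI\<close>), which turns them into complex
  arithmetic, and operator identities are settled pointwise (\<open>bop_eqI\<close>). Gelfand
  numbers suit the estimates because they are given by finitely many linear constraints: those of
  two summands are united, those of an outer factor are pulled back along the adjoint of the inner
  one, and no two eigenbases have to be compared. The price is that \<open>n\<close> constraints are
  shared between two operators, hence the index \<open>n div 2\<close> in the majorants. The
  condition on \<open>m\<close> does not make a form of degree \<open>2 * m\<close> trace class.
  Only its commutator with \<open>F\<close>, of degree \<open>2 * m + 1\<close>, has to be, and the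
  supertrace sees nothing else. Accordingly the trace property is applied to products with one
  factor that is already a commutator and is annihilated by a further one. The adjoint, the trace
  and the grading operator are definite descriptions, and each needs an existence and uniqueness
  argument before it can be computed with.\<close>

lemma cfield_simps [simp]:
  "carrier cfield = UNIV" "mult cfield = (*)" "one cfield = 1" "zero cfield = 0"
  "add cfield = (+)" "smult cfield = (*)"
  by (simp_all add: cfield_def)

lemma cring_cfield: "cring cfield"
proof (intro cringI abelian_groupI comm_monoidI)
  fix x assume "x \<in> carrier cfield"
  show "\<exists>y\<in>carrier cfield. y \<oplus>\<^bsub>cfield\<^esub> x = \<zero>\<^bsub>cfield\<^esub>"
    by (rule bexI[of _ "- x"]) auto
qed (auto simp: algebra_simps)

lemma a_inv_cfield [simp]: "\<ominus>\<^bsub>cfield\<^esub> c = - c"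
proof -
  interpret cring cfield by (rule cring_cfield)
  show ?thesis by (rule minus_equality) auto
qed

section \<open>Inner product calculus, Cauchy-Schwarz and limits on carriers\<close>

section \<open>Hilbert spaces\<close>

lemma hs_module: "hilbert_space H \<Longrightarrow> module cfield H"
  by (simp add: hilbert_space_def)

lemma hs_abelian_group: "hilbert_space H \<Longrightarrow> abelian_group H"
  by (simp add: hilbert_space_def module_def)

lemma hs_zero [simp]: "hilbert_space H \<Longrightarrow> \<zero>\<^bsub>H\<^esub> \<in> carrier H"
  using hs_abelian_group[of H] by (simp add: abelian_group_def abelian_monoid.zero_closed)

lemma hs_add [simp]:
  "hilbert_space H \<Longrightarrow> x \<in> carrier H \<Longrightarrow> y \<in> carrier H \<Longrightarrow> x \<oplus>\<^bsub>H\<^esub> y \<in> carrier H"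
  using hs_abelian_group[of H] by (simp add: abelian_group_def abelian_monoid.a_closed)

lemma hs_minus [simp]:
  "hilbert_space H \<Longrightarrow> x \<in> carrier H \<Longrightarrow> y \<in> carrier H \<Longrightarrow> x \<ominus>\<^bsub>H\<^esub> y \<in> carrier H"
  using hs_abelian_group[of H] by (simp add: abelian_group.minus_closed)

lemma hs_uminus [simp]: "hilbert_space H \<Longrightarrow> x \<in> carrier H \<Longrightarrow> \<ominus>\<^bsub>H\<^esub> x \<in> carrier H"
  using hs_abelian_group[of H] by (simp add: abelian_group.a_inv_closed)

lemma hs_smult [simp]: "hilbert_space H \<Longrightarrow> x \<in> carrier H \<Longrightarrow> c \<odot>\<^bsub>H\<^esub> x \<in> carrier H"
  using module.smult_closed[OF hs_module, of H c x] by simp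

lemma hs_finsum [simp]:
  assumes "hilbert_space H" "\<And>a. a \<in> A \<Longrightarrow> f a \<in> carrier H"
  shows "finsum H f A \<in> carrier H"
proof -
  interpret abelian_group H by (rule hs_abelian_group) fact
  show ?thesis by (rule finsum_closed) (use assms(2) in blast)
qed

lemma hinner_linear:
  "hilbert_space H \<Longrightarrow> y \<in> carrier H \<Longrightarrow> linear_map H cfield (\<lambda>x. hinner H x y)"
  unfolding hilbert_space_def by blast

lemma hinner_add_left [simp]:
  "hilbert_space H \<Longrightarrow> x \<in> carrier H \<Longrightarrow> y \<in> carrier H \<Longrightarrow> z \<in> carrier H \<Longrightarrow>
    hinner H (x \<oplus>\<^bsub>H\<^esub> y) z = hinner H x z + hinner H y z"
  using hinner_linear[of H z] by (simp add: linear_map_def)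

lemma hinner_smult_left [simp]:
  "hilbert_space H \<Longrightarrow> x \<in> carrier H \<Longrightarrow> z \<in> carrier H \<Longrightarrow>
    hinner H (c \<odot>\<^bsub>H\<^esub> x) z = c * hinner H x z"
  using hinner_linear[of H z] by (simp add: linear_map_def)

lemma hinner_commute:
  "hilbert_space H \<Longrightarrow> x \<in> carrier H \<Longrightarrow> y \<in> carrier H \<Longrightarrow> hinner H y x = cnj (hinner H x y)"
  unfolding hilbert_space_def by blast

lemma hinner_pos:
  "hilbert_space H \<Longrightarrow> x \<in> carrier H \<Longrightarrow> x \<noteq> \<zero>\<^bsub>H\<^esub> \<Longrightarrow> Re (hinner H x x) > 0"
  unfolding hilbert_space_def by blast

lemma hs_smult_zero: "hilbert_space H \<Longrightarrow> x \<in> carrier H \<Longrightarrow> 0 \<odot>\<^bsub>H\<^esub> x = \<zero>\<^bsub>H\<^esub>"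
  using module.smult_l_null[OF hs_module, of H x] by simp

lemma hs_uminus_smult:
  assumes "hilbert_space H" "x \<in> carrier H" shows "\<ominus>\<^bsub>H\<^esub> x = (- 1) \<odot>\<^bsub>H\<^esub> x"
proof -
  interpret module cfield H by (rule hs_module) fact
  show ?thesis using smult_l_minus[of 1 x] smult_one[of x] assms by simp
qed

lemma hs_minus_smult:
  assumes "hilbert_space H" "x \<in> carrier H" "y \<in> carrier H"
  shows "x \<ominus>\<^bsub>H\<^esub> y = x \<oplus>\<^bsub>H\<^esub> (- 1) \<odot>\<^bsub>H\<^esub> y"
  using assms by (simp add: a_minus_def hs_uminus_smult)

lemma hinner_zero_left [simp]:
  "hilbert_space H \<Longrightarrow> z \<in> carrier H \<Longrightarrow> hinner H \<zero>\<^bsub>H\<^esub> z = 0"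
  using hinner_smult_left[of H "\<zero>\<^bsub>H\<^esub>" z 0] by (simp add: hs_smult_zero)

lemma hinner_minus_left [simp]:
  "hilbert_space H \<Longrightarrow> x \<in> carrier H \<Longrightarrow> y \<in> carrier H \<Longrightarrow> z \<in> carrier H \<Longrightarrow>
    hinner H (x \<ominus>\<^bsub>H\<^esub> y) z = hinner H x z - hinner H y z"
  by (simp add: hs_minus_smult)

lemma hinner_uminus_left [simp]:
  "hilbert_space H \<Longrightarrow> x \<in> carrier H \<Longrightarrow> z \<in> carrier H \<Longrightarrow>
    hinner H (\<ominus>\<^bsub>H\<^esub> x) z = - hinner H x z"
  by (simp add: hs_uminus_smult)

text \<open>Finite and infinite index sets are treated alike, because both sums default to zero on
  an infinite set.\<close>

lemma hinner_finsum_left [simp]: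
  assumes "hilbert_space H" "\<And>a. a \<in> A \<Longrightarrow> f a \<in> carrier H" "z \<in> carrier H"
  shows "hinner H (finsum H f A) z = (\<Sum>a\<in>A. hinner H (f a) z)"
proof -
  interpret abelian_monoid H
    using hs_abelian_group[OF assms(1)] by (simp add: abelian_group_def)
  show ?thesis
    using assms(2)
  proof (induction A rule: infinite_finite_induct)
    case (insert a A)
    then have "finsum H f (insert a A) = f a \<oplus>\<^bsub>H\<^esub> finsum H f A"
      by (intro finsum_insert) auto
    with insert assms show ?case by simp
  qed (use assms in auto)
qed

lemma hinner_add_right [simp]:
  "hilbert_space H \<Longrightarrow> x \<in> carrier H \<Longrightarrow> y \<in> carrier H \<Longrightarrow> z \<in> carrier H \<Longrightarrow>
    hinner H z (x \<oplus>\<^bsub>H\<^esub> y) = hinner H z x + hinner H z y"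
  by (simp add: hinner_commute[of H _ z])

lemma hinner_smult_right [simp]:
  "hilbert_space H \<Longrightarrow> x \<in> carrier H \<Longrightarrow> z \<in> carrier H \<Longrightarrow>
    hinner H z (c \<odot>\<^bsub>H\<^esub> x) = cnj c * hinner H z x"
  by (simp add: hinner_commute[of H _ z])

lemma hinner_zero_right [simp]:
  "hilbert_space H \<Longrightarrow> z \<in> carrier H \<Longrightarrow> hinner H z \<zero>\<^bsub>H\<^esub> = 0"
  by (simp add: hinner_commute[of H _ z])

lemma hinner_minus_right [simp]:
  "hilbert_space H \<Longrightarrow> x \<in> carrier H \<Longrightarrow> y \<in> carrier H \<Longrightarrow> z \<in> carrier H \<Longrightarrow>
    hinner H z (x \<ominus>\<^bsub>H\<^esub> y) = hinner H z x - hinner H z y"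
  by (simp add: hinner_commute[of H _ z])

lemma hinner_uminus_right [simp]:
  "hilbert_space H \<Longrightarrow> x \<in> carrier H \<Longrightarrow> z \<in> carrier H \<Longrightarrow>
    hinner H z (\<ominus>\<^bsub>H\<^esub> x) = - hinner H z x"
  by (simp add: hs_uminus_smult)

lemma hinner_finsum_right [simp]:
  assumes "hilbert_space H" "\<And>a. a \<in> A \<Longrightarrow> f a \<in> carrier H" "z \<in> carrier H"
  shows "hinner H z (finsum H f A) = (\<Sum>a\<in>A. hinner H z (f a))"
proof -
  have "hinner H z (finsum H f A) = cnj (\<Sum>a\<in>A. hinner H (f a) z)"
    using assms by (subst hinner_commute[of H _ z]) auto
  also have "\<dots> = (\<Sum>a\<in>A. hinner H z (f a))"
    unfolding cnj_sum by (rule sum.cong) (use assms in \<open>auto simp: hinner_commute[of H _ z]\<close>)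
  finally show ?thesis .
qed

lemma hinner_self_zero_iff:
  "hilbert_space H \<Longrightarrow> x \<in> carrier H \<Longrightarrow> Re (hinner H x x) = 0 \<longleftrightarrow> x = \<zero>\<^bsub>H\<^esub>"
  using hinner_pos[of H x] by fastforce

lemma hinner_self_nonneg: "hilbert_space H \<Longrightarrow> x \<in> carrier H \<Longrightarrow> 0 \<le> Re (hinner H x x)"
  using hinner_pos[of H x] by (cases "x = \<zero>\<^bsub>H\<^esub>") auto

lemma hnorm_nonneg [simp]: "hilbert_space H \<Longrightarrow> x \<in> carrier H \<Longrightarrow> 0 \<le> hnorm H x"
  by (simp add: hnorm_def hinner_self_nonneg)

lemma hnorm_sq: "hilbert_space H \<Longrightarrow> x \<in> carrier H \<Longrightarrow> (hnorm H x)\<^sup>2 = Re (hinner H x x)"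
  by (simp add: hnorm_def hinner_self_nonneg)

lemma hinner_self:
  assumes "hilbert_space H" "x \<in> carrier H"
  shows "hinner H x x = complex_of_real ((hnorm H x)\<^sup>2)"
proof -
  have "Im (hinner H x x) = 0"
    using hinner_commute[of H x x] assms by (metis Reals_cnj_iff complex_is_Real_iff)
  then show ?thesis by (simp add: hnorm_sq assms complex_eq_iff)
qed

lemma hnorm_eq_zero [simp]:
  "hilbert_space H \<Longrightarrow> x \<in> carrier H \<Longrightarrow> hnorm H x = 0 \<longleftrightarrow> x = \<zero>\<^bsub>H\<^esub>"
  by (simp add: hnorm_def hinner_self_zero_iff)

lemma hnorm_zero [simp]: "hilbert_space H \<Longrightarrow> hnorm H \<zero>\<^bsub>H\<^esub> = 0"
  by simp

text \<open>With the simp rules for \<open>hinner\<close>, this reduces identities between vectors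
  to identities between complex numbers.\<close>

lemma hs_eqI:
  assumes "hilbert_space H" "x \<in> carrier H" "y \<in> carrier H"
    and "\<And>z. z \<in> carrier H \<Longrightarrow> hinner H x z = hinner H y z"
  shows "x = y"
proof -
  interpret abelian_group H by (rule hs_abelian_group) fact
  \<comment> \<open>The right argument is kept whole, so that the hypothesis applies with the
    difference itself as test vector.\<close>
  have "hinner H (x \<ominus>\<^bsub>H\<^esub> y) (x \<ominus>\<^bsub>H\<^esub> y) = 0"
    using assms by (simp del: hinner_minus_right)
  then have "x \<ominus>\<^bsub>H\<^esub> y = \<zero>\<^bsub>H\<^esub>"
    using hinner_self_zero_iff[of H "x \<ominus>\<^bsub>H\<^esub> y"] assms by simp
  then show ?thesis using assms by (metis a_minus_def minus_equality minus_minus add.inv_closed hs_uminus)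
qed

lemma hnorm_smult [simp]:
  assumes "hilbert_space H" "x \<in> carrier H" shows "hnorm H (c \<odot>\<^bsub>H\<^esub> x) = cmod c * hnorm H x"
proof -
  have "(hnorm H (c \<odot>\<^bsub>H\<^esub> x))\<^sup>2 = Re (c * cnj c * hinner H x x)"
    using assms by (simp add: hnorm_sq algebra_simps)
  also have "\<dots> = (cmod c * hnorm H x)\<^sup>2"
    unfolding hinner_self[OF assms] complex_norm_square[symmetric]
    by (metis Re_complex_of_real of_real_mult power_mult_distrib)
  finally show ?thesis using assms by (simp add: power2_eq_iff_nonneg)
qed

lemma hnorm_minus_commute:
  assumes "hilbert_space H" "x \<in> carrier H" "y \<in> carrier H"
  shows "hnorm H (x \<ominus>\<^bsub>H\<^esub> y) = hnorm H (y \<ominus>\<^bsub>H\<^esub> x)"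
  using assms by (simp add: hnorm_def)

lemma hnorm_add_sq:
  assumes "hilbert_space H" "x \<in> carrier H" "y \<in> carrier H"
  shows "(hnorm H (x \<oplus>\<^bsub>H\<^esub> y))\<^sup>2 = (hnorm H x)\<^sup>2 + (hnorm H y)\<^sup>2 + 2 * Re (hinner H x y)"
  using assms hinner_commute[of H x y] by (simp add: hnorm_sq)

lemma hnorm_minus_sq:
  assumes "hilbert_space H" "x \<in> carrier H" "y \<in> carrier H"
  shows "(hnorm H (x \<ominus>\<^bsub>H\<^esub> y))\<^sup>2 = (hnorm H x)\<^sup>2 + (hnorm H y)\<^sup>2 - 2 * Re (hinner H x y)"
  using assms hinner_commute[of H x y] by (simp add: hnorm_sq)

lemma cauchy_schwarz:
  assumes "hilbert_space H" "x \<in> carrier H" "y \<in> carrier H"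
  shows "cmod (hinner H x y) \<le> hnorm H x * hnorm H y"
proof (cases "y = \<zero>\<^bsub>H\<^esub>")
  case False
  \<comment> \<open>The coefficient of the orthogonal projection of \<open>x\<close> onto the line
    of \<open>y\<close>; the squared norm of the remainder being nonnegative is the
    inequality.\<close>
  define c where "c = hinner H x y / hinner H y y"
  have y: "hnorm H y > 0"
    using False assms by (metis hnorm_eq_zero hnorm_nonneg less_eq_real_def)
  have "hinner H (x \<ominus>\<^bsub>H\<^esub> c \<odot>\<^bsub>H\<^esub> y) (x \<ominus>\<^bsub>H\<^esub> c \<odot>\<^bsub>H\<^esub> y)
      = hinner H x x - hinner H x y * cnj (hinner H x y) / hinner H y y"
    using assms y by (simp add: c_def hinner_self[of H y] hinner_commute[of H x y] field_simps power2_eq_square)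
  also have "\<dots> = of_real ((hnorm H x)\<^sup>2 - (cmod (hinner H x y))\<^sup>2 / (hnorm H y)\<^sup>2)"
    using assms by (simp add: hinner_self flip: complex_norm_square)
  finally have "0 \<le> (hnorm H x)\<^sup>2 - (cmod (hinner H x y))\<^sup>2 / (hnorm H y)\<^sup>2"
    using hinner_self_nonneg[of H "x \<ominus>\<^bsub>H\<^esub> c \<odot>\<^bsub>H\<^esub> y"] assms by simp
  then have "(cmod (hinner H x y))\<^sup>2 \<le> (hnorm H x * hnorm H y)\<^sup>2"
    using y by (simp add: field_simps power_mult_distrib)
  then show ?thesis by (rule power2_le_imp_le) (use assms in auto)
qed (use assms in simp)

lemma hnorm_triangle:
  assumes "hilbert_space H" "x \<in> carrier H" "y \<in> carrier H"
  shows "hnorm H (x \<oplus>\<^bsub>H\<^esub> y) \<le> hnorm H x + hnorm H y"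
proof (rule power2_le_imp_le)
  have "Re (hinner H x y) \<le> hnorm H x * hnorm H y"
    using cauchy_schwarz[OF assms] complex_Re_le_cmod order_trans by blast
  then show "(hnorm H (x \<oplus>\<^bsub>H\<^esub> y))\<^sup>2 \<le> (hnorm H x + hnorm H y)\<^sup>2"
    using assms by (simp add: hnorm_add_sq power2_sum)
qed (use assms in auto)

lemma hnorm_diff_le:
  assumes "hilbert_space H" "x \<in> carrier H" "y \<in> carrier H"
  shows "\<bar>hnorm H x - hnorm H y\<bar> \<le> hnorm H (x \<ominus>\<^bsub>H\<^esub> y)"
proof -
  have "x = (x \<ominus>\<^bsub>H\<^esub> y) \<oplus>\<^bsub>H\<^esub> y" "y = (y \<ominus>\<^bsub>H\<^esub> x) \<oplus>\<^bsub>H\<^esub> x"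
    using assms by (auto intro!: hs_eqI[of H])
  then show ?thesis
    using hnorm_triangle[of H "x \<ominus>\<^bsub>H\<^esub> y" y] hnorm_triangle[of H "y \<ominus>\<^bsub>H\<^esub> x" x]
      hnorm_minus_commute[of H x y] assms by auto
qed

text \<open>The epsilon form of unconditional summation, into which a norm estimate for finite
  partial sums can be inserted directly.\<close>

lemma has_sum_metric:
  fixes l :: "'a :: {metric_space, comm_monoid_add}"
  shows "(f has_sum l) A \<longleftrightarrow> (\<forall>e. e > 0 \<longrightarrow> (\<exists>X. finite X \<and> X \<subseteq> A \<and>
      (\<forall>Y. finite Y \<and> X \<subseteq> Y \<and> Y \<subseteq> A \<longrightarrow> dist (sum f Y) l < e)))"
  unfolding has_sum_def tendsto_iff eventually_finite_subsets_at_top by blast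

lemma nonneg_bounded_summable_on:
  fixes f :: "'a \<Rightarrow> real"
  assumes "\<And>x. x \<in> A \<Longrightarrow> 0 \<le> f x" "\<And>F. finite F \<Longrightarrow> F \<subseteq> A \<Longrightarrow> sum f F \<le> C"
  shows "f summable_on A"
  by (rule nonneg_bdd_above_summable_on) (use assms in \<open>auto simp: bdd_above_def\<close>)

lemma hs_complete:
  assumes "hilbert_space H" "\<And>n. s n \<in> carrier H"
    and "\<And>e. e > 0 \<Longrightarrow> \<exists>N. \<forall>m\<ge>N. \<forall>n\<ge>N. hnorm H (s m \<ominus>\<^bsub>H\<^esub> s n) < e"
  obtains l where "l \<in> carrier H" "(\<lambda>n. hnorm H (s n \<ominus>\<^bsub>H\<^esub> l)) \<longlonglongrightarrow> 0"
  using assms unfolding hilbert_space_def by blast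

lemma hinner_tendsto:
  assumes "hilbert_space H" "\<And>n. s n \<in> carrier H" "l \<in> carrier H" "y \<in> carrier H"
    and "(\<lambda>n. hnorm H (s n \<ominus>\<^bsub>H\<^esub> l)) \<longlonglongrightarrow> 0"
  shows "(\<lambda>n. hinner H (s n) y) \<longlonglongrightarrow> hinner H l y"
proof (rule LIM_zero_cancel, rule Lim_null_comparison)
  show "\<forall>\<^sub>F n in sequentially. norm (hinner H (s n) y - hinner H l y) \<le>
      hnorm H (s n \<ominus>\<^bsub>H\<^esub> l) * hnorm H y"
    using assms cauchy_schwarz[of H "s n \<ominus>\<^bsub>H\<^esub> l" y for n] by simp
  show "(\<lambda>n. hnorm H (s n \<ominus>\<^bsub>H\<^esub> l) * hnorm H y) \<longlonglongrightarrow> 0"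
    by (rule tendsto_mult_left_zero) fact
qed

lemma hnorm_tendsto:
  assumes "hilbert_space H" "\<And>n. s n \<in> carrier H" "l \<in> carrier H"
    and "(\<lambda>n. hnorm H (s n \<ominus>\<^bsub>H\<^esub> l)) \<longlonglongrightarrow> 0"
  shows "(\<lambda>n. hnorm H (s n)) \<longlonglongrightarrow> hnorm H l"
proof (rule LIM_zero_cancel, rule Lim_null_comparison)
  show "\<forall>\<^sub>F n in sequentially. norm (hnorm H (s n) - hnorm H l) \<le> hnorm H (s n \<ominus>\<^bsub>H\<^esub> l)"
    using assms hnorm_diff_le[of H "s n" l for n] by simp
qed fact

section \<open>Orthonormal systems: Bessel, Riesz-Fischer, Parseval, and bases by Zorn's
  lemma\<close>

section \<open>Orthonormal systems\<close>

definition orthonormal :: "('v, 'r) hilb_scheme \<Rightarrow> 'v set \<Rightarrow> bool" where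
  "orthonormal H S \<longleftrightarrow> S \<subseteq> carrier H \<and>
     (\<forall>e\<in>S. \<forall>e'\<in>S. hinner H e e' = (if e = e' then 1 else 0))"

definition lincomb :: "('v, 'r) hilb_scheme \<Rightarrow> ('v \<Rightarrow> complex) \<Rightarrow> 'v set \<Rightarrow> 'v" where
  "lincomb H c A = finsum H (\<lambda>e. c e \<odot>\<^bsub>H\<^esub> e) A"

lemma orthonormal_basis_alt:
  "orthonormal_basis H E \<longleftrightarrow>
     orthonormal H E \<and> (\<forall>x\<in>carrier H. (\<forall>e\<in>E. hinner H x e = 0) \<longrightarrow> x = \<zero>\<^bsub>H\<^esub>)"
  by (auto simp: orthonormal_basis_def orthonormal_def)

lemma orthonormal_carrier: "orthonormal H S \<Longrightarrow> e \<in> S \<Longrightarrow> e \<in> carrier H"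
  by (auto simp: orthonormal_def)

lemma orthonormal_subset: "orthonormal H S \<Longrightarrow> A \<subseteq> S \<Longrightarrow> orthonormal H A"
  unfolding orthonormal_def by blast

lemma orthonormal_hnorm: "orthonormal H S \<Longrightarrow> e \<in> S \<Longrightarrow> hnorm H e = 1"
  by (simp add: orthonormal_def hnorm_def)

lemma lincomb_closed [simp]:
  "hilbert_space H \<Longrightarrow> A \<subseteq> carrier H \<Longrightarrow> lincomb H c A \<in> carrier H"
  unfolding lincomb_def by (rule hs_finsum) auto

lemma hinner_lincomb_left:
  assumes "hilbert_space H" "A \<subseteq> carrier H" "z \<in> carrier H"
  shows "hinner H (lincomb H c A) z = (\<Sum>e\<in>A. c e * hinner H e z)"
proof -
  have "\<And>a. a \<in> A \<Longrightarrow> a \<in> carrier H" using assms by auto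
  then show ?thesis using assms by (simp add: lincomb_def)
qed

lemma hinner_lincomb_orthonormal:
  assumes "hilbert_space H" "orthonormal H S" "finite A" "A \<subseteq> S" "e \<in> S"
  shows "hinner H (lincomb H c A) e = (if e \<in> A then c e else 0)"
proof -
  have "hinner H (lincomb H c A) e = (\<Sum>a\<in>A. c a * hinner H a e)"
    using assms by (intro hinner_lincomb_left) (auto simp: orthonormal_def)
  also have "\<dots> = (\<Sum>a\<in>A. if a = e then c a else 0)"
    using assms by (intro sum.cong) (auto simp: orthonormal_def)
  finally show ?thesis using assms by simp
qed

lemma hnorm_lincomb:
  assumes "hilbert_space H" "orthonormal H A" "finite A"
  shows "(hnorm H (lincomb H c A))\<^sup>2 = (\<Sum>e\<in>A. (cmod (c e))\<^sup>2)"
proof -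
  have A: "A \<subseteq> carrier H" using assms by (simp add: orthonormal_def)
  have "hinner H (lincomb H c A) (lincomb H c A) = (\<Sum>e\<in>A. c e * hinner H e (lincomb H c A))"
    using assms A by (intro hinner_lincomb_left) auto
  also have "\<dots> = (\<Sum>e\<in>A. of_real ((cmod (c e))\<^sup>2))"
  proof (rule sum.cong)
    fix e assume "e \<in> A"
    then have "hinner H e (lincomb H c A) = cnj (c e)"
      using assms A hinner_commute[of H "lincomb H c A" e] hinner_lincomb_orthonormal[of H A A e c]
      by auto
    then show "c e * hinner H e (lincomb H c A) = of_real ((cmod (c e))\<^sup>2)"
      by (simp only: complex_norm_square)
  qed simp
  finally have "hinner H (lincomb H c A) (lincomb H c A) = of_real (\<Sum>e\<in>A. (cmod (c e))\<^sup>2)"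
    by simp
  then show ?thesis using assms A by (simp add: hnorm_sq)
qed

text \<open>The Fourier combination is the orthogonal projection onto the span of \<open>A\<close>.
  This exact distance yields Bessel's inequality, and in \<open>bop_parseval\<close> the convergence
  of the expansion.\<close>

lemma hnorm_minus_lincomb:
  assumes "hilbert_space H" "orthonormal H A" "finite A" "x \<in> carrier H"
  shows "(hnorm H (x \<ominus>\<^bsub>H\<^esub> lincomb H (hinner H x) A))\<^sup>2
    = (hnorm H x)\<^sup>2 - (\<Sum>e\<in>A. (cmod (hinner H x e))\<^sup>2)"
proof -
  let ?y = "lincomb H (hinner H x) A"
  have A: "A \<subseteq> carrier H" using assms by (simp add: orthonormal_def)
  have "hinner H ?y x = (\<Sum>e\<in>A. hinner H x e * hinner H e x)"
    using assms A by (intro hinner_lincomb_left) auto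
  also have "\<dots> = (\<Sum>e\<in>A. of_real ((cmod (hinner H x e))\<^sup>2))"
  proof (rule sum.cong)
    fix e assume "e \<in> A"
    then show "hinner H x e * hinner H e x = of_real ((cmod (hinner H x e))\<^sup>2)"
      using assms A hinner_commute[of H x e] by (metis complex_norm_square subsetD)
  qed simp
  finally have "Re (hinner H x ?y) = (\<Sum>e\<in>A. (cmod (hinner H x e))\<^sup>2)"
    using assms A hinner_commute[of H ?y x] by simp
  then show ?thesis
    using assms A by (simp add: hnorm_minus_sq hnorm_lincomb)
qed

lemma hinner_minus_lincomb:
  assumes "hilbert_space H" "orthonormal H A" "finite A" "x \<in> carrier H" "e \<in> A"
  shows "hinner H (x \<ominus>\<^bsub>H\<^esub> lincomb H (hinner H x) A) e = 0"
proof -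
  have A: "A \<subseteq> carrier H" using assms by (simp add: orthonormal_def)
  then have "e \<in> carrier H" using assms by auto
  then show ?thesis
    using assms A hinner_lincomb_orthonormal[of H A A e "hinner H x"] by simp
qed

lemma bessel:
  assumes "hilbert_space H" "orthonormal H S" "x \<in> carrier H" "finite A" "A \<subseteq> S"
  shows "(\<Sum>e\<in>A. (cmod (hinner H x e))\<^sup>2) \<le> (hnorm H x)\<^sup>2"
proof -
  have "orthonormal H A" using assms orthonormal_subset by blast
  then show ?thesis
    using hnorm_minus_lincomb[of H A x] assms zero_le_power2 by (metis diff_ge_0_iff_ge)
qed

lemma bessel_summable:
  assumes "hilbert_space H" "orthonormal H S" "x \<in> carrier H"
  shows "(\<lambda>e. (cmod (hinner H x e))\<^sup>2) summable_on S"
  by (rule nonneg_bounded_summable_on, simp, rule bessel[OF assms])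

text \<open>Completeness is available for sequences while \<open>S\<close> may be uncountable, so
  the vector is built as the limit of combinations over a sequence of finite sets \<open>F n\<close>
  that carry all but \<open>1 / (n + 1)\<close> of the total sum.\<close>

lemma riesz_fischer:
  assumes H: "hilbert_space H" and S: "orthonormal H S"
    and c: "(\<lambda>e. (cmod (c e))\<^sup>2) summable_on S"
  obtains x where "x \<in> carrier H" "\<And>e. e \<in> S \<Longrightarrow> hinner H x e = c e"
    "(hnorm H x)\<^sup>2 = (\<Sum>\<^sub>\<infinity>e\<in>S. (cmod (c e))\<^sup>2)"
proof -
  let ?g = "\<lambda>e. (cmod (c e))\<^sup>2"
  let ?t = "infsum ?g S"
  have "\<exists>F. finite F \<and> F \<subseteq> S \<and> dist (sum ?g F) ?t < 1 / real (n + 1)" for n :: nat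
  proof -
    \<comment> \<open>The approximation comes with a weak inequality; asking for half the error
      makes it strict.\<close>
    obtain F where F: "finite F" "F \<subseteq> S" "dist (sum ?g F) ?t \<le> 1 / (2 * real (n + 1))"
      using infsum_finite_approximation[OF c, of "1 / (2 * real (n + 1))"] by auto
    have "1 / (2 * real (n + 1)) < 1 / real (n + 1)" by (simp add: field_simps)
    from le_less_trans[OF F(3) this] F(1,2) show ?thesis by blast
  qed
  then obtain F where F: "\<And>n. finite (F n)" "\<And>n. F n \<subseteq> S"
      "\<And>n. dist (sum ?g (F n)) ?t < 1 / real (n + 1)"
    by metis
  \<comment> \<open>Adding a set disjoint from \<open>F n\<close> cannot push the partial sum above
    the total.\<close>
  have tail: "sum ?g A < 1 / real (n + 1)" if "finite A" "A \<subseteq> S" "A \<inter> F n = {}" for A n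
  proof -
    have "sum ?g (A \<union> F n) \<le> ?t"
      using that F c by (intro finite_sum_le_infsum) auto
    moreover have "sum ?g (A \<union> F n) = sum ?g A + sum ?g (F n)"
      using that F by (intro sum.union_disjoint) auto
    ultimately show ?thesis using F(3)[of n] by (auto simp: dist_real_def)
  qed
  have SH: "S \<subseteq> carrier H" using S by (simp add: orthonormal_def)
  have FH: "F n \<subseteq> carrier H" for n using F(2) SH by blast
  define s where "s n = lincomb H c (F n)" for n
  have sH: "s n \<in> carrier H" for n using FH H by (simp add: s_def)
  have inner: "hinner H (s n) e = (if e \<in> F n then c e else 0)" if "e \<in> S" for n e
    using that F S H unfolding s_def by (intro hinner_lincomb_orthonormal) auto
  \<comment> \<open>Written as one combination over the union, the difference has a norm given by
    Pythagoras, and the coefficients cancel on the common part.\<close>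
  have fd: "s m \<ominus>\<^bsub>H\<^esub> s n = lincomb H (\<lambda>e. (if e \<in> F m then c e else 0) - (if e \<in> F n then c e else 0))
      (F m \<union> F n)" (is "_ = lincomb H (?c m n) _") for m n
  proof (rule hs_eqI[OF H])
    fix z assume z: "z \<in> carrier H"
    have "hinner H (s m) z = (\<Sum>e\<in>F m \<union> F n. (if e \<in> F m then c e else 0) * hinner H e z)" for m n
      using z FH H F unfolding s_def
      by (subst hinner_lincomb_left) (auto intro!: sum.mono_neutral_cong_left)
    from this[of m n] this[of n m]
    show "hinner H (s m \<ominus>\<^bsub>H\<^esub> s n) z = hinner H (lincomb H (?c m n) (F m \<union> F n)) z"
      using z FH[of m] FH[of n] H sH
      by (simp add: hinner_lincomb_left Un_commute[of "F n"] left_diff_distrib sum_subtractf)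
  qed (use sH H FH in auto)
  have bound: "(hnorm H (s m \<ominus>\<^bsub>H\<^esub> s n))\<^sup>2 < 1 / real (m + 1) + 1 / real (n + 1)" for m n
  proof -
    have "(hnorm H (s m \<ominus>\<^bsub>H\<^esub> s n))\<^sup>2 = (\<Sum>e\<in>F m \<union> F n. (cmod (?c m n e))\<^sup>2)"
      unfolding fd using H F orthonormal_subset[OF S] by (intro hnorm_lincomb) auto
    also have "\<dots> = (\<Sum>e\<in>(F m - F n) \<union> (F n - F m). ?g e)"
      using F by (intro sum.mono_neutral_cong_right) auto
    also have "\<dots> = sum ?g (F m - F n) + sum ?g (F n - F m)"
      using F by (intro sum.union_disjoint) auto
    also have "\<dots> < 1 / real (n + 1) + 1 / real (m + 1)"
      using F by (intro add_strict_mono tail) auto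
    finally show ?thesis by simp
  qed
  obtain l where l: "l \<in> carrier H" "(\<lambda>n. hnorm H (s n \<ominus>\<^bsub>H\<^esub> l)) \<longlonglongrightarrow> 0"
  proof (rule hs_complete[OF H sH])
    fix e :: real assume e: "e > 0"
    obtain N where N: "1 / real (N + 1) < e\<^sup>2 / 2"
      using reals_Archimedean[of "e\<^sup>2 / 2"] e by (auto simp: inverse_eq_divide)
    have "hnorm H (s m \<ominus>\<^bsub>H\<^esub> s n) < e" if "m \<ge> N" "n \<ge> N" for m n
    proof -
      have "1 / real (m + 1) \<le> 1 / real (N + 1)" "1 / real (n + 1) \<le> 1 / real (N + 1)"
        using that by (auto simp: field_simps)
      with bound[of m n] N have "(hnorm H (s m \<ominus>\<^bsub>H\<^esub> s n))\<^sup>2 < e\<^sup>2" by linarith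
      then show ?thesis using e by (simp add: power2_less_imp_less)
    qed
    then show "\<exists>N. \<forall>m\<ge>N. \<forall>n\<ge>N. hnorm H (s m \<ominus>\<^bsub>H\<^esub> s n) < e" by blast
  qed
  show thesis
  proof
    show "l \<in> carrier H" by fact
  next
    fix e assume e: "e \<in> S"
    have "(\<lambda>n. hinner H (s n) e) \<longlonglongrightarrow> c e"
    proof (rule LIM_zero_cancel, rule Lim_null_comparison)
      show "\<forall>\<^sub>F n in sequentially. norm (hinner H (s n) e - c e) \<le> sqrt (1 / real (n + 1))"
      proof (intro always_eventually allI)
        fix n
        \<comment> \<open>While \<open>e\<close> is missing from \<open>F n\<close>, its own
          coefficient is part of the tail.\<close>
        have "?g e \<le> 1 / real (n + 1)" if "e \<notin> F n"
          using tail[of "{e}" n] e that by simp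
        then show "norm (hinner H (s n) e - c e) \<le> sqrt (1 / real (n + 1))"
          using inner[OF e, of n] by (auto intro: real_le_rsqrt)
      qed
      show "(\<lambda>n. sqrt (1 / real (n + 1))) \<longlonglongrightarrow> 0"
        using tendsto_real_sqrt[OF LIMSEQ_inverse_real_of_nat] by (simp add: inverse_eq_divide add.commute)
    qed
    moreover have "(\<lambda>n. hinner H (s n) e) \<longlonglongrightarrow> hinner H l e"
      using e SH l sH H by (intro hinner_tendsto) auto
    ultimately show "hinner H l e = c e" using LIMSEQ_unique by blast
  next
    have "(\<lambda>n. (hnorm H (s n))\<^sup>2) \<longlonglongrightarrow> (hnorm H l)\<^sup>2"
      using l sH H by (intro tendsto_power hnorm_tendsto)
    moreover have "(hnorm H (s n))\<^sup>2 = sum ?g (F n)" for n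
      unfolding s_def using H F orthonormal_subset[OF S] by (intro hnorm_lincomb) auto
    moreover have "(\<lambda>n. sum ?g (F n)) \<longlonglongrightarrow> ?t"
    proof (rule LIM_zero_cancel, rule Lim_null_comparison)
      show "\<forall>\<^sub>F n in sequentially. norm (sum ?g (F n) - ?t) \<le> inverse (real (Suc n))"
        using F(3) by (auto simp: dist_real_def inverse_eq_divide less_imp_le add.commute)
    qed (rule LIMSEQ_inverse_real_of_nat)
    ultimately show "(hnorm H l)\<^sup>2 = ?t" using LIMSEQ_unique by auto
  qed
qed

text \<open>Riesz-Fischer provides a vector with the same coefficients and the desired norm; its
  difference from \<open>x\<close> is orthogonal to the basis, hence zero.\<close>

lemma parseval:
  assumes H: "hilbert_space H" and E: "orthonormal_basis H E" and x: "x \<in> carrier H"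
  shows "((\<lambda>e. (cmod (hinner H x e))\<^sup>2) has_sum (hnorm H x)\<^sup>2) E"
proof -
  have o: "orthonormal H E" and EH: "E \<subseteq> carrier H"
    using E by (auto simp: orthonormal_basis_alt orthonormal_def)
  have s: "(\<lambda>e. (cmod (hinner H x e))\<^sup>2) summable_on E" by (rule bessel_summable) fact+
  obtain y where y: "y \<in> carrier H" "\<And>e. e \<in> E \<Longrightarrow> hinner H y e = hinner H x e"
    "(hnorm H y)\<^sup>2 = (\<Sum>\<^sub>\<infinity>e\<in>E. (cmod (hinner H x e))\<^sup>2)"
    using riesz_fischer[OF H o s] by blast
  have "x \<ominus>\<^bsub>H\<^esub> y = \<zero>\<^bsub>H\<^esub>"
  proof -
    have "hinner H (x \<ominus>\<^bsub>H\<^esub> y) e = 0" if "e \<in> E" for e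
      using that EH H x y subsetD[OF EH that] by simp
    then show ?thesis using E H x y by (auto simp: orthonormal_basis_alt)
  qed
  then have "hnorm H (x \<ominus>\<^bsub>H\<^esub> y) = 0" using H by simp
  then have "hnorm H x = hnorm H y" using hnorm_diff_le[of H x y] H x y by simp
  then show ?thesis using y s by simp
qed

text \<open>The side condition \<open>P\<close> serves twice: it is trivial for the existence of
  bases, and it is the eigenvector property in \<open>spectral_theorem\<close>. Both orders of the
  inner product occur because \<open>H\<close> is an arbitrary record here, without Hermitian
  symmetry.\<close>

lemma orthonormal_extend:
  assumes "orthonormal H S" "\<And>x. x \<in> S \<Longrightarrow> P x"
  obtains E where "S \<subseteq> E" "orthonormal H E" "\<And>x. x \<in> E \<Longrightarrow> P x"
    "\<And>x. x \<in> carrier H \<Longrightarrow> hinner H x x = 1 \<Longrightarrow> P x \<Longrightarrow> \<exists>e\<in>E. hinner H x e \<noteq> 0 \<or> hinner H e x \<noteq> 0"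
proof -
  let ?A = "{E. S \<subseteq> E \<and> orthonormal H E \<and> (\<forall>x\<in>E. P x)}"
  have "\<exists>E\<in>?A. \<forall>X\<in>?A. E \<subseteq> X \<longrightarrow> X = E"
  proof (rule subset_Zorn_nonempty)
    show "?A \<noteq> {}" using assms by auto
    fix \<C> assume ne: "\<C> \<noteq> {}" and ch: "subset.chain ?A \<C>"
    have sub: "\<And>X. X \<in> \<C> \<Longrightarrow> S \<subseteq> X \<and> orthonormal H X \<and> (\<forall>x\<in>X. P x)"
      using ch by (auto simp: subset.chain_def)
    \<comment> \<open>Two elements of the union of a chain already lie together in the larger of
      their two members.\<close>
    have "hinner H e e' = (if e = e' then 1 else 0)" if "e \<in> X" "X \<in> \<C>" "e' \<in> Y" "Y \<in> \<C>" for e e' X Y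
    proof -
      have "X \<subseteq> Y \<or> Y \<subseteq> X" using ch that by (auto simp: subset_chain_def)
      then show ?thesis using sub[OF that(2)] sub[OF that(4)] that unfolding orthonormal_def by blast
    qed
    moreover have "\<Union>\<C> \<subseteq> carrier H" using sub unfolding orthonormal_def by blast
    ultimately have "orthonormal H (\<Union>\<C>)" unfolding orthonormal_def by blast
    then show "\<Union>\<C> \<in> ?A" using sub ne by blast
  qed
  then obtain E where E: "S \<subseteq> E" "orthonormal H E" "\<forall>x\<in>E. P x"
    and max: "\<And>X. S \<subseteq> X \<Longrightarrow> orthonormal H X \<Longrightarrow> \<forall>x\<in>X. P x \<Longrightarrow> E \<subseteq> X \<Longrightarrow> X = E"
    by auto
  show thesis
  proof (rule that[of E])
    fix x assume x: "x \<in> carrier H" "hinner H x x = 1" "P x"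
    show "\<exists>e\<in>E. hinner H x e \<noteq> 0 \<or> hinner H e x \<noteq> 0"
    proof (rule ccontr)
      assume *: "\<not> ?thesis"
      then have "x \<notin> E" using x by auto
      moreover have "orthonormal H (insert x E)"
        using x E(2) * by (auto simp: orthonormal_def)
      ultimately show False using max[of "insert x E"] E x by auto
    qed
  qed (use E in auto)
qed

lemma hnorm_normalize:
  assumes "hilbert_space H" "x \<in> carrier H" "x \<noteq> \<zero>\<^bsub>H\<^esub>"
  shows "hinner H (of_real (1 / hnorm H x) \<odot>\<^bsub>H\<^esub> x) (of_real (1 / hnorm H x) \<odot>\<^bsub>H\<^esub> x) = 1"
  using assms by (simp add: hinner_self[of H x] power2_eq_square)

text \<open>A nonzero vector orthogonal to a maximal system could be normalized and adjoined, so
  maximality gives totality.\<close>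

lemma orthonormal_extend_basis:
  assumes H: "hilbert_space H" and "orthonormal H S"
  obtains E where "S \<subseteq> E" "orthonormal_basis H E"
proof -
  obtain E where E: "S \<subseteq> E" "orthonormal H E"
    "\<And>x. x \<in> carrier H \<Longrightarrow> hinner H x x = 1 \<Longrightarrow> \<exists>e\<in>E. hinner H x e \<noteq> 0 \<or> hinner H e x \<noteq> 0"
    using orthonormal_extend[OF assms(2), of "\<lambda>_. True"] by metis
  have "orthonormal_basis H E"
    unfolding orthonormal_basis_alt
  proof (intro conjI ballI impI E(2))
    fix x assume x: "x \<in> carrier H" "\<forall>e\<in>E. hinner H x e = 0"
    show "x = \<zero>\<^bsub>H\<^esub>"
    proof (rule ccontr)
      assume "x \<noteq> \<zero>\<^bsub>H\<^esub>"
      then have "\<exists>e\<in>E. hinner H (of_real (1 / hnorm H x) \<odot>\<^bsub>H\<^esub> x) e \<noteq> 0 \<or>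
          hinner H e (of_real (1 / hnorm H x) \<odot>\<^bsub>H\<^esub> x) \<noteq> 0"
        using hnorm_normalize[OF H x(1)] H x(1) by (intro E(3)) auto
      then obtain e where "e \<in> E" "hinner H e x \<noteq> 0"
        using x H orthonormal_carrier[OF E(2)] by auto
      then show False using x H orthonormal_carrier[OF E(2)] hinner_commute[of H x e] by auto
    qed
  qed
  with E(1) show thesis by (rule that)
qed

lemma ex_orthonormal_basis: "hilbert_space H \<Longrightarrow> \<exists>E. orthonormal_basis H E"
  using orthonormal_extend_basis[of H "{}"] by (auto simp: orthonormal_def)

section \<open>Bounded operators as a vector space, and their expansion along a basis\<close>

section \<open>Bounded operators\<close>

lemma bop_mem:
  "T \<in> carrier (bop H K) \<longleftrightarrow> T \<in> carrier H \<rightarrow>\<^sub>E carrier K \<and> linear_map H K T \<and>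
     (\<exists>B. \<forall>x\<in>carrier H. hnorm K (T x) \<le> B * hnorm H x)"
  by (simp add: bop_def)

lemma bopI:
  assumes "\<And>x. x \<in> carrier H \<Longrightarrow> T x \<in> carrier K" "T \<in> extensional (carrier H)"
    and "\<And>x y. x \<in> carrier H \<Longrightarrow> y \<in> carrier H \<Longrightarrow> T (x \<oplus>\<^bsub>H\<^esub> y) = T x \<oplus>\<^bsub>K\<^esub> T y"
    and "\<And>c x. x \<in> carrier H \<Longrightarrow> T (c \<odot>\<^bsub>H\<^esub> x) = c \<odot>\<^bsub>K\<^esub> T x"
    and "\<And>x. x \<in> carrier H \<Longrightarrow> hnorm K (T x) \<le> B * hnorm H x"
  shows "T \<in> carrier (bop H K)"
  unfolding bop_mem linear_map_def PiE_def using assms by blast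

lemma bop_closed [simp]: "T \<in> carrier (bop H K) \<Longrightarrow> x \<in> carrier H \<Longrightarrow> T x \<in> carrier K"
  unfolding bop_mem by blast

lemma bop_add [simp]:
  "T \<in> carrier (bop H K) \<Longrightarrow> x \<in> carrier H \<Longrightarrow> y \<in> carrier H \<Longrightarrow> T (x \<oplus>\<^bsub>H\<^esub> y) = T x \<oplus>\<^bsub>K\<^esub> T y"
  unfolding bop_mem linear_map_def by blast

lemma bop_smult [simp]:
  "T \<in> carrier (bop H K) \<Longrightarrow> x \<in> carrier H \<Longrightarrow> T (c \<odot>\<^bsub>H\<^esub> x) = c \<odot>\<^bsub>K\<^esub> T x"
  unfolding bop_mem linear_map_def by blast

lemma bop_minus [simp]:
  "T \<in> carrier (bop H K) \<Longrightarrow> hilbert_space H \<Longrightarrow> hilbert_space K \<Longrightarrow> x \<in> carrier H \<Longrightarrow>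
    y \<in> carrier H \<Longrightarrow> T (x \<ominus>\<^bsub>H\<^esub> y) = T x \<ominus>\<^bsub>K\<^esub> T y"
  by (simp add: hs_minus_smult)

lemma bop_zero [simp]:
  "hilbert_space H \<Longrightarrow> hilbert_space K \<Longrightarrow> T \<in> carrier (bop H K) \<Longrightarrow> T \<zero>\<^bsub>H\<^esub> = \<zero>\<^bsub>K\<^esub>"
  using bop_smult[of T H K "\<zero>\<^bsub>H\<^esub>" 0] by (simp add: hs_smult_zero)

lemma bop_extensional: "T \<in> carrier (bop H K) \<Longrightarrow> T \<in> extensional (carrier H)"
  unfolding bop_mem PiE_def by blast

text \<open>The bound in \<open>bop\<close> carries no sign, and on the zero space it may be
  negative; its absolute value works as well and can be used in products of estimates.\<close>

lemma bop_bound: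
  assumes H: "hilbert_space H" and "T \<in> carrier (bop H K)"
  obtains B where "B \<ge> 0" "\<And>x. x \<in> carrier H \<Longrightarrow> hnorm K (T x) \<le> B * hnorm H x"
proof -
  obtain B where B: "\<And>x. x \<in> carrier H \<Longrightarrow> hnorm K (T x) \<le> B * hnorm H x"
    using assms unfolding bop_mem by blast
  have "hnorm K (T x) \<le> \<bar>B\<bar> * hnorm H x" if "x \<in> carrier H" for x
    using B[OF that] mult_right_mono[of B "\<bar>B\<bar>" "hnorm H x"] hnorm_nonneg[OF H that] by linarith
  then show thesis using that[of "\<bar>B\<bar>"] by auto
qed

lemma bop_eqI:
  assumes "S \<in> carrier (bop H K)" "T \<in> carrier (bop H K)" "\<And>x. x \<in> carrier H \<Longrightarrow> S x = T x"
  shows "S = T"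
  using assms by (auto intro: extensionalityI bop_extensional)

lemma bop_compose [simp]:
  assumes "hilbert_space H" "hilbert_space K" "hilbert_space L"
    and S: "S \<in> carrier (bop H K)" and T: "T \<in> carrier (bop K L)"
  shows "compose (carrier H) T S \<in> carrier (bop H L)"
proof -
  obtain A where A: "A \<ge> 0" "\<And>x. x \<in> carrier H \<Longrightarrow> hnorm K (S x) \<le> A * hnorm H x"
    using bop_bound[OF assms(1) S] by blast
  obtain B where B: "B \<ge> 0" "\<And>x. x \<in> carrier K \<Longrightarrow> hnorm L (T x) \<le> B * hnorm K x"
    using bop_bound[OF assms(2) T] by blast
  show ?thesis
  proof (rule bopI[where B = "B * A"])
    fix x assume x: "x \<in> carrier H"
    have "hnorm L (T (S x)) \<le> B * hnorm K (S x)" using x S B by simp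
    also have "\<dots> \<le> B * (A * hnorm H x)" using A B x by (intro mult_left_mono) auto
    finally show "hnorm L (compose (carrier H) T S x) \<le> B * A * hnorm H x"
      using x by (simp add: compose_eq mult.assoc)
  qed (use assms in \<open>auto simp: compose_eq\<close>)
qed

lemma bop_id [simp]: "hilbert_space H \<Longrightarrow> id_op H \<in> carrier (bop H H)"
  by (rule bopI[where B = 1]) (auto simp: id_op_def)

lemma bop_apply [simp]:
  "x \<in> carrier H \<Longrightarrow> (S \<oplus>\<^bsub>bop H K\<^esub> T) x = S x \<oplus>\<^bsub>K\<^esub> T x"
  "x \<in> carrier H \<Longrightarrow> (c \<odot>\<^bsub>bop H K\<^esub> T) x = c \<odot>\<^bsub>K\<^esub> T x"
  "x \<in> carrier H \<Longrightarrow> \<zero>\<^bsub>bop H K\<^esub> x = \<zero>\<^bsub>K\<^esub>"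
  "x \<in> carrier H \<Longrightarrow> id_op H x = x"
  by (simp_all add: bop_def id_op_def)

lemma bop_extensional_ops [simp]:
  "S \<oplus>\<^bsub>bop H K\<^esub> T \<in> extensional (carrier H)"
  "c \<odot>\<^bsub>bop H K\<^esub> T \<in> extensional (carrier H)"
  "\<zero>\<^bsub>bop H K\<^esub> \<in> extensional (carrier H)"
  by (simp_all add: bop_def)

lemma bop_add_closed [simp]:
  assumes "hilbert_space H" "hilbert_space K"
    and S: "S \<in> carrier (bop H K)" and T: "T \<in> carrier (bop H K)"
  shows "S \<oplus>\<^bsub>bop H K\<^esub> T \<in> carrier (bop H K)"
proof -
  obtain A where A: "A \<ge> 0" "\<And>x. x \<in> carrier H \<Longrightarrow> hnorm K (S x) \<le> A * hnorm H x"
    using bop_bound[OF assms(1) S] by blast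
  obtain B where B: "B \<ge> 0" "\<And>x. x \<in> carrier H \<Longrightarrow> hnorm K (T x) \<le> B * hnorm H x"
    using bop_bound[OF assms(1) T] by blast
  show ?thesis
  proof (rule bopI[where B = "A + B"])
    fix x assume x: "x \<in> carrier H"
    have "hnorm K (S x \<oplus>\<^bsub>K\<^esub> T x) \<le> hnorm K (S x) + hnorm K (T x)"
      using assms x by (intro hnorm_triangle) auto
    then show "hnorm K ((S \<oplus>\<^bsub>bop H K\<^esub> T) x) \<le> (A + B) * hnorm H x"
      using A(2)[OF x] B(2)[OF x] x by (simp add: algebra_simps)
  qed (use assms in \<open>auto intro!: hs_eqI[of K] simp: algebra_simps\<close>)
qed

lemma bop_smult_closed [simp]:
  assumes "hilbert_space H" "hilbert_space K" and T: "T \<in> carrier (bop H K)"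
  shows "c \<odot>\<^bsub>bop H K\<^esub> T \<in> carrier (bop H K)"
proof -
  obtain B where B: "B \<ge> 0" "\<And>x. x \<in> carrier H \<Longrightarrow> hnorm K (T x) \<le> B * hnorm H x"
    using bop_bound[OF assms(1) T] by blast
  show ?thesis
  proof (rule bopI[where B = "cmod c * B"])
    fix x assume x: "x \<in> carrier H"
    show "hnorm K ((c \<odot>\<^bsub>bop H K\<^esub> T) x) \<le> cmod c * B * hnorm H x"
      using mult_left_mono[OF B(2)[OF x], of "cmod c"] assms x by (simp add: mult.assoc)
  qed (use assms in \<open>auto intro!: hs_eqI[of K] simp: algebra_simps\<close>)
qed

lemma bop_zero_closed [simp]:
  assumes "hilbert_space H" "hilbert_space K"
  shows "\<zero>\<^bsub>bop H K\<^esub> \<in> carrier (bop H K)"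
  by (rule bopI[where B = 0]) (use assms in \<open>auto intro!: hs_eqI[of K]\<close>)

lemma bop_module:
  assumes H: "hilbert_space H" and K: "hilbert_space K"
  shows "module cfield (bop H K)"
proof (rule moduleI[OF cring_cfield abelian_groupI])
  fix T assume T: "T \<in> carrier (bop H K)"
  show "\<exists>S\<in>carrier (bop H K). S \<oplus>\<^bsub>bop H K\<^esub> T = \<zero>\<^bsub>bop H K\<^esub>"
  proof
    show "(- 1) \<odot>\<^bsub>bop H K\<^esub> T \<in> carrier (bop H K)" using H K T by simp
    with T show "(- 1) \<odot>\<^bsub>bop H K\<^esub> T \<oplus>\<^bsub>bop H K\<^esub> T = \<zero>\<^bsub>bop H K\<^esub>"
      using H K by (intro bop_eqI[of _ H K]) (auto intro!: hs_eqI[of K])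
  qed
qed (use H K in \<open>auto intro!: bop_eqI[of _ H K] hs_eqI[of K] simp: algebra_simps\<close>)

lemma bop_minus_closed [simp]:
  "hilbert_space H \<Longrightarrow> hilbert_space K \<Longrightarrow> S \<in> carrier (bop H K) \<Longrightarrow> T \<in> carrier (bop H K) \<Longrightarrow>
    S \<ominus>\<^bsub>bop H K\<^esub> T \<in> carrier (bop H K)"
  using bop_module[of H K] by (simp add: module_def abelian_group.minus_closed)

lemma bop_uminus:
  assumes "hilbert_space H" "hilbert_space K" "T \<in> carrier (bop H K)"
  shows "\<ominus>\<^bsub>bop H K\<^esub> T = (- 1) \<odot>\<^bsub>bop H K\<^esub> T"
proof -
  interpret module cfield "bop H K" by (rule bop_module) fact+
  show ?thesis using smult_l_minus[of 1 T] smult_one[of T] assms by simp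
qed

lemma bop_minus_apply [simp]:
  assumes "hilbert_space H" "hilbert_space K" "T \<in> carrier (bop H K)" "S \<in> carrier (bop H K)" "x \<in> carrier H"
  shows "(S \<ominus>\<^bsub>bop H K\<^esub> T) x = S x \<ominus>\<^bsub>K\<^esub> T x"
  using assms by (simp add: a_minus_def bop_uminus hs_uminus_smult)

lemma bop_lincomb:
  assumes H: "hilbert_space H" and K: "hilbert_space K" and T: "T \<in> carrier (bop H K)"
    and A: "A \<subseteq> carrier H" and y: "y \<in> carrier K"
  shows "hinner K (T (lincomb H c A)) y = (\<Sum>e\<in>A. c e * hinner K (T e) y)"
proof -
  interpret abelian_group H by (rule hs_abelian_group) fact
  show ?thesis
    using A
  proof (induction A rule: infinite_finite_induct)
    case (insert a A)
    have "lincomb H c (insert a A) = c a \<odot>\<^bsub>H\<^esub> a \<oplus>\<^bsub>H\<^esub> lincomb H c A"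
      unfolding lincomb_def using insert H by (intro finsum_insert) auto
    then show ?case using insert H K T y by simp
  qed (use H K T y in \<open>auto simp: lincomb_def\<close>)
qed

text \<open>The error after a finite partial sum is the pairing of \<open>y\<close> with the image
  of the remainder of \<open>x\<close>. Parseval makes the remainder small, and boundedness with
  Cauchy-Schwarz carries this over.\<close>

lemma bop_parseval:
  assumes H: "hilbert_space H" and K: "hilbert_space K" and T: "T \<in> carrier (bop H K)"
    and E: "orthonormal_basis H E" and x: "x \<in> carrier H" and y: "y \<in> carrier K"
  shows "((\<lambda>e. hinner H x e * hinner K (T e) y) has_sum hinner K (T x) y) E"
  unfolding has_sum_metric
proof (intro allI impI)
  fix r :: real assume r: "r > 0"
  have o: "orthonormal H E" and EH: "E \<subseteq> carrier H"
    using E by (auto simp: orthonormal_basis_alt orthonormal_def)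
  obtain B where B: "B \<ge> 0" "\<And>x. x \<in> carrier H \<Longrightarrow> hnorm K (T x) \<le> B * hnorm H x"
    using bop_bound[OF H T] by blast
  \<comment> \<open>Chosen so that \<open>B * q * hnorm K y < r\<close>; the added 1 keeps the
    denominator positive when \<open>B\<close> or \<open>y\<close> vanishes.\<close>
  define q where "q = r / (B * hnorm K y + 1)"
  have q: "q > 0" using r B K y by (simp add: q_def add_nonneg_pos)
  obtain F where F: "finite F" "F \<subseteq> E" and
    Fq: "\<And>A. finite A \<Longrightarrow> F \<subseteq> A \<Longrightarrow> A \<subseteq> E \<Longrightarrow>
      dist (\<Sum>e\<in>A. (cmod (hinner H x e))\<^sup>2) ((hnorm H x)\<^sup>2) < q\<^sup>2"
    using parseval[OF H E x] q unfolding has_sum_metric by (meson zero_less_power)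
  have "dist (\<Sum>e\<in>A. hinner H x e * hinner K (T e) y) (hinner K (T x) y) < r"
    if A: "finite A" "F \<subseteq> A" "A \<subseteq> E" for A
  proof -
    have oA: "orthonormal H A" and AH: "A \<subseteq> carrier H" using A o EH orthonormal_subset by blast+
    let ?u = "x \<ominus>\<^bsub>H\<^esub> lincomb H (hinner H x) A"
    have u: "?u \<in> carrier H" using H x AH by simp
    have "(hnorm H ?u)\<^sup>2 < q\<^sup>2"
      using hnorm_minus_lincomb[OF H oA A(1) x] Fq[OF A] by (simp add: dist_real_def)
    then have "hnorm H ?u < q" using q by (simp add: power2_less_imp_less)
    then have "hnorm K (T ?u) \<le> B * q"
      using B(2)[OF u] B(1) by (meson less_imp_le mult_left_mono order_trans)
    then have "cmod (hinner K (T ?u) y) \<le> B * q * hnorm K y"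
      using cauchy_schwarz[OF K bop_closed[OF T u] y] K y
      by (meson hnorm_nonneg mult_right_mono order_trans)
    also have "\<dots> < r"
      using r B K y by (simp add: q_def field_simps add_pos_nonneg)
    also have "hinner K (T ?u) y = hinner K (T x) y - (\<Sum>e\<in>A. hinner H x e * hinner K (T e) y)"
      using H K T x y AH by (simp add: bop_lincomb)
    finally show ?thesis by (simp add: dist_norm norm_minus_commute)
  qed
  then show "\<exists>F. finite F \<and> F \<subseteq> E \<and> (\<forall>A. finite A \<and> F \<subseteq> A \<and> A \<subseteq> E \<longrightarrow>
      dist (\<Sum>e\<in>A. hinner H x e * hinner K (T e) y) (hinner K (T x) y) < r)"
    using F by blast
qed

lemma parseval_hinner:
  assumes H: "hilbert_space H" and E: "orthonormal_basis H E"
    and x: "x \<in> carrier H" and y: "y \<in> carrier H"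
  shows "((\<lambda>e. hinner H x e * hinner H e y) has_sum hinner H x y) E"
proof -
  have "e \<in> carrier H" if "e \<in> E" for e using that E by (auto simp: orthonormal_basis_def)
  then show ?thesis
    using bop_parseval[OF H H bop_id[OF H] E x y, unfolded bop_apply(4)[OF x]]
    by (simp cong: has_sum_cong)
qed

section \<open>Adjoints through Riesz representation\<close>

subsection \<open>Adjoints\<close>

text \<open>The functional \<open>\<lambda>x. hinner K (T x) y\<close> prescribes the coefficients
  of its representing vector; they are square summable, so Riesz-Fischer produces it. The norm bound
  is included because it makes the adjoint bounded.\<close>

lemma riesz_vector:
  assumes H: "hilbert_space H" and K: "hilbert_space K" and T: "T \<in> carrier (bop H K)"
    and y: "y \<in> carrier K"
    and B: "B \<ge> 0" "\<And>x. x \<in> carrier H \<Longrightarrow> hnorm K (T x) \<le> B * hnorm H x"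
  obtains z where "z \<in> carrier H" "\<And>x. x \<in> carrier H \<Longrightarrow> hinner K (T x) y = hinner H x z"
    "hnorm H z \<le> B * hnorm K y"
proof -
  obtain E where E: "orthonormal_basis H E" using ex_orthonormal_basis[OF H] by blast
  then have o: "orthonormal H E" and EH: "E \<subseteq> carrier H"
    by (auto simp: orthonormal_basis_alt orthonormal_def)
  define c where "c e = hinner K y (T e)" for e
  have part: "(\<Sum>e\<in>F. (cmod (c e))\<^sup>2) \<le> (B * hnorm K y)\<^sup>2" if F: "finite F" "F \<subseteq> E" for F
  proof -
    \<comment> \<open>On the combination with the prescribed coefficients the functional takes the
      value \<open>(hnorm H ?x)\<^sup>2\<close>, while it is at most
      \<open>B * hnorm K y * hnorm H ?x\<close>; dividing bounds the partial sum.\<close>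
    let ?x = "lincomb H c F"
    have FH: "F \<subseteq> carrier H" and oF: "orthonormal H F" using F EH o orthonormal_subset by blast+
    have x: "?x \<in> carrier H" using H FH by simp
    have "hinner K (T ?x) y = (\<Sum>e\<in>F. c e * hinner K (T e) y)"
      by (rule bop_lincomb) fact+
    also have "\<dots> = (\<Sum>e\<in>F. of_real ((cmod (c e))\<^sup>2))"
    proof (rule sum.cong)
      fix e assume "e \<in> F"
      then have "e \<in> carrier H" using FH by auto
      then have "hinner K (T e) y = cnj (c e)"
        unfolding c_def using K T y hinner_commute[of K y "T e"] by simp
      then show "c e * hinner K (T e) y = of_real ((cmod (c e))\<^sup>2)"
        by (simp only: complex_norm_square)
    qed simp
    also have "\<dots> = of_real ((hnorm H ?x)\<^sup>2)" using hnorm_lincomb[OF H oF F(1)] by simp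
    finally have "cmod (hinner K (T ?x) y) = (hnorm H ?x)\<^sup>2"
      by (simp only: norm_of_real abs_power2)
    moreover have "cmod (hinner K (T ?x) y) \<le> (B * hnorm H ?x) * hnorm K y"
      using cauchy_schwarz[OF K _ y, of "T ?x"] B(2)[OF x] x T K y
      by (meson bop_closed hnorm_nonneg mult_right_mono order_trans)
    ultimately have "(hnorm H ?x)\<^sup>2 \<le> (B * hnorm K y) * hnorm H ?x" by (simp add: mult_ac)
    moreover have "0 \<le> hnorm H ?x" "0 \<le> B * hnorm K y" using H x B K y by auto
    ultimately have "hnorm H ?x \<le> B * hnorm K y"
      by (cases "hnorm H ?x = 0") (auto simp: power2_eq_square)
    then show ?thesis
      using hnorm_lincomb[OF H oF F(1), of c] \<open>0 \<le> hnorm H ?x\<close> by (metis power_mono)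
  qed
  have s: "(\<lambda>e. (cmod (c e))\<^sup>2) summable_on E"
    by (rule nonneg_bounded_summable_on[OF _ part]) auto
  obtain z where z: "z \<in> carrier H" "\<And>e. e \<in> E \<Longrightarrow> hinner H z e = c e"
    "(hnorm H z)\<^sup>2 = (\<Sum>\<^sub>\<infinity>e\<in>E. (cmod (c e))\<^sup>2)"
    using riesz_fischer[OF H o s] by blast
  have "(hnorm H z)\<^sup>2 \<le> (B * hnorm K y)\<^sup>2"
    unfolding z(3) by (rule infsum_le_finite_sums[OF s part])
  then have "hnorm H z \<le> B * hnorm K y"
    using B K y by (intro power2_le_imp_le[of "hnorm H z"]) auto
  moreover have "hinner K (T x) y = hinner H x z" if x: "x \<in> carrier H" for x
  proof -
    have 1: "((\<lambda>e. hinner H x e * hinner H e z) has_sum hinner H x z) E"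
      by (rule parseval_hinner) fact+
    have "((\<lambda>e. hinner H x e * hinner K (T e) y) has_sum hinner K (T x) y) E"
      by (rule bop_parseval) fact+
    moreover have "hinner H e z = hinner K (T e) y" if "e \<in> E" for e
    proof -
      have e: "e \<in> carrier H" using that EH by blast
      have "hinner H e z = cnj (hinner H z e)" using hinner_commute[of H z e] H z e by simp
      also have "\<dots> = cnj (hinner K y (T e))" using z(2)[OF that] by (simp add: c_def)
      also have "\<dots> = hinner K (T e) y" using hinner_commute[of K y "T e"] K T y e by simp
      finally show ?thesis .
    qed
    ultimately have "((\<lambda>e. hinner H x e * hinner H e z) has_sum hinner K (T x) y) E"
      by (simp cong: has_sum_cong)
    with 1 show ?thesis using has_sum_unique by blast
  qed
  ultimately show thesis using that z(1) by blast
qed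

text \<open>This justifies the definite description in \<open>adjoint_op\<close>. The representing
  vectors are chosen pointwise; their uniqueness forces linearity, and one common bound
  \<open>B\<close> forces boundedness.\<close>

lemma adjoint_ex1:
  assumes H: "hilbert_space H" and K: "hilbert_space K" and T: "T \<in> carrier (bop H K)"
  shows "\<exists>!S. S \<in> carrier (bop K H) \<and>
    (\<forall>x\<in>carrier H. \<forall>y\<in>carrier K. hinner K (T x) y = hinner H x (S y))"
proof (rule ex_ex1I)
  obtain B where B: "B \<ge> 0" "\<And>x. x \<in> carrier H \<Longrightarrow> hnorm K (T x) \<le> B * hnorm H x"
    using bop_bound[OF H T] by blast
  have "\<exists>z. z \<in> carrier H \<and> (\<forall>x\<in>carrier H. hinner K (T x) y = hinner H x z) \<and> hnorm H z \<le> B * hnorm K y"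
    if "y \<in> carrier K" for y
    using riesz_vector[OF H K T that B] by metis
  then obtain s where s: "\<And>y. y \<in> carrier K \<Longrightarrow> s y \<in> carrier H"
    "\<And>x y. y \<in> carrier K \<Longrightarrow> x \<in> carrier H \<Longrightarrow> hinner K (T x) y = hinner H x (s y)"
    "\<And>y. y \<in> carrier K \<Longrightarrow> hnorm H (s y) \<le> B * hnorm K y"
    by metis
  have s2: "hinner H (s y) x = hinner K y (T x)" if "y \<in> carrier K" "x \<in> carrier H" for x y
    using s(2)[OF that] hinner_commute[of K "T x" y] hinner_commute[of H x "s y"] H K T s(1) that by simp
  have "restrict s (carrier K) \<in> carrier (bop K H)"
  proof (rule bopI[where B = B])
    fix x y assume "x \<in> carrier K" "y \<in> carrier K"
    then show "restrict s (carrier K) (x \<oplus>\<^bsub>K\<^esub> y) = restrict s (carrier K) x \<oplus>\<^bsub>H\<^esub> restrict s (carrier K) y"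
      using H K T s by (auto intro!: hs_eqI[of H] simp: s2)
  next
    fix c x assume "x \<in> carrier K"
    then show "restrict s (carrier K) (c \<odot>\<^bsub>K\<^esub> x) = c \<odot>\<^bsub>H\<^esub> restrict s (carrier K) x"
      using H K T s by (auto intro!: hs_eqI[of H] simp: s2)
  qed (use H K s in auto)
  then show "\<exists>S. S \<in> carrier (bop K H) \<and>
    (\<forall>x\<in>carrier H. \<forall>y\<in>carrier K. hinner K (T x) y = hinner H x (S y))"
    using s(2) by (intro exI[of _ "restrict s (carrier K)"]) auto
next
  fix S S'
  assume S: "S \<in> carrier (bop K H) \<and>
    (\<forall>x\<in>carrier H. \<forall>y\<in>carrier K. hinner K (T x) y = hinner H x (S y))"
    and S': "S' \<in> carrier (bop K H) \<and>
    (\<forall>x\<in>carrier H. \<forall>y\<in>carrier K. hinner K (T x) y = hinner H x (S' y))"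
  show "S = S'"
  proof (rule bop_eqI[of _ K H])
    fix y assume y: "y \<in> carrier K"
    show "S y = S' y"
    proof (rule hs_eqI[OF H])
      fix z assume z: "z \<in> carrier H"
      have "hinner H z (S y) = hinner H z (S' y)" using S S' y z by metis
      then show "hinner H (S y) z = hinner H (S' y) z"
        using hinner_commute[of H z "S y"] hinner_commute[of H z "S' y"] H z y
          bop_closed[of S K H y] bop_closed[of S' K H y] S S' by simp
    qed (use S S' y in auto)
  qed (use S S' in auto)
qed

lemma adjoint_closed [simp]:
  "hilbert_space H \<Longrightarrow> hilbert_space K \<Longrightarrow> T \<in> carrier (bop H K) \<Longrightarrow>
    adjoint_op H K T \<in> carrier (bop K H)"
  unfolding adjoint_op_def by (drule (2) adjoint_ex1[THEN theI']) blast

lemma adjoint_op: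
  "hilbert_space H \<Longrightarrow> hilbert_space K \<Longrightarrow> T \<in> carrier (bop H K) \<Longrightarrow> x \<in> carrier H \<Longrightarrow>
    y \<in> carrier K \<Longrightarrow> hinner H x (adjoint_op H K T y) = hinner K (T x) y"
  unfolding adjoint_op_def by (drule (2) adjoint_ex1[THEN theI']) auto

lemma adjoint_op_left:
  assumes "hilbert_space H" "hilbert_space K" "T \<in> carrier (bop H K)" "x \<in> carrier H" "y \<in> carrier K"
  shows "hinner H (adjoint_op H K T y) x = hinner K y (T x)"
  using adjoint_op[OF assms] assms hinner_commute[of H x "adjoint_op H K T y"]
    hinner_commute[of K "T x" y] by (metis adjoint_closed bop_closed)

lemma adjoint_apply_closed [simp]:
  "hilbert_space H \<Longrightarrow> hilbert_space K \<Longrightarrow> T \<in> carrier (bop H K) \<Longrightarrow> y \<in> carrier K \<Longrightarrow>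
    adjoint_op H K T y \<in> carrier H"
  by (rule bop_closed[OF adjoint_closed])

section \<open>Gelfand numbers of sums, products and multiples\<close>

section \<open>Gelfand numbers\<close>

text \<open>\<open>gelfand_bound H K T n s\<close> says that \<open>T\<close> is bounded by \<open>s\<close> on a subspace of codimension at most
  \<open>n\<close>, that is, that the \<open>(n + 1)\<close>-st Gelfand number of \<open>T\<close> is at most \<open>s\<close>.\<close>

definition gelfand_bound ::
  "('v, 'r) hilb_scheme \<Rightarrow> ('w, 's) hilb_scheme \<Rightarrow> ('v \<Rightarrow> 'w) \<Rightarrow> nat \<Rightarrow> real \<Rightarrow> bool" where
  "gelfand_bound H K T n s \<longleftrightarrow>
     (\<exists>W. finite W \<and> W \<subseteq> carrier H \<and> card W \<le> n \<and>
        (\<forall>x\<in>carrier H. (\<forall>w\<in>W. hinner H x w = 0) \<longrightarrow> hnorm K (T x) \<le> s * hnorm H x))"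

lemma gelfand_bound_mono:
  assumes "hilbert_space H" "gelfand_bound H K T n s" "n \<le> n'" "s \<le> s'"
  shows "gelfand_bound H K T n' s'"
proof -
  obtain W where W: "finite W" "W \<subseteq> carrier H" "card W \<le> n"
    "\<And>x. x \<in> carrier H \<Longrightarrow> \<forall>w\<in>W. hinner H x w = 0 \<Longrightarrow> hnorm K (T x) \<le> s * hnorm H x"
    using assms(2) unfolding gelfand_bound_def by blast
  have "hnorm K (T x) \<le> s' * hnorm H x" if "x \<in> carrier H" "\<forall>w\<in>W. hinner H x w = 0" for x
    using W(4)[OF that] mult_right_mono[OF assms(4) hnorm_nonneg[OF assms(1) that(1)]] by linarith
  with W assms(3) show ?thesis unfolding gelfand_bound_def by (meson order_trans)
qed

lemma gelfand_bound_bounded: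
  "(\<And>x. x \<in> carrier H \<Longrightarrow> hnorm K (T x) \<le> B * hnorm H x) \<Longrightarrow> gelfand_bound H K T 0 B"
  unfolding gelfand_bound_def by (rule exI[of _ "{}"]) simp

text \<open>Both estimates hold at once on the vectors that satisfy the union of the two sets of
  constraints.\<close>

lemma gelfand_bound_add:
  assumes "hilbert_space H" "hilbert_space K"
    and "S \<in> carrier (bop H K)" "T \<in> carrier (bop H K)"
    and "gelfand_bound H K S m s" "gelfand_bound H K T n t"
  shows "gelfand_bound H K (S \<oplus>\<^bsub>bop H K\<^esub> T) (m + n) (s + t)"
proof -
  obtain V where V: "finite V" "V \<subseteq> carrier H" "card V \<le> m"
    "\<And>x. x \<in> carrier H \<Longrightarrow> \<forall>w\<in>V. hinner H x w = 0 \<Longrightarrow> hnorm K (S x) \<le> s * hnorm H x"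
    using assms(5) unfolding gelfand_bound_def by blast
  obtain W where W: "finite W" "W \<subseteq> carrier H" "card W \<le> n"
    "\<And>x. x \<in> carrier H \<Longrightarrow> \<forall>w\<in>W. hinner H x w = 0 \<Longrightarrow> hnorm K (T x) \<le> t * hnorm H x"
    using assms(6) unfolding gelfand_bound_def by blast
  have "card (V \<union> W) \<le> m + n" using card_Un_le[of V W] V W by linarith
  moreover have "hnorm K ((S \<oplus>\<^bsub>bop H K\<^esub> T) x) \<le> (s + t) * hnorm H x"
    if x: "x \<in> carrier H" and o: "\<forall>w\<in>V \<union> W. hinner H x w = 0" for x
  proof -
    have "hnorm K (S x) \<le> s * hnorm H x" "hnorm K (T x) \<le> t * hnorm H x"
      using V(4)[OF x] W(4)[OF x] o by blast+
    moreover have "hnorm K (S x \<oplus>\<^bsub>K\<^esub> T x) \<le> hnorm K (S x) + hnorm K (T x)"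
      using assms x by (intro hnorm_triangle) auto
    ultimately show ?thesis using x by (simp add: algebra_simps)
  qed
  ultimately show ?thesis
    unfolding gelfand_bound_def using V W by (intro exI[of _ "V \<union> W"]) blast
qed

text \<open>That \<open>S x\<close> be orthogonal to \<open>w\<close> is the condition that
  \<open>x\<close> be orthogonal to the adjoint image of \<open>w\<close>. So the constraints of
  \<open>T\<close> become as many constraints on \<open>x\<close>.\<close>

lemma gelfand_bound_compose:
  assumes H: "hilbert_space H" and K: "hilbert_space K" and L: "hilbert_space L"
    and S: "S \<in> carrier (bop H K)" and T: "T \<in> carrier (bop K L)"
    and "gelfand_bound H K S m s" "gelfand_bound K L T n t" "t \<ge> 0"
  shows "gelfand_bound H L (compose (carrier H) T S) (m + n) (t * s)"
proof -
  obtain V where V: "finite V" "V \<subseteq> carrier H" "card V \<le> m"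
    "\<And>x. x \<in> carrier H \<Longrightarrow> \<forall>w\<in>V. hinner H x w = 0 \<Longrightarrow> hnorm K (S x) \<le> s * hnorm H x"
    using assms(6) unfolding gelfand_bound_def by blast
  obtain W where W: "finite W" "W \<subseteq> carrier K" "card W \<le> n"
    "\<And>x. x \<in> carrier K \<Longrightarrow> \<forall>w\<in>W. hinner K x w = 0 \<Longrightarrow> hnorm L (T x) \<le> t * hnorm K x"
    using assms(7) unfolding gelfand_bound_def by blast
  let ?W = "adjoint_op H K S ` W"
  have "card (V \<union> ?W) \<le> m + n"
    using card_Un_le[of V ?W] card_image_le[OF W(1), of "adjoint_op H K S"] V W by linarith
  moreover have "?W \<subseteq> carrier H" using W(2) bop_closed[OF adjoint_closed[OF H K S]] by blast
  moreover have "hnorm L (compose (carrier H) T S x) \<le> t * s * hnorm H x"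
    if x: "x \<in> carrier H" and o: "\<forall>w\<in>V \<union> ?W. hinner H x w = 0" for x
  proof -
    have "hnorm K (S x) \<le> s * hnorm H x" using V(4)[OF x] o by blast
    moreover have "hinner K (S x) w = 0" if "w \<in> W" for w
      using o that adjoint_op[OF H K S x, of w] W(2) by auto
    then have "hnorm L (T (S x)) \<le> t * hnorm K (S x)" using W(4) S x by simp
    ultimately show ?thesis
      using x mult_left_mono[of "hnorm K (S x)" "s * hnorm H x" t] \<open>t \<ge> 0\<close>
      by (simp add: compose_eq mult.assoc)
  qed
  ultimately show ?thesis
    unfolding gelfand_bound_def using V W by (intro exI[of _ "V \<union> ?W"]) blast
qed

lemma gelfand_bound_smult:
  assumes "hilbert_space H" "hilbert_space K" "T \<in> carrier (bop H K)" "gelfand_bound H K T n s"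
  shows "gelfand_bound H K (c \<odot>\<^bsub>bop H K\<^esub> T) n (cmod c * s)"
proof -
  obtain W where W: "finite W" "W \<subseteq> carrier H" "card W \<le> n"
    "\<And>x. x \<in> carrier H \<Longrightarrow> \<forall>w\<in>W. hinner H x w = 0 \<Longrightarrow> hnorm K (T x) \<le> s * hnorm H x"
    using assms(4) unfolding gelfand_bound_def by blast
  have "hnorm K ((c \<odot>\<^bsub>bop H K\<^esub> T) x) \<le> cmod c * s * hnorm H x"
    if "x \<in> carrier H" "\<forall>w\<in>W. hinner H x w = 0" for x
    using mult_left_mono[OF W(4)[OF that] norm_ge_zero[of c]] assms that by (simp add: mult.assoc)
  with W show ?thesis unfolding gelfand_bound_def by blast
qed

section \<open>Comparison of eigenvalues of \<open>T* T\<close> with Gelfand numbers of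
  \<open>T\<close>\<close>

subsection \<open>Eigenvalues and Gelfand numbers\<close>

text \<open>Fewer linear equations than unknowns leave a nonzero solution, by Gaussian elimination:
  one equation is used to eliminate one unknown.\<close>

lemma homogeneous_system:
  fixes M :: "'a \<Rightarrow> 'b \<Rightarrow> complex"
  assumes "finite V" "finite A" "card V < card A"
  shows "\<exists>c. (\<exists>a\<in>A. c a \<noteq> 0) \<and> (\<forall>v\<in>V. (\<Sum>a\<in>A. c a * M a v) = 0)"
  using assms
proof (induction V arbitrary: A M rule: finite_induct)
  case empty
  then have "A \<noteq> {}" by auto
  then show ?case by (intro exI[of _ "\<lambda>_. 1"]) auto
next
  case (insert v V)
  show ?case
  proof (cases "\<forall>a\<in>A. M a v = 0")
    case True
    have "card V < card A" using insert by simp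
    from insert.IH[OF insert.prems(1) this, of M] show ?thesis using True by auto
  next
    case False
    then obtain b where b: "b \<in> A" "M b v \<noteq> 0" by blast
    define A' where "A' = A - {b}"
    \<comment> \<open>The coefficients left after unknown \<open>b\<close> has been eliminated with
      equation \<open>v\<close>.\<close>
    define M' where "M' a w = M a w - M a v / M b v * M b w" for a w
    have A': "finite A'" "card V < card A'" "A = insert b A'" "b \<notin> A'"
      using insert b by (auto simp: A'_def)
    obtain c where c: "\<exists>a\<in>A'. c a \<noteq> 0" "\<And>w. w \<in> V \<Longrightarrow> (\<Sum>a\<in>A'. c a * M' a w) = 0"
      using insert.IH[OF A'(1,2), of M'] by blast
    \<comment> \<open>Back substitution: the value at \<open>b\<close> is the one that solves
      equation \<open>v\<close>.\<close>
    define c' where "c' = c(b := - (\<Sum>a\<in>A'. c a * M a v) / M b v)"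
    have sum: "(\<Sum>a\<in>A. c' a * M a w) = c' b * M b w + (\<Sum>a\<in>A'. c a * M a w)" for w
    proof -
      have "(\<Sum>a\<in>A'. c' a * M a w) = (\<Sum>a\<in>A'. c a * M a w)"
        using A' by (intro sum.cong) (auto simp: c'_def)
      then show ?thesis using A' by simp
    qed
    have "(\<Sum>a\<in>A. c' a * M a w) = 0" if "w \<in> insert v V" for w
    proof (cases "w = v")
      case True
      then show ?thesis using b unfolding sum by (simp add: c'_def)
    next
      case False
      then have "0 = (\<Sum>a\<in>A'. c a * M' a w)" using c that by simp
      also have "\<dots> = (\<Sum>a\<in>A'. c a * M a w) - (\<Sum>a\<in>A'. c a * M a v) / M b v * M b w"
        by (simp add: M'_def sum_subtractf sum_distrib_left sum_divide_distrib algebra_simps)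
      finally show ?thesis unfolding sum by (simp add: c'_def)
    qed
    moreover have "\<exists>a\<in>A. c' a \<noteq> 0" using c(1) A' by (auto simp: c'_def)
    ultimately show ?thesis by blast
  qed
qed

text \<open>With more than \<open>n\<close> eigenvectors, some nonzero combination of them meets all
  \<open>n\<close> constraints; but on their span \<open>T\<close> stretches every nonzero vector by
  strictly more than \<open>s\<close>.\<close>

lemma gelfand_bound_card_eigenvalues:
  assumes H: "hilbert_space H" and K: "hilbert_space K" and T: "T \<in> carrier (bop H K)"
    and o: "orthonormal H A" and fin: "finite A"
    and eig: "\<And>e. e \<in> A \<Longrightarrow> adjoint_op H K T (T e) = complex_of_real ((\<mu> e)\<^sup>2) \<odot>\<^bsub>H\<^esub> e"
    and big: "\<And>e. e \<in> A \<Longrightarrow> \<mu> e > s" and "s \<ge> 0" and gel: "gelfand_bound H K T n s"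
  shows "card A \<le> n"
proof (rule ccontr)
  assume "\<not> card A \<le> n"
  obtain W where W: "finite W" "W \<subseteq> carrier H" "card W \<le> n"
    "\<And>x. x \<in> carrier H \<Longrightarrow> \<forall>w\<in>W. hinner H x w = 0 \<Longrightarrow> hnorm K (T x) \<le> s * hnorm H x"
    using gel unfolding gelfand_bound_def by blast
  have "card W < card A" using W \<open>\<not> card A \<le> n\<close> by simp
  then obtain c where c: "\<exists>a\<in>A. c a \<noteq> 0" "\<And>w. w \<in> W \<Longrightarrow> (\<Sum>a\<in>A. c a * hinner H a w) = 0"
    using homogeneous_system[OF W(1) fin, of "hinner H"] by blast
  have AH: "A \<subseteq> carrier H" using o by (simp add: orthonormal_def)
  define x where "x = lincomb H c A"
  have x: "x \<in> carrier H" using H AH by (simp add: x_def)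
  have nx: "(hnorm H x)\<^sup>2 = (\<Sum>a\<in>A. (cmod (c a))\<^sup>2)"
    unfolding x_def by (rule hnorm_lincomb) fact+
  have "hinner K (T x) (T x) = (\<Sum>a\<in>A. c a * hinner K (T a) (T x))"
    unfolding x_def by (rule bop_lincomb) (use H K T AH in auto)
  also have "\<dots> = (\<Sum>a\<in>A. of_real ((\<mu> a)\<^sup>2 * (cmod (c a))\<^sup>2))"
  proof (rule sum.cong)
    fix a assume a: "a \<in> A"
    then have aH: "a \<in> carrier H" using AH by blast
    have "hinner H x a = c a"
      using hinner_lincomb_orthonormal[OF H o fin _ a, of c] a by (simp add: x_def)
    moreover have "hinner K (T a) (T x) = hinner H (adjoint_op H K T (T a)) x"
      using adjoint_op_left[OF H K T x, of "T a"] T aH by simp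
    ultimately have "hinner K (T a) (T x) = of_real ((\<mu> a)\<^sup>2) * cnj (c a)"
      using eig[OF a] H aH x hinner_commute[of H x a] by simp
    then have "c a * hinner K (T a) (T x) = of_real ((\<mu> a)\<^sup>2) * (c a * cnj (c a))" by simp
    then show "c a * hinner K (T a) (T x) = of_real ((\<mu> a)\<^sup>2 * (cmod (c a))\<^sup>2)"
      by (simp only: complex_norm_square of_real_mult)
  qed simp
  finally have nT: "(hnorm K (T x))\<^sup>2 = (\<Sum>a\<in>A. (\<mu> a)\<^sup>2 * (cmod (c a))\<^sup>2)"
    using K T x by (simp add: hnorm_sq flip: of_real_sum of_real_mult of_real_power)
  \<comment> \<open>Strict, because the solution of the homogeneous system has at least one nonzero
    coefficient.\<close>
  have "(\<Sum>a\<in>A. s\<^sup>2 * (cmod (c a))\<^sup>2) < (\<Sum>a\<in>A. (\<mu> a)\<^sup>2 * (cmod (c a))\<^sup>2)"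
  proof (rule sum_strict_mono_ex1[OF fin])
    show "\<forall>a\<in>A. s\<^sup>2 * (cmod (c a))\<^sup>2 \<le> (\<mu> a)\<^sup>2 * (cmod (c a))\<^sup>2"
      using big \<open>s \<ge> 0\<close> by (intro ballI mult_right_mono power_mono) (auto intro: less_imp_le)
    obtain a where a: "a \<in> A" "c a \<noteq> 0" using c by blast
    have "s\<^sup>2 < (\<mu> a)\<^sup>2" using big[OF a(1)] \<open>s \<ge> 0\<close> by (intro power_strict_mono) auto
    then show "\<exists>a\<in>A. s\<^sup>2 * (cmod (c a))\<^sup>2 < (\<mu> a)\<^sup>2 * (cmod (c a))\<^sup>2"
      using a by (intro bexI[of _ a] mult_strict_right_mono) auto
  qed
  then have "(s * hnorm H x)\<^sup>2 < (hnorm K (T x))\<^sup>2"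
    by (simp only: nT power_mult_distrib nx sum_distrib_left)
  moreover have "hnorm K (T x) \<le> s * hnorm H x"
  proof (rule W(4)[OF x], intro ballI)
    fix w assume "w \<in> W"
    then show "hinner H x w = 0"
      unfolding x_def using c(2) H AH W(2) by (subst hinner_lincomb_left) auto
  qed
  then have "(hnorm K (T x))\<^sup>2 \<le> (s * hnorm H x)\<^sup>2" using K T x by (intro power_mono) auto
  ultimately show False by simp
qed

text \<open>The squared norm of \<open>T x\<close> is the pairing of \<open>x\<close> with
  \<open>T* T x\<close>, and the expansion of this pairing in the eigenbasis is diagonal.\<close>

lemma hnorm_eigenbasis:
  assumes H: "hilbert_space H" and K: "hilbert_space K" and T: "T \<in> carrier (bop H K)"
    and E: "orthonormal_basis H E" and x: "x \<in> carrier H"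
    and eig: "\<And>e. e \<in> E \<Longrightarrow> adjoint_op H K T (T e) = complex_of_real ((\<mu> e)\<^sup>2) \<odot>\<^bsub>H\<^esub> e"
  shows "((\<lambda>e. (\<mu> e)\<^sup>2 * (cmod (hinner H x e))\<^sup>2) has_sum (hnorm K (T x))\<^sup>2) E"
proof -
  let ?S = "adjoint_op H K T"
  have EH: "E \<subseteq> carrier H" using E by (auto simp: orthonormal_basis_def)
  have "((\<lambda>e. hinner H x e * hinner H e (?S (T x))) has_sum hinner H x (?S (T x))) E"
    by (rule parseval_hinner) (use H K T E x in auto)
  moreover have "hinner H x e * hinner H e (?S (T x)) = of_real ((\<mu> e)\<^sup>2 * (cmod (hinner H x e))\<^sup>2)"
    if "e \<in> E" for e
  proof -
    have e: "e \<in> carrier H" using that EH by blast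
    have "hinner H e (?S (T x)) = hinner H (?S (T e)) x"
      using adjoint_op[OF H K T e, of "T x"] adjoint_op_left[OF H K T x, of "T e"] T x e by simp
    also have "\<dots> = of_real ((\<mu> e)\<^sup>2) * cnj (hinner H x e)"
      using eig[OF that] H e x hinner_commute[of H x e] by simp
    finally have "hinner H x e * hinner H e (?S (T x))
        = of_real ((\<mu> e)\<^sup>2) * (hinner H x e * cnj (hinner H x e))" by simp
    then show ?thesis by (simp only: complex_norm_square of_real_mult)
  qed
  moreover have "hinner H x (?S (T x)) = of_real ((hnorm K (T x))\<^sup>2)"
    using adjoint_op[OF H K T x, of "T x"] T x K by (simp add: hinner_self)
  ultimately have "((\<lambda>e. of_real ((\<mu> e)\<^sup>2 * (cmod (hinner H x e))\<^sup>2)) has_sum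
      complex_of_real ((hnorm K (T x))\<^sup>2)) E"
    by (metis (no_types, lifting) has_sum_cong)
  then show ?thesis by (simp only: has_sum_of_real_iff)
qed

text \<open>The eigenvectors with \<open>s < \<mu> e\<close> serve as constraints; orthogonally to
  them, every term of the diagonal expansion has a factor at most \<open>s\<^sup>2\<close>.\<close>

lemma eigenbasis_gelfand_bound:
  assumes H: "hilbert_space H" and K: "hilbert_space K" and T: "T \<in> carrier (bop H K)"
    and E: "orthonormal_basis H E"
    and eig: "\<And>e. e \<in> E \<Longrightarrow> \<mu> e \<ge> 0 \<and>
        adjoint_op H K T (T e) = complex_of_real ((\<mu> e)\<^sup>2) \<odot>\<^bsub>H\<^esub> e"
    and "finite {e \<in> E. s < \<mu> e}" "card {e \<in> E. s < \<mu> e} \<le> n" "s \<ge> 0"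
  shows "gelfand_bound H K T n s"
proof -
  have EH: "E \<subseteq> carrier H" using E by (auto simp: orthonormal_basis_def)
  have "hnorm K (T x) \<le> s * hnorm H x"
    if x: "x \<in> carrier H" and o: "\<forall>w\<in>{e \<in> E. s < \<mu> e}. hinner H x w = 0" for x
  proof (rule power2_le_imp_le)
    have "((\<lambda>e. s\<^sup>2 * (cmod (hinner H x e))\<^sup>2) has_sum s\<^sup>2 * (hnorm H x)\<^sup>2) E"
      by (rule has_sum_cmult_right) (rule parseval[OF H E x])
    moreover have "((\<lambda>e. (\<mu> e)\<^sup>2 * (cmod (hinner H x e))\<^sup>2) has_sum (hnorm K (T x))\<^sup>2) E"
      using eig by (intro hnorm_eigenbasis[OF H K T E x]) blast
    moreover have "(\<mu> e)\<^sup>2 * (cmod (hinner H x e))\<^sup>2 \<le> s\<^sup>2 * (cmod (hinner H x e))\<^sup>2" if "e \<in> E" for e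
    proof (cases "s < \<mu> e")
      case False
      then show ?thesis using eig[OF that] by (intro mult_right_mono power_mono) auto
    qed (use o that in auto)
    ultimately have "(hnorm K (T x))\<^sup>2 \<le> s\<^sup>2 * (hnorm H x)\<^sup>2" by (meson has_sum_mono)
    then show "(hnorm K (T x))\<^sup>2 \<le> (s * hnorm H x)\<^sup>2" by (simp add: power_mult_distrib)
  qed (use H x \<open>s \<ge> 0\<close> in auto)
  then show ?thesis
    unfolding gelfand_bound_def using assms(6,7) EH by (intro exI[of _ "{e \<in> E. s < \<mu> e}"]) blast
qed

section \<open>Ideals of operators with decaying Gelfand numbers, in place of Schatten
  classes\<close>

section \<open>Operators with decaying Gelfand numbers\<close>

text \<open>For \<open>\<theta> > 0\<close> this is the Schatten class of exponent
  \<open>1 / \<theta>\<close>, with the summable sequence split off so that exponents can be added.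
  Positivity of \<open>u\<close> matters at \<open>\<theta> = 0\<close>, which is to cover all
  bounded operators: in HOL \<open>0 powr 0\<close> is 0.\<close>

definition decay ::
  "real \<Rightarrow> ('v, 'r) hilb_scheme \<Rightarrow> ('w, 's) hilb_scheme \<Rightarrow> ('v \<Rightarrow> 'w) set" where
  "decay \<theta> H K = {T \<in> carrier (bop H K). \<exists>u C. decseq u \<and> (\<forall>n. u n > 0) \<and> summable u \<and> C \<ge> 0 \<and>
     (\<forall>n. gelfand_bound H K T n (C * u n powr \<theta>))}"

lemma decay_bop: "T \<in> decay \<theta> H K \<Longrightarrow> T \<in> carrier (bop H K)"
  by (simp add: decay_def)

lemma decayE:
  assumes "T \<in> decay \<theta> H K"
  obtains u C where "decseq u" "\<And>n::nat. (u n :: real) > 0" "summable u" "C \<ge> 0"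
    "\<And>n. gelfand_bound H K T n (C * u n powr \<theta>)"
  using assms unfolding decay_def by blast

lemma decayI:
  fixes u :: "nat \<Rightarrow> real"
  assumes "T \<in> carrier (bop H K)" "decseq u" "\<And>n. u n > 0" "summable u" "C \<ge> 0"
    "\<And>n. gelfand_bound H K T n (C * u n powr \<theta>)"
  shows "T \<in> decay \<theta> H K"
  using assms unfolding decay_def by blast

text \<open>Every term occurs twice, so halving the index costs only a factor 2.\<close>

lemma summable_div_2:
  fixes f :: "nat \<Rightarrow> real"
  assumes "summable f" "\<And>n. f n \<ge> 0"
  shows "summable (\<lambda>n. f (n div 2))"
proof (rule summableI_nonneg_bounded)
  fix n
  have eq: "(\<Sum>i<2 * n. f (i div 2)) = 2 * (\<Sum>i<n. f i)" for n
    by (induction n) auto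
  have "(\<Sum>i<n. f (i div 2)) \<le> (\<Sum>i<2 * n. f (i div 2))"
    using assms by (intro sum_mono2) auto
  also have "\<dots> \<le> 2 * suminf f"
    unfolding eq using assms sum_le_suminf[of f "{..<n}"] by simp
  finally show "(\<Sum>i<n. f (i div 2)) \<le> 2 * suminf f" .
qed (use assms in simp)

text \<open>A common majorant for two decay sequences at half the index: of \<open>n\<close>
  constraints each of two operators receives \<open>n div 2\<close>.\<close>

lemma decay_mix:
  fixes u v :: "nat \<Rightarrow> real"
  assumes "decseq u" "\<And>n. u n > 0" "summable u" "decseq v" "\<And>n. v n > 0" "summable v"
  shows "decseq (\<lambda>n. u (n div 2) + v (n div 2))" "\<And>n. u (n div 2) + v (n div 2) > 0"
    "summable (\<lambda>n. u (n div 2) + v (n div 2))"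
proof -
  show "decseq (\<lambda>n. u (n div 2) + v (n div 2))"
    unfolding decseq_def
  proof (intro allI impI)
    fix m n :: nat assume "m \<le> n"
    then have "m div 2 \<le> n div 2" by (rule div_le_mono)
    then show "u (n div 2) + v (n div 2) \<le> u (m div 2) + v (m div 2)"
      using assms by (intro add_mono) (auto simp: decseq_def)
  qed
  show "u (n div 2) + v (n div 2) > 0" for n using assms by (simp add: add_pos_pos)
  show "summable (\<lambda>n. u (n div 2) + v (n div 2))"
    using assms by (intro summable_add summable_div_2) (auto intro: less_imp_le)
qed

lemma decay_add:
  assumes H: "hilbert_space H" and K: "hilbert_space K" and "\<theta> \<ge> 0"
    and S: "S \<in> decay \<theta> H K" and T: "T \<in> decay \<theta> H K"
  shows "S \<oplus>\<^bsub>bop H K\<^esub> T \<in> decay \<theta> H K"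
proof -
  obtain u C where u: "decseq u" "\<And>n. u n > 0" "summable u" "C \<ge> 0"
    "\<And>n. gelfand_bound H K S n (C * u n powr \<theta>)"
    using decayE[OF S] by blast
  obtain v D where v: "decseq v" "\<And>n. v n > 0" "summable v" "D \<ge> 0"
    "\<And>n. gelfand_bound H K T n (D * v n powr \<theta>)"
    using decayE[OF T] by blast
  let ?w = "\<lambda>n. u (n div 2) + v (n div 2)"
  show ?thesis
  proof (rule decayI[OF _ decay_mix[OF u(1-3) v(1-3)]])
    show "S \<oplus>\<^bsub>bop H K\<^esub> T \<in> carrier (bop H K)" using H K S T by (simp add: decay_bop)
    show "C + D \<ge> 0" using u v by simp
    fix n
    have "C * u (n div 2) powr \<theta> + D * v (n div 2) powr \<theta> \<le> C * ?w n powr \<theta> + D * ?w n powr \<theta>"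
      using u(2)[of "n div 2"] v(2)[of "n div 2"] u(4) v(4) \<open>\<theta> \<ge> 0\<close>
      by (intro add_mono mult_left_mono powr_mono2) auto
    then have "C * u (n div 2) powr \<theta> + D * v (n div 2) powr \<theta> \<le> (C + D) * ?w n powr \<theta>"
      by (simp add: distrib_right)
    moreover have "gelfand_bound H K (S \<oplus>\<^bsub>bop H K\<^esub> T) (n div 2 + n div 2)
        (C * u (n div 2) powr \<theta> + D * v (n div 2) powr \<theta>)"
      using H K S T u v by (intro gelfand_bound_add) (auto simp: decay_bop)
    ultimately show "gelfand_bound H K (S \<oplus>\<^bsub>bop H K\<^esub> T) n ((C + D) * ?w n powr \<theta>)"
      by (rule gelfand_bound_mono[OF H, rotated -1]) auto
  qed
qed

text \<open>The role of Hoelder's inequality is played by the common majorant: once both sequences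
  are enlarged to \<open>?w\<close>, their powers multiply to a single power.\<close>

lemma decay_compose:
  assumes H: "hilbert_space H" and K: "hilbert_space K" and L: "hilbert_space L"
    and "\<theta> \<ge> 0" "\<eta> \<ge> 0" and S: "S \<in> decay \<theta> H K" and T: "T \<in> decay \<eta> K L"
  shows "compose (carrier H) T S \<in> decay (\<eta> + \<theta>) H L"
proof -
  obtain u C where u: "decseq u" "\<And>n. u n > 0" "summable u" "C \<ge> 0"
    "\<And>n. gelfand_bound H K S n (C * u n powr \<theta>)"
    using decayE[OF S] by blast
  obtain v D where v: "decseq v" "\<And>n. v n > 0" "summable v" "D \<ge> 0"
    "\<And>n. gelfand_bound K L T n (D * v n powr \<eta>)"
    using decayE[OF T] by blast
  let ?w = "\<lambda>n. u (n div 2) + v (n div 2)"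
  show ?thesis
  proof (rule decayI[OF _ decay_mix[OF u(1-3) v(1-3)]])
    show "compose (carrier H) T S \<in> carrier (bop H L)"
      using H K L S T by (intro bop_compose[of H K L]) (auto simp: decay_bop)
    show "D * C \<ge> 0" using u v by simp
    fix n
    have "(D * v (n div 2) powr \<eta>) * (C * u (n div 2) powr \<theta>)
        = (D * C) * (v (n div 2) powr \<eta> * u (n div 2) powr \<theta>)" by simp
    also have "\<dots> \<le> (D * C) * (?w n powr \<eta> * ?w n powr \<theta>)"
      using u(2)[of "n div 2"] v(2)[of "n div 2"] u(4) v(4) \<open>\<theta> \<ge> 0\<close> \<open>\<eta> \<ge> 0\<close>
      by (intro mult_left_mono mult_mono powr_mono2) auto
    also have "\<dots> = (D * C) * ?w n powr (\<eta> + \<theta>)" by (simp add: powr_add)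
    finally have "(D * v (n div 2) powr \<eta>) * (C * u (n div 2) powr \<theta>) \<le> (D * C) * ?w n powr (\<eta> + \<theta>)" .
    moreover have "gelfand_bound H L (compose (carrier H) T S) (n div 2 + n div 2)
        ((D * v (n div 2) powr \<eta>) * (C * u (n div 2) powr \<theta>))"
      using H K L S T u v by (intro gelfand_bound_compose[of H K L]) (auto simp: decay_bop)
    ultimately show "gelfand_bound H L (compose (carrier H) T S) n (D * C * ?w n powr (\<eta> + \<theta>))"
      by (rule gelfand_bound_mono[OF H, rotated -1]) auto
  qed
qed

lemma decay_smult:
  assumes H: "hilbert_space H" and K: "hilbert_space K" and T: "T \<in> decay \<theta> H K"
  shows "c \<odot>\<^bsub>bop H K\<^esub> T \<in> decay \<theta> H K"
proof -
  obtain u C where u: "decseq u" "\<And>n. u n > 0" "summable u" "C \<ge> 0"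
    "\<And>n. gelfand_bound H K T n (C * u n powr \<theta>)"
    using decayE[OF T] by blast
  show ?thesis
  proof (rule decayI[OF _ u(1-3)])
    show "gelfand_bound H K (c \<odot>\<^bsub>bop H K\<^esub> T) n ((cmod c * C) * u n powr \<theta>)" for n
      using gelfand_bound_smult[OF H K decay_bop[OF T] u(5), of c n] by (simp only: mult.assoc)
  qed (use u H K T in \<open>auto simp: decay_bop\<close>)
qed

text \<open>As \<open>u\<close> decreases, the surplus power
  \<open>u n powr (\<theta> - \<eta>)\<close> is at most its value at 0 and goes into the
  constant.\<close>

lemma decay_mono:
  assumes H: "hilbert_space H" and "\<eta> \<le> \<theta>" and T: "T \<in> decay \<theta> H K"
  shows "T \<in> decay \<eta> H K"
proof -
  obtain u C where u: "decseq u" "\<And>n. u n > 0" "summable u" "C \<ge> 0"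
    "\<And>n. gelfand_bound H K T n (C * u n powr \<theta>)"
    using decayE[OF T] by blast
  show ?thesis
  proof (rule decayI[OF decay_bop[OF T] u(1-3)])
    show "C * u 0 powr (\<theta> - \<eta>) \<ge> 0" using u by simp
    fix n
    have "u n powr \<theta> = u n powr (\<theta> - \<eta>) * u n powr \<eta>" by (simp flip: powr_add)
    also have "\<dots> \<le> u 0 powr (\<theta> - \<eta>) * u n powr \<eta>"
      using u(1) u(2)[of n] \<open>\<eta> \<le> \<theta>\<close> by (intro mult_right_mono powr_mono2) (auto simp: decseq_def)
    finally have "C * u n powr \<theta> \<le> C * u 0 powr (\<theta> - \<eta>) * u n powr \<eta>"
      using u(4) by (simp add: mult_left_mono mult.assoc)
    then show "gelfand_bound H K T n (C * u 0 powr (\<theta> - \<eta>) * u n powr \<eta>)"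
      using gelfand_bound_mono[OF H u(5)] by blast
  qed
qed

text \<open>This lets bounded factors enter \<open>decay_compose\<close> without changing the
  exponent. At exponent 0 the sequence is irrelevant, and a geometric one is positive and
  summable.\<close>

lemma bop_decay_0:
  assumes H: "hilbert_space H" and T: "T \<in> carrier (bop H K)"
  shows "T \<in> decay 0 H K"
proof -
  obtain B where B: "B \<ge> 0" "\<And>x. x \<in> carrier H \<Longrightarrow> hnorm K (T x) \<le> B * hnorm H x"
    using bop_bound[OF H T] by blast
  show ?thesis
  proof (rule decayI[OF T])
    show "decseq (\<lambda>n. (1 / 2) ^ n :: real)" by (simp add: decseq_def power_decreasing)
    show "gelfand_bound H K T n (B * ((1 / 2) ^ n) powr 0)" for n
      using gelfand_bound_mono[OF H gelfand_bound_bounded[OF B(2)], of n B] by simp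
  qed (use B in \<open>auto intro!: summable_geometric\<close>)
qed

lemma zero_decay:
  assumes H: "hilbert_space H" and K: "hilbert_space K"
  shows "\<zero>\<^bsub>bop H K\<^esub> \<in> decay \<theta> H K"
proof (rule decayI)
  show "decseq (\<lambda>n. (1 / 2) ^ n :: real)" by (simp add: decseq_def power_decreasing)
  have "gelfand_bound H K \<zero>\<^bsub>bop H K\<^esub> 0 0" using H K by (intro gelfand_bound_bounded) simp
  then show "gelfand_bound H K \<zero>\<^bsub>bop H K\<^esub> n (0 * ((1 / 2) ^ n) powr \<theta>)" for n
    using gelfand_bound_mono[OF H, of K _ 0 0 n] by simp
qed (use H K in \<open>auto intro!: summable_geometric\<close>)

text \<open>A bound up to a constant factor suffices, so instead of sorting the eigenvalues, elements of the
  eigenbasis are picked greedily with eigenvalue above half the Gelfand number.\<close>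

lemma schatten_decay:
  assumes H: "hilbert_space H" and K: "hilbert_space K" and p: "p > 0" and T: "T \<in> schatten p H K"
  shows "T \<in> decay (1 / p) H K"
proof -
  have TB: "T \<in> carrier (bop H K)" using T by (simp add: schatten_def)
  obtain E \<mu> where E: "orthonormal_basis H E"
    and eig: "\<And>e. e \<in> E \<Longrightarrow> \<mu> e \<ge> 0 \<and> adjoint_op H K T (T e) = complex_of_real ((\<mu> e)\<^sup>2) \<odot>\<^bsub>H\<^esub> e"
    and s: "(\<lambda>e. \<mu> e powr p) summable_on E"
    using T unfolding schatten_def by blast
  define t where "t = (\<Sum>\<^sub>\<infinity>e\<in>E. \<mu> e powr p)"
  have part: "(\<Sum>e\<in>F. \<mu> e powr p) \<le> t" if "finite F" "F \<subseteq> E" for F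
    unfolding t_def using that s by (intro finite_sum_le_infsum) auto
  have t0: "t \<ge> 0" using part[of "{}"] by simp
  \<comment> \<open>\<open>Q n s\<close> allows at most \<open>n\<close> eigenvalues above the
    threshold \<open>s\<close>; the infimum \<open>a n\<close> of such thresholds is the singular
    value with index \<open>n\<close>, counted from 0, without any sorting.\<close>
  define Q where "Q n s \<longleftrightarrow> s \<ge> 0 \<and> finite {e \<in> E. s < \<mu> e} \<and> card {e \<in> E. s < \<mu> e} \<le> n" for n s
  define a where "a n = Inf {s. Q n s}" for n
  \<comment> \<open>No eigenvalue exceeds this number, since a single term is at most the whole sum;
    so the infimum is over a nonempty set.\<close>
  have Q0: "Q n (t powr (1 / p))" for n
  proof -
    have "\<not> t powr (1 / p) < \<mu> e" if "e \<in> E" for e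
    proof -
      have "\<mu> e powr p \<le> t" using part[of "{e}"] that by simp
      then have "(\<mu> e powr p) powr (1 / p) \<le> t powr (1 / p)" using p by (intro powr_mono2) auto
      then show ?thesis using p eig[OF that] by (simp add: powr_powr)
    qed
    then have "{e \<in> E. t powr (1 / p) < \<mu> e} = {}" by blast
    then show ?thesis unfolding Q_def by (simp del: Collect_empty_eq)
  qed
  have bdd: "bdd_below {s. Q n s}" for n by (rule bdd_belowI[of _ 0]) (auto simp: Q_def)
  have a0: "a n \<ge> 0" for n
    unfolding a_def by (rule cInf_greatest) (use Q0[of n] in \<open>blast, simp add: Q_def\<close>)
  have aQ: "Q n s" if less: "a n < s" for n s
  proof -
    have ne: "{s. Q n s} \<noteq> {}" using Q0[of n] by blast
    obtain s' where s': "Q n s'" "s' < s"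
      using cInf_lessD[OF ne less[unfolded a_def]] by blast
    have sub: "{e \<in> E. s < \<mu> e} \<subseteq> {e \<in> E. s' < \<mu> e}" using s' by auto
    have *: "finite {e \<in> E. s' < \<mu> e}" "card {e \<in> E. s' < \<mu> e} \<le> n" "0 \<le> s'"
      using s' by (auto simp: Q_def)
    then show ?thesis
      unfolding Q_def using s'(2) finite_subset[OF sub *(1)] card_mono[OF *(1) sub] by linarith
  qed
  have nQ: "\<not> Q n s" if "s < a n" for n s
    using cInf_lower[OF _ bdd, of s n] that unfolding a_def by auto
  have adec: "a n \<le> a m" if "m \<le> n" for m n
    unfolding a_def
  proof (rule cInf_superset_mono)
    show "{s. Q m s} \<noteq> {}" using Q0 by blast
    show "{s. Q m s} \<subseteq> {s. Q n s}" using that by (auto simp: Q_def)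
  qed (rule bdd)
  have greedy: "\<exists>F. finite F \<and> F \<subseteq> E \<and> card F \<le> N \<and> (\<Sum>n<N. (a n / 2) powr p) \<le> (\<Sum>e\<in>F. \<mu> e powr p)"
    for N
  proof (induction N)
    case 0
    show ?case by (intro exI[of _ "{}"]) auto
  next
    case (Suc N)
    then obtain F where F: "finite F" "F \<subseteq> E" "card F \<le> N"
      "(\<Sum>n<N. (a n / 2) powr p) \<le> (\<Sum>e\<in>F. \<mu> e powr p)" by blast
    show ?case
    proof (cases "a N = 0")
      case True
      then show ?thesis using F by (intro exI[of _ F]) auto
    next
      case False
      then have "a N / 2 < a N" "0 \<le> a N / 2" using a0[of N] by auto
      from nQ[OF this(1)] this(2) have n: "\<not> (finite {e \<in> E. a N / 2 < \<mu> e} \<and> card {e \<in> E. a N / 2 < \<mu> e} \<le> N)"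
        by (simp add: Q_def)
      \<comment> \<open>Half of a positive infimum is not admissible, so more than \<open>N\<close>
        eigenvalues lie above it, too many for \<open>F\<close> to contain.\<close>
      have "\<not> {e \<in> E. a N / 2 < \<mu> e} \<subseteq> F"
        using n F(1,3) by (meson card_mono finite_subset order_trans)
      then obtain e where e: "e \<in> E" "a N / 2 < \<mu> e" "e \<notin> F" by blast
      have "(a N / 2) powr p \<le> \<mu> e powr p" using e p a0[of N] by (intro powr_mono2) auto
      then show ?thesis using F e by (intro exI[of _ "insert e F"]) auto
    qed
  qed
  have suma: "summable (\<lambda>n. (a n / 2) powr p)"
  proof (rule summableI_nonneg_bounded)
    show "(\<Sum>n<N. (a n / 2) powr p) \<le> t" for N using greedy[of N] part by (meson order_trans)
  qed simp
  \<comment> \<open>The geometric term only makes \<open>u\<close> strictly positive.\<close>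
  define u where "u n = (a n / 2) powr p + (1 / 2) ^ n" for n
  show ?thesis
  proof (rule decayI[OF TB])
    show "decseq u"
      unfolding decseq_def u_def
    proof (intro allI impI add_mono)
      fix m n :: nat assume "m \<le> n"
      then show "(a n / 2) powr p \<le> (a m / 2) powr p"
        using adec[of m n] a0[of n] p by (intro powr_mono2) auto
      show "(1 / 2) ^ n \<le> ((1 / 2) ^ m :: real)" using \<open>m \<le> n\<close> by (intro power_decreasing) auto
    qed
    show pos: "u n > 0" for n by (simp add: u_def add_nonneg_pos)
    show "summable u" unfolding u_def by (intro summable_add suma summable_geometric) simp
    fix n
    \<comment> \<open>The infimum \<open>a n\<close> need not be admissible itself, so a strict
      inequality is required; enlarging the natural constant 2 to 3 provides it.\<close>
    have "a n / 2 = ((a n / 2) powr p) powr (1 / p)" using p a0[of n] by (simp add: powr_powr)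
    also have "\<dots> \<le> u n powr (1 / p)" using p by (intro powr_mono2) (auto simp: u_def)
    also have "\<dots> < 3 / 2 * u n powr (1 / p)" using pos[of n] by simp
    finally have "Q n (3 * u n powr (1 / p))" by (intro aQ) auto
    then show "gelfand_bound H K T n (3 * u n powr (1 / p))"
      using eigenbasis_gelfand_bound[OF H K TB E eig] unfolding Q_def by blast
  qed simp
qed

section \<open>Diagonalization of \<open>T* T\<close> for compact \<open>T\<close>\<close>

section \<open>The spectral theorem\<close>

text \<open>Constraints from a Gelfand bound may be taken orthonormal, which makes the projection
  onto their span explicit. Only one inclusion of orthogonal complements is recorded: the new
  constraints imply the old ones.\<close>

lemma gram_schmidt:
  assumes H: "hilbert_space H" and "finite W" "W \<subseteq> carrier H"
  obtains V where "finite V" "orthonormal H V"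
    "\<And>x. x \<in> carrier H \<Longrightarrow> \<forall>v\<in>V. hinner H x v = 0 \<Longrightarrow> \<forall>w\<in>W. hinner H x w = 0"
proof -
  have "\<exists>V. finite V \<and> orthonormal H V \<and>
    (\<forall>x\<in>carrier H. (\<forall>v\<in>V. hinner H x v = 0) \<longrightarrow> (\<forall>w\<in>W. hinner H x w = 0))"
    using assms(2,3)
  proof (induction W rule: finite_induct)
    case empty
    show ?case by (intro exI[of _ "{}"]) (simp add: orthonormal_def)
  next
    case (insert w W)
    then obtain V where V: "finite V" "orthonormal H V"
      "\<And>x. x \<in> carrier H \<Longrightarrow> \<forall>v\<in>V. hinner H x v = 0 \<Longrightarrow> \<forall>w\<in>W. hinner H x w = 0"
      by auto
    have w: "w \<in> carrier H" using insert by simp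
    have VH: "V \<subseteq> carrier H" using V(2) by (simp add: orthonormal_def)
    define l where "l = lincomb H (hinner H w) V"
    define r where "r = w \<ominus>\<^bsub>H\<^esub> l"
    have l: "l \<in> carrier H" and r: "r \<in> carrier H" using H VH w by (auto simp: r_def l_def)
    have rV: "hinner H r v = 0" if "v \<in> V" for v
      unfolding r_def l_def by (rule hinner_minus_lincomb) (use H V w that in auto)
    have lx: "hinner H x l = 0" if "x \<in> carrier H" "\<forall>v\<in>V. hinner H x v = 0" for x
    proof -
      have "hinner H v x = 0" if "v \<in> V" for v
        using \<open>\<forall>v\<in>V. hinner H x v = 0\<close> that hinner_commute[of H x v] \<open>x \<in> carrier H\<close> H VH by auto
      then have "hinner H l x = 0"
        unfolding l_def using that H VH by (subst hinner_lincomb_left) auto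
      then show ?thesis using hinner_commute[of H l x] that H l by simp
    qed
    show ?case
    proof (cases "r = \<zero>\<^bsub>H\<^esub>")
      case True
      have "hinner H x w = 0" if x: "x \<in> carrier H" "\<forall>v\<in>V. hinner H x v = 0" for x
      proof -
        have "hinner H x r = 0" using True H x by simp
        then show ?thesis using lx[OF x] H x w l by (simp add: r_def)
      qed
      then show ?thesis using V by (intro exI[of _ V]) auto
    next
      case False
      define q where "q = of_real (1 / hnorm H r) \<odot>\<^bsub>H\<^esub> r"
      have q: "q \<in> carrier H" "hinner H q q = 1"
        unfolding q_def using H r hnorm_normalize[OF H r False] by auto
      have nr: "hnorm H r \<noteq> 0" using False H r by simp
      have qV: "hinner H q v = 0" "hinner H v q = 0" if "v \<in> V" for v
      proof -
        have v: "v \<in> carrier H" using that VH by blast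
        show *: "hinner H q v = 0" unfolding q_def using H r v rV[OF that] by simp
        show "hinner H v q = 0" using * hinner_commute[of H q v] H q v by simp
      qed
      have "orthonormal H (insert q V)"
      proof -
        have "q \<notin> V" using qV(1)[of q] q(2) by auto
        then show ?thesis using V(2) q qV unfolding orthonormal_def by auto
      qed
      moreover have "hinner H x w = 0"
        if x: "x \<in> carrier H" "\<forall>v\<in>insert q V. hinner H x v = 0" for x
      proof -
        have "hinner H x q = 0" using x by simp
        then have "hinner H x r = 0" unfolding q_def using H r x nr by simp
        moreover have "hinner H x l = 0" using lx x by simp
        ultimately show ?thesis using H x w l by (simp add: r_def)
      qed
      ultimately show ?thesis using V by (intro exI[of _ "insert q V"]) auto
    qed
  qed
  then show thesis using that by blast
qed

text \<open>Bolzano-Weierstrass for finitely many coordinates, refining the subsequence once per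
  coordinate.\<close>

lemma convergent_subsequence_family:
  fixes f :: "nat \<Rightarrow> 'a \<Rightarrow> complex"
  assumes "finite W" "\<And>w. w \<in> W \<Longrightarrow> bounded (range (\<lambda>n. f n w))"
  obtains r l where "strict_mono (r :: nat \<Rightarrow> nat)" "\<And>w. w \<in> W \<Longrightarrow> (\<lambda>n. f (r n) w) \<longlonglongrightarrow> l w"
proof -
  have "\<exists>r l. strict_mono (r :: nat \<Rightarrow> nat) \<and> (\<forall>w\<in>W. (\<lambda>n. f (r n) w) \<longlonglongrightarrow> l w)"
    using assms
  proof (induction W rule: finite_induct)
    case empty
    show ?case by (intro exI[of _ "\<lambda>n. n"]) (auto simp: strict_mono_def)
  next
    case (insert w W)
    then obtain r l where r: "strict_mono (r :: nat \<Rightarrow> nat)" "\<And>w. w \<in> W \<Longrightarrow> (\<lambda>n. f (r n) w) \<longlonglongrightarrow> l w"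
      by blast
    have "bounded (range (\<lambda>n. f (r n) w))"
      by (rule bounded_subset[OF insert.prems[of w]]) auto
    then obtain k s where s: "strict_mono (s :: nat \<Rightarrow> nat)" "((\<lambda>n. f (r n) w) \<circ> s) \<longlonglongrightarrow> k"
      using bounded_imp_convergent_subsequence by blast
    have "(\<lambda>n. f (r (s n)) v) \<longlonglongrightarrow> (l(w := k)) v" if "v \<in> insert w W" for v
    proof (cases "v = w")
      case False
      then show ?thesis
        using LIMSEQ_subseq_LIMSEQ[OF r(2)[of v] s(1)] that by (simp add: o_def)
    qed (use s in \<open>simp add: o_def\<close>)
    then show ?case
      using strict_mono_o[OF r(1) s(1)]
      by (intro exI[of _ "\<lambda>n. r (s n)"] exI[of _ "l(w := k)"]) (auto simp: o_def)
  qed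
  then show thesis using that by blast
qed

text \<open>The norm of \<open>T\<close> on the complement of \<open>E\<close> is attained, without
  weak compactness. For a maximizing sequence the parallelogram law bounds \<open>T\<close> of a
  difference from below by nearly \<open>s\<close> times its norm. Off finitely many directions
  \<open>T\<close> has norm at most \<open>s / 2\<close>, and in those directions the coordinates
  converge along a subsequence. The two bounds together make the subsequence Cauchy.\<close>

lemma maximizing_vector:
  assumes H: "hilbert_space H" and K: "hilbert_space K" and T: "T \<in> carrier (bop H K)"
    and cpt: "\<And>e. e > 0 \<Longrightarrow> \<exists>n. gelfand_bound H K T n e"
    and EH: "E \<subseteq> carrier H"
    and x0: "x0 \<in> carrier H" "\<forall>e\<in>E. hinner H x0 e = 0" "T x0 \<noteq> \<zero>\<^bsub>K\<^esub>"
  obtains x where "x \<in> carrier H" "\<forall>e\<in>E. hinner H x e = 0" "hnorm H x = 1" "hnorm K (T x) > 0"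
    "\<And>y. y \<in> carrier H \<Longrightarrow> \<forall>e\<in>E. hinner H y e = 0 \<Longrightarrow> hnorm K (T y) \<le> hnorm K (T x) * hnorm H y"
proof -
  define U where "U = {x \<in> carrier H. \<forall>e\<in>E. hinner H x e = 0}"
  have UH: "x \<in> carrier H" if "x \<in> U" for x using that by (simp add: U_def)
  have eH: "e \<in> carrier H" if "e \<in> E" for e using EH that by blast
  have U_add: "x \<oplus>\<^bsub>H\<^esub> y \<in> U" and U_minus: "x \<ominus>\<^bsub>H\<^esub> y \<in> U" if "x \<in> U" "y \<in> U" for x y
    using that H eH by (auto simp: U_def)
  have U_smult: "c \<odot>\<^bsub>H\<^esub> x \<in> U" if "x \<in> U" for x c
    using that H eH by (auto simp: U_def)
  obtain B where B: "B \<ge> 0" "\<And>x. x \<in> carrier H \<Longrightarrow> hnorm K (T x) \<le> B * hnorm H x"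
    using bop_bound[OF H T] by blast
  define A where "A = {hnorm K (T x) | x. x \<in> U \<and> hnorm H x = 1}"
  define s where "s = Sup A"
  have Abdd: "bdd_above A"
    unfolding bdd_above_def A_def using B UH by (intro exI[of _ B]) force
  have le_s: "hnorm K (T y) \<le> s * hnorm H y" if y: "y \<in> U" for y
  proof (cases "y = \<zero>\<^bsub>H\<^esub>")
    case False
    define q where "q = of_real (1 / hnorm H y) \<odot>\<^bsub>H\<^esub> y"
    have ny: "hnorm H y > 0"
      using False H UH[OF y] by (metis hnorm_eq_zero hnorm_nonneg less_eq_real_def)
    have "hnorm H q = 1" using ny False H UH[OF y] by (simp add: q_def norm_divide)
    then have "hnorm K (T q) \<in> A" using U_smult[OF y] by (auto simp: A_def q_def)
    then have "hnorm K (T q) \<le> s" unfolding s_def using Abdd by (rule cSup_upper)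
    moreover have "hnorm K (T q) = hnorm K (T y) / hnorm H y"
      using ny H K T UH[OF y] by (simp add: q_def norm_divide)
    ultimately show ?thesis using ny by (simp add: pos_divide_le_eq)
  qed (use H K T in simp)
  have s0: "s > 0"
  proof -
    have x0U: "x0 \<in> U" using x0 by (simp add: U_def)
    have "hnorm K (T x0) > 0"
      using x0 T K by (metis bop_closed hnorm_eq_zero hnorm_nonneg less_eq_real_def)
    then have "0 < s * hnorm H x0" using le_s[OF x0U] by linarith
    then show ?thesis using H x0 by (meson hnorm_nonneg not_less zero_less_mult_pos2 mult_nonpos_nonneg leD)
  qed
  have "A \<noteq> {}"
  proof
    assume "A = {}"
    define q where "q = of_real (1 / hnorm H x0) \<odot>\<^bsub>H\<^esub> x0"
    have x0U: "x0 \<in> U" using x0 by (simp add: U_def)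
    have "hnorm H x0 \<noteq> 0" using x0 H K T by auto
    then have "hnorm H q = 1" using H x0 by (simp add: q_def norm_divide)
    then have "hnorm K (T q) \<in> A" using U_smult[OF x0U] by (auto simp: A_def q_def)
    with \<open>A = {}\<close> show False by simp
  qed
  have "\<exists>x. x \<in> U \<and> hnorm H x = 1 \<and> s - 1 / real (Suc n) < hnorm K (T x)" for n
    using less_cSupD[OF \<open>A \<noteq> {}\<close>, of "s - 1 / real (Suc n)"] unfolding s_def A_def by force
  then obtain \<xi> where \<xi>: "\<And>n. \<xi> n \<in> U" "\<And>n. hnorm H (\<xi> n) = 1"
    "\<And>n. s - 1 / real (Suc n) < hnorm K (T (\<xi> n))" by metis
  have lim: "(\<lambda>n. hnorm K (T (\<xi> n))) \<longlonglongrightarrow> s"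
  proof (rule tendsto_sandwich)
    show "\<forall>\<^sub>F n in sequentially. s - 1 / real (Suc n) \<le> hnorm K (T (\<xi> n))"
      by (intro always_eventually allI less_imp_le \<xi>(3))
    show "\<forall>\<^sub>F n in sequentially. hnorm K (T (\<xi> n)) \<le> s"
      using le_s[OF \<xi>(1)] \<xi>(2) by auto
    show "(\<lambda>n. s - 1 / real (Suc n)) \<longlonglongrightarrow> s"
      using tendsto_diff[OF tendsto_const LIMSEQ_inverse_real_of_nat, of s] by (simp add: inverse_eq_divide)
  qed simp
  \<comment> \<open>Half of \<open>s\<close> is small enough: squaring a sum of two terms loses a
    factor 2, and \<open>2 * (s / 2)\<^sup>2\<close> is still below
    \<open>s\<^sup>2\<close>.\<close>
  obtain n where "gelfand_bound H K T n (s / 2)" using cpt[of "s / 2"] s0 by auto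
  then obtain W where W: "finite W" "W \<subseteq> carrier H"
    "\<And>x. x \<in> carrier H \<Longrightarrow> \<forall>w\<in>W. hinner H x w = 0 \<Longrightarrow> hnorm K (T x) \<le> s / 2 * hnorm H x"
    unfolding gelfand_bound_def by blast
  obtain V where V: "finite V" "orthonormal H V"
    "\<And>x. x \<in> carrier H \<Longrightarrow> \<forall>v\<in>V. hinner H x v = 0 \<Longrightarrow> \<forall>w\<in>W. hinner H x w = 0"
    using gram_schmidt[OF H W(1,2)] by blast
  have VH: "V \<subseteq> carrier H" using V(2) by (simp add: orthonormal_def)
  have "bounded (range (\<lambda>n. hinner H (\<xi> n) v))" if "v \<in> V" for v
  proof -
    have "cmod (hinner H (\<xi> n) v) \<le> hnorm H v" for n
      using cauchy_schwarz[OF H UH[OF \<xi>(1)], of v n] \<xi>(2)[of n] VH that by auto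
    then show ?thesis unfolding bounded_iff by blast
  qed
  then obtain r l where r: "strict_mono (r :: nat \<Rightarrow> nat)"
    and l: "\<And>v. v \<in> V \<Longrightarrow> (\<lambda>n. hinner H (\<xi> (r n)) v) \<longlonglongrightarrow> l v"
    using convergent_subsequence_family[OF V(1), of "\<lambda>n. hinner H (\<xi> n)"] by blast
  define \<zeta> where "\<zeta> n = \<xi> (r n)" for n
  have \<zeta>: "\<And>n. \<zeta> n \<in> U" "\<And>n. hnorm H (\<zeta> n) = 1" "(\<lambda>n. hnorm K (T (\<zeta> n))) \<longlonglongrightarrow> s"
    using \<xi> LIMSEQ_subseq_LIMSEQ[OF lim r] by (auto simp: \<zeta>_def o_def)
  have \<zeta>H: "\<zeta> n \<in> carrier H" for n by (rule UH[OF \<zeta>(1)])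
  define G where "G n = (\<Sum>v\<in>V. (cmod (hinner H (\<zeta> n) v - l v))\<^sup>2)" for n
  \<comment> \<open>The error attached to one index: the deviation of its
    \<open>V\<close>-coordinates from their limits and the defect of its image norm from the
    supremum. Its coefficients are those that come out of \<open>key\<close>.\<close>
  define J where "J n = 4 * B\<^sup>2 * G n + 2 * (s\<^sup>2 - (hnorm K (T (\<zeta> n)))\<^sup>2)" for n
  have "(\<lambda>n. G n) \<longlonglongrightarrow> (\<Sum>v\<in>V. (cmod (l v - l v))\<^sup>2)"
    unfolding G_def \<zeta>_def by (intro tendsto_intros l)
  then have "J \<longlonglongrightarrow> 4 * B\<^sup>2 * (\<Sum>v\<in>V. (cmod (l v - l v))\<^sup>2) + 2 * (s\<^sup>2 - s\<^sup>2)"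
    unfolding J_def by (intro tendsto_intros \<zeta>(3))
  then have J: "J \<longlonglongrightarrow> 0" by simp
  have key: "s\<^sup>2 / 2 * (hnorm H (\<zeta> m \<ominus>\<^bsub>H\<^esub> \<zeta> n))\<^sup>2 \<le> J m + J n" for m n
  proof -
    define y where "y = \<zeta> m \<ominus>\<^bsub>H\<^esub> \<zeta> n"
    have yU: "y \<in> U" and y: "y \<in> carrier H" using U_minus \<zeta>(1) UH by (auto simp: y_def)
    have "hnorm K (T (\<zeta> m \<oplus>\<^bsub>H\<^esub> \<zeta> n)) \<le> s * hnorm H (\<zeta> m \<oplus>\<^bsub>H\<^esub> \<zeta> n)"
      by (intro le_s U_add \<zeta>)
    \<comment> \<open>The parallelogram law is used in both spaces: the image of the sum is at most
      \<open>s\<close> times its norm, which leaves a lower bound for the image of the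
      difference.\<close>
    then have "(hnorm K (T (\<zeta> m \<oplus>\<^bsub>H\<^esub> \<zeta> n)))\<^sup>2 \<le> (s * hnorm H (\<zeta> m \<oplus>\<^bsub>H\<^esub> \<zeta> n))\<^sup>2"
      using K T H \<zeta>H by (intro power_mono) auto
    also have "\<dots> = s\<^sup>2 * (4 - (hnorm H y)\<^sup>2)"
      using H \<zeta>H \<zeta>(2) by (simp add: y_def power_mult_distrib hnorm_add_sq hnorm_minus_sq)
    finally have 1: "(hnorm K (T (\<zeta> m) \<oplus>\<^bsub>K\<^esub> T (\<zeta> n)))\<^sup>2 \<le> s\<^sup>2 * (4 - (hnorm H y)\<^sup>2)"
      using T \<zeta>H by simp
    have "(hnorm K (T y))\<^sup>2 = 2 * (hnorm K (T (\<zeta> m)))\<^sup>2 + 2 * (hnorm K (T (\<zeta> n)))\<^sup>2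
        - (hnorm K (T (\<zeta> m) \<oplus>\<^bsub>K\<^esub> T (\<zeta> n)))\<^sup>2"
      using H K T \<zeta>H by (simp add: y_def hnorm_add_sq hnorm_minus_sq)
    with 1 have lower: "s\<^sup>2 * (hnorm H y)\<^sup>2 - 2 * (s\<^sup>2 - (hnorm K (T (\<zeta> m)))\<^sup>2)
        - 2 * (s\<^sup>2 - (hnorm K (T (\<zeta> n)))\<^sup>2) \<le> (hnorm K (T y))\<^sup>2"
      by (simp add: algebra_simps)
    \<comment> \<open>Projection onto the exceptional directions: on \<open>y\<close> minus
      \<open>P\<close> the bound \<open>s / 2\<close> holds, and \<open>P\<close> is controlled by
      the coordinates.\<close>
    define P where "P = lincomb H (hinner H y) V"
    have P: "P \<in> carrier H" using H VH by (simp add: P_def)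
    have "\<forall>v\<in>V. hinner H (y \<ominus>\<^bsub>H\<^esub> P) v = 0"
      unfolding P_def using hinner_minus_lincomb[OF H V(2,1) y] by blast
    then have "hnorm K (T (y \<ominus>\<^bsub>H\<^esub> P)) \<le> s / 2 * hnorm H (y \<ominus>\<^bsub>H\<^esub> P)"
      using V(3) W(3) H y P by simp
    also have "\<dots> \<le> s / 2 * hnorm H y"
    proof -
      have "(hnorm H (y \<ominus>\<^bsub>H\<^esub> P))\<^sup>2 \<le> (hnorm H y)\<^sup>2"
        unfolding P_def hnorm_minus_lincomb[OF H V(2,1) y] by (simp add: sum_nonneg)
      then have "hnorm H (y \<ominus>\<^bsub>H\<^esub> P) \<le> hnorm H y" by (rule power2_le_imp_le) (use H y in simp)
      then show ?thesis using s0 by simp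
    qed
    finally have a: "hnorm K (T (y \<ominus>\<^bsub>H\<^esub> P)) \<le> s / 2 * hnorm H y" .
    have "y = (y \<ominus>\<^bsub>H\<^esub> P) \<oplus>\<^bsub>H\<^esub> P" using H y P by (intro hs_eqI[of H]) auto
    then have "T y = T (y \<ominus>\<^bsub>H\<^esub> P) \<oplus>\<^bsub>K\<^esub> T P" using H T y P by (metis bop_add hs_minus)
    then have "hnorm K (T y) \<le> hnorm K (T (y \<ominus>\<^bsub>H\<^esub> P)) + hnorm K (T P)"
      using hnorm_triangle[of K "T (y \<ominus>\<^bsub>H\<^esub> P)" "T P"] H K T y P by simp
    then have "hnorm K (T y) \<le> s / 2 * hnorm H y + B * hnorm H P" using a B(2)[OF P] by linarith
    then have "(hnorm K (T y))\<^sup>2 \<le> (s / 2 * hnorm H y + B * hnorm H P)\<^sup>2"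
      using K T y by (intro power_mono) auto
    \<comment> \<open>The inequality
      \<open>(a + b)\<^sup>2 \<le> 2 * a\<^sup>2 + 2 * b\<^sup>2\<close>, equivalent to
      \<open>(a - b)\<^sup>2 \<ge> 0\<close>.\<close>
    also have "\<dots> \<le> 2 * (s / 2 * hnorm H y)\<^sup>2 + 2 * (B * hnorm H P)\<^sup>2"
      using sum_squares_ge_zero[of "s / 2 * hnorm H y - B * hnorm H P" 0]
      by (simp add: power2_eq_square algebra_simps)
    also have "\<dots> = s\<^sup>2 / 2 * (hnorm H y)\<^sup>2 + 2 * B\<^sup>2 * (hnorm H P)\<^sup>2"
      by (simp add: power2_eq_square)
    finally have upper: "(hnorm K (T y))\<^sup>2 \<le> s\<^sup>2 / 2 * (hnorm H y)\<^sup>2 + 2 * B\<^sup>2 * (hnorm H P)\<^sup>2" .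
    have "(hnorm H P)\<^sup>2 = (\<Sum>v\<in>V. (cmod (hinner H y v))\<^sup>2)"
      unfolding P_def by (rule hnorm_lincomb) fact+
    also have "\<dots> \<le> (\<Sum>v\<in>V. 2 * (cmod (hinner H (\<zeta> m) v - l v))\<^sup>2 + 2 * (cmod (hinner H (\<zeta> n) v - l v))\<^sup>2)"
    proof (rule sum_mono)
      fix v assume v: "v \<in> V"
      let ?a = "cmod (hinner H (\<zeta> m) v - l v)" and ?b = "cmod (hinner H (\<zeta> n) v - l v)"
      have "hinner H y v = (hinner H (\<zeta> m) v - l v) - (hinner H (\<zeta> n) v - l v)"
        using v VH H \<zeta>H subsetD[OF VH v] by (simp add: y_def)
      then have "cmod (hinner H y v) \<le> ?a + ?b" by (simp only: norm_triangle_ineq4)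
      then have "(cmod (hinner H y v))\<^sup>2 \<le> (?a + ?b)\<^sup>2" by (intro power_mono) auto
      also have "\<dots> \<le> 2 * ?a\<^sup>2 + 2 * ?b\<^sup>2"
        using sum_squares_ge_zero[of "?a - ?b" 0] by (simp add: power2_eq_square algebra_simps)
      finally show "(cmod (hinner H y v))\<^sup>2 \<le> 2 * ?a\<^sup>2 + 2 * ?b\<^sup>2" .
    qed
    also have "\<dots> = 2 * G m + 2 * G n" by (simp add: G_def sum.distrib sum_distrib_left)
    finally have "2 * B\<^sup>2 * (hnorm H P)\<^sup>2 \<le> 2 * B\<^sup>2 * (2 * G m + 2 * G n)"
      by (intro mult_left_mono) auto
    then show ?thesis
      using lower upper unfolding J_def y_def[symmetric] by (simp add: algebra_simps)
  qed
  obtain x where x: "x \<in> carrier H" "(\<lambda>n. hnorm H (\<zeta> n \<ominus>\<^bsub>H\<^esub> x)) \<longlonglongrightarrow> 0"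
  proof (rule hs_complete[OF H \<zeta>H])
    fix e :: real assume e: "e > 0"
    have "s\<^sup>2 / 2 * e\<^sup>2 / 2 > 0" using e s0 by simp
    from order_tendstoD(2)[OF J this]
    obtain N where N: "\<And>n. n \<ge> N \<Longrightarrow> J n < s\<^sup>2 / 2 * e\<^sup>2 / 2"
      unfolding eventually_sequentially by blast
    have "hnorm H (\<zeta> m \<ominus>\<^bsub>H\<^esub> \<zeta> n) < e" if "m \<ge> N" "n \<ge> N" for m n
    proof -
      have "s\<^sup>2 / 2 * (hnorm H (\<zeta> m \<ominus>\<^bsub>H\<^esub> \<zeta> n))\<^sup>2 < s\<^sup>2 / 2 * e\<^sup>2"
        using key[of m n] N[OF that(1)] N[OF that(2)] by linarith
      then have "(hnorm H (\<zeta> m \<ominus>\<^bsub>H\<^esub> \<zeta> n))\<^sup>2 < e\<^sup>2" using s0 by simp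
      then show ?thesis using e by (simp add: power2_less_imp_less)
    qed
    then show "\<exists>N. \<forall>m\<ge>N. \<forall>n\<ge>N. hnorm H (\<zeta> m \<ominus>\<^bsub>H\<^esub> \<zeta> n) < e" by blast
  qed
  have xe: "hinner H x e = 0" if "e \<in> E" for e
  proof -
    have "(\<lambda>n. hinner H (\<zeta> n) e) \<longlonglongrightarrow> hinner H x e"
      by (rule hinner_tendsto) (use H \<zeta>H x that eH in auto)
    moreover have "hinner H (\<zeta> n) e = 0" for n using \<zeta>(1)[of n] that by (simp add: U_def)
    ultimately show ?thesis by (simp add: LIMSEQ_const_iff)
  qed
  have "(\<lambda>n. hnorm H (\<zeta> n)) \<longlonglongrightarrow> hnorm H x"
    by (rule hnorm_tendsto) (use H \<zeta>H x in auto)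
  then have nx: "hnorm H x = 1" using \<zeta>(2) by (simp add: LIMSEQ_const_iff)
  have "(\<lambda>n. hnorm K (T (\<zeta> n) \<ominus>\<^bsub>K\<^esub> T x)) \<longlonglongrightarrow> 0"
  proof (rule Lim_null_comparison)
    show "\<forall>\<^sub>F n in sequentially. norm (hnorm K (T (\<zeta> n) \<ominus>\<^bsub>K\<^esub> T x)) \<le> B * hnorm H (\<zeta> n \<ominus>\<^bsub>H\<^esub> x)"
      using B(2)[of "\<zeta> n \<ominus>\<^bsub>H\<^esub> x" for n] H K T \<zeta>H x by simp
    show "(\<lambda>n. B * hnorm H (\<zeta> n \<ominus>\<^bsub>H\<^esub> x)) \<longlonglongrightarrow> 0" by (rule tendsto_mult_right_zero) (rule x)
  qed
  then have "(\<lambda>n. hnorm K (T (\<zeta> n))) \<longlonglongrightarrow> hnorm K (T x)"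
    by (intro hnorm_tendsto) (use K T \<zeta>H x in auto)
  then have Tx: "hnorm K (T x) = s" using \<zeta>(3) LIMSEQ_unique by blast
  show thesis
  proof (rule that)
    show "hnorm K (T y) \<le> hnorm K (T x) * hnorm H y"
      if "y \<in> carrier H" "\<forall>e\<in>E. hinner H y e = 0" for y
      using le_s[of y] that by (simp add: Tx U_def)
  qed (use x xe nx s0 Tx in auto)
qed

text \<open>The hypothesis \<open>cpt\<close> expresses compactness. A maximal orthonormal system of
  eigenvectors is total: a nonzero vector orthogonal to it is either killed by \<open>T\<close>, and
  is then an eigenvector for 0, or makes the maximizing vector available, which is an eigenvector of
  \<open>T* T\<close>.\<close>

lemma spectral_theorem:
  assumes H: "hilbert_space H" and K: "hilbert_space K" and T: "T \<in> carrier (bop H K)"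
    and cpt: "\<And>e. e > 0 \<Longrightarrow> \<exists>n. gelfand_bound H K T n e"
  obtains E \<mu> where "orthonormal_basis H E"
    "\<And>e. e \<in> E \<Longrightarrow> \<mu> e \<ge> 0 \<and> adjoint_op H K T (T e) = complex_of_real ((\<mu> e)\<^sup>2) \<odot>\<^bsub>H\<^esub> e"
proof -
  let ?S = "adjoint_op H K T"
  define P where "P e \<longleftrightarrow> (\<exists>\<mu>\<ge>0. ?S (T e) = complex_of_real (\<mu>\<^sup>2) \<odot>\<^bsub>H\<^esub> e)" for e
  obtain E where o: "orthonormal H E" and PE: "\<And>e. e \<in> E \<Longrightarrow> P e"
    and max: "\<And>x. x \<in> carrier H \<Longrightarrow> hinner H x x = 1 \<Longrightarrow> P x \<Longrightarrow> \<exists>e\<in>E. hinner H x e \<noteq> 0 \<or> hinner H e x \<noteq> 0"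
    using orthonormal_extend[of H "{}" P] by (auto simp: orthonormal_def)
  have EH: "E \<subseteq> carrier H" using o by (simp add: orthonormal_def)
  have max': False if x: "x \<in> carrier H" "hinner H x x = 1" "P x" and xe: "\<forall>e\<in>E. hinner H x e = 0" for x
  proof -
    have "hinner H e x = 0" if "e \<in> E" for e
      using xe that hinner_commute[of H x e] H x EH by auto
    then show False using max[OF x] xe by blast
  qed
  have "orthonormal_basis H E"
    unfolding orthonormal_basis_alt
  proof (intro conjI ballI impI o)
    fix x assume x: "x \<in> carrier H" and xe: "\<forall>e\<in>E. hinner H x e = 0"
    show "x = \<zero>\<^bsub>H\<^esub>"
    proof (rule ccontr)
      assume nz: "x \<noteq> \<zero>\<^bsub>H\<^esub>"
      show False
      proof (cases "T x = \<zero>\<^bsub>K\<^esub>")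
        case True
        define q where "q = of_real (1 / hnorm H x) \<odot>\<^bsub>H\<^esub> x"
        have q: "q \<in> carrier H" "hinner H q q = 1"
          unfolding q_def using H x hnorm_normalize[OF H x nz] by auto
        have "?S (T q) = complex_of_real (0\<^sup>2) \<odot>\<^bsub>H\<^esub> q"
          using True H K T x by (intro hs_eqI[OF H]) (auto simp: q_def adjoint_op_left)
        then have "P q" unfolding P_def by blast
        moreover have "\<forall>e\<in>E. hinner H q e = 0"
          using xe H x EH by (auto simp: q_def)
        ultimately show False using max'[OF q] by blast
      next
        case False
        obtain z where z: "z \<in> carrier H" "\<forall>e\<in>E. hinner H z e = 0" "hnorm H z = 1" "hnorm K (T z) > 0"
          and zmax: "\<And>y. y \<in> carrier H \<Longrightarrow> \<forall>e\<in>E. hinner H y e = 0 \<Longrightarrow>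
            hnorm K (T y) \<le> hnorm K (T z) * hnorm H y"
          using maximizing_vector[OF H K T cpt EH x xe False] by blast
        define s where "s = hnorm K (T z)"
        define w where "w = ?S (T z)"
        have w: "w \<in> carrier H" using H K T z by (simp add: w_def)
        have wz: "hinner H w z = of_real (s\<^sup>2)"
          unfolding w_def s_def using adjoint_op_left[OF H K T z(1), of "T z"] T z K by (simp add: hinner_self)
        \<comment> \<open>The operator \<open>T* T\<close> is symmetric and scales each
          \<open>e\<close>, so it preserves the complement of \<open>E\<close>; the maximality of
          \<open>z\<close> can thus be applied to \<open>w\<close>.\<close>
        have we: "\<forall>e\<in>E. hinner H w e = 0"
        proof
          fix e assume e: "e \<in> E"
          then have eH: "e \<in> carrier H" using EH by blast
          obtain \<mu> where \<mu>: "?S (T e) = complex_of_real (\<mu>\<^sup>2) \<odot>\<^bsub>H\<^esub> e" using PE[OF e] P_def by blast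
          have "hinner H w e = hinner K (T z) (T e)"
            unfolding w_def using adjoint_op_left[OF H K T eH, of "T z"] T z by simp
          also have "\<dots> = hinner H z (?S (T e))"
            using adjoint_op[OF H K T z(1), of "T e"] T eH by simp
          also have "\<dots> = 0" unfolding \<mu> using H z eH e by simp
          finally show "hinner H w e = 0" .
        qed
        have "(hnorm H w)\<^sup>2 = Re (hinner K (T z) (T w))"
          unfolding hnorm_sq[OF H w] using adjoint_op_left[OF H K T w, of "T z"] T z by (simp add: w_def)
        also have "\<dots> \<le> hnorm K (T z) * hnorm K (T w)"
          using cauchy_schwarz[OF K, of "T z" "T w"] T z w complex_Re_le_cmod order_trans
          by (metis bop_closed)
        also have "\<dots> \<le> s * (s * hnorm H w)"
          unfolding s_def using zmax[OF w we] K T z by (intro mult_left_mono) auto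
        finally have "(hnorm H w)\<^sup>2 \<le> s\<^sup>2 * hnorm H w" by (simp add: power2_eq_square mult.assoc)
        then have ws: "hnorm H w \<le> s\<^sup>2"
          using hnorm_nonneg[OF H w] by (cases "hnorm H w = 0") (auto simp: power2_eq_square)
        let ?d = "w \<ominus>\<^bsub>H\<^esub> of_real (s\<^sup>2) \<odot>\<^bsub>H\<^esub> z"
        \<comment> \<open>Equality case of Cauchy-Schwarz: \<open>w\<close> has norm at most
          \<open>s\<^sup>2\<close> but pairs with the unit vector \<open>z\<close> to exactly
          \<open>s\<^sup>2\<close>, so it equals that multiple of \<open>z\<close>.\<close>
        have "(hnorm H ?d)\<^sup>2 = (hnorm H w)\<^sup>2 + (s\<^sup>2)\<^sup>2 - 2 * (s\<^sup>2 * s\<^sup>2)"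
          using H w z wz by (simp add: hnorm_minus_sq norm_power power_mult_distrib)
        also have "\<dots> \<le> 0"
        proof -
          have "(hnorm H w)\<^sup>2 \<le> (s\<^sup>2)\<^sup>2" using ws H w by (intro power_mono) auto
          then show ?thesis by (simp add: power2_eq_square)
        qed
        finally have "hnorm H ?d = 0" by simp
        then have "?d = \<zero>\<^bsub>H\<^esub>" using H w z by simp
        then have "w = of_real (s\<^sup>2) \<odot>\<^bsub>H\<^esub> z"
          using H w z
          by (metis (no_types, lifting) a_minus_def abelian_group.minus_minus abelian_group.minus_equality
              hs_abelian_group hs_smult hs_uminus)
        moreover have "s \<ge> 0" using z by (simp add: s_def)
        ultimately have "P z" unfolding P_def w_def by blast
        moreover have "hinner H z z = 1" using z H by (simp add: hinner_self)
        ultimately show False using max' z by blast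
      qed
    qed
  qed
  moreover have "\<exists>\<mu>. \<forall>e\<in>E. \<mu> e \<ge> 0 \<and> ?S (T e) = complex_of_real ((\<mu> e)\<^sup>2) \<odot>\<^bsub>H\<^esub> e"
    using PE unfolding P_def by metis
  ultimately show thesis using that by blast
qed

text \<open>A positive exponent drives the bounds to zero, which is the compactness that
  \<open>spectral_theorem\<close> asks for.\<close>

lemma decay_eigenbasis:
  assumes H: "hilbert_space H" and K: "hilbert_space K" and T: "T \<in> decay \<theta> H K" and "\<theta> > 0"
  obtains E \<mu> where "orthonormal_basis H E"
    "\<And>e. e \<in> E \<Longrightarrow> \<mu> e \<ge> 0 \<and> adjoint_op H K T (T e) = complex_of_real ((\<mu> e)\<^sup>2) \<odot>\<^bsub>H\<^esub> e"
proof -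
  obtain u C where u: "decseq u" "\<And>n. u n > 0" "summable u" "C \<ge> 0"
    "\<And>n. gelfand_bound H K T n (C * u n powr \<theta>)"
    using decayE[OF T] by blast
  have "(\<lambda>n. u n powr \<theta>) \<longlonglongrightarrow> 0"
    using u(2) \<open>\<theta> > 0\<close> by (intro tendsto_zero_powrI[OF summable_LIMSEQ_zero[OF u(3)] tendsto_const])
      (auto intro: always_eventually less_imp_le)
  then have lim: "(\<lambda>n. C * u n powr \<theta>) \<longlonglongrightarrow> 0" by (rule tendsto_mult_right_zero)
  have cpt: "\<exists>n. gelfand_bound H K T n e" if e: "e > 0" for e
  proof -
    obtain n where "C * u n powr \<theta> < e"
      using order_tendstoD(2)[OF lim e] unfolding eventually_sequentially by blast
    then show ?thesis using gelfand_bound_mono[OF H u(5)[of n]] by (meson less_imp_le order_refl)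
  qed
  show thesis using spectral_theorem[OF H K decay_bop[OF T] cpt] that by blast
qed

text \<open>Among \<open>N + 1\<close> eigenvalues the smallest is at most \<open>v N\<close>, since
  otherwise all of them would exceed it. Removing it and repeating bounds any finite sum of
  eigenvalues by a partial sum of \<open>v\<close>.\<close>

lemma decay_schatten:
  assumes H: "hilbert_space H" and K: "hilbert_space K" and T: "T \<in> decay \<theta> H K" and "\<theta> \<ge> 1"
  shows "T \<in> schatten 1 H K"
proof -
  have TB: "T \<in> carrier (bop H K)" by (rule decay_bop[OF T])
  have "T \<in> decay 1 H K" using decay_mono[OF H \<open>\<theta> \<ge> 1\<close> T] .
  then obtain u C where u: "decseq u" "\<And>n. u n > 0" "summable u" "C \<ge> 0"
    "\<And>n. gelfand_bound H K T n (C * u n powr 1)"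
    using decayE by blast
  define v where "v n = C * u n" for n
  have v0: "v n \<ge> 0" for n using u(2)[of n] u(4) by (simp add: v_def)
  have gel: "gelfand_bound H K T n (v n)" for n using u(5)[of n] u(2)[of n] by (simp add: v_def)
  have sv: "summable v" unfolding v_def using u(3) by (rule summable_mult)
  have "\<theta> > 0" using \<open>\<theta> \<ge> 1\<close> by simp
  then obtain E \<mu> where E: "orthonormal_basis H E"
    and eig: "\<And>e. e \<in> E \<Longrightarrow> \<mu> e \<ge> 0 \<and> adjoint_op H K T (T e) = complex_of_real ((\<mu> e)\<^sup>2) \<odot>\<^bsub>H\<^esub> e"
    using decay_eigenbasis[OF H K T] by blast
  have o: "orthonormal H E" using E by (simp add: orthonormal_basis_alt)
  have part: "(\<Sum>e\<in>A. \<mu> e) \<le> (\<Sum>n<card A. v n)" if "finite A" "A \<subseteq> E" for A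
    using that
  proof (induction "card A" arbitrary: A)
    case 0
    then show ?case by simp
  next
    case (Suc N)
    have "A \<noteq> {}" using Suc by auto
    obtain e where e: "e \<in> A" "\<And>a. a \<in> A \<Longrightarrow> \<mu> e \<le> \<mu> a"
      using arg_min_if_finite[OF Suc(3) \<open>A \<noteq> {}\<close>, of \<mu>] by (metis not_le)
    have "\<mu> e \<le> v N"
    proof (rule ccontr)
      assume "\<not> \<mu> e \<le> v N"
      then have "card A \<le> N"
        using e eig Suc(4) v0 Suc(3) gel orthonormal_subset[OF o Suc(4)]
        by (intro gelfand_bound_card_eigenvalues[OF H K TB, of A \<mu> "v N"]) force+
      then show False using Suc(2) by simp
    qed
    moreover have card: "card (A - {e}) = N" using Suc(2,3) e(1) by simp
    have "(\<Sum>a\<in>A - {e}. \<mu> a) \<le> (\<Sum>n<N. v n)"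
      using Suc(1)[OF card[symmetric]] Suc(3,4) unfolding card by blast
    moreover have "(\<Sum>a\<in>A. \<mu> a) = \<mu> e + (\<Sum>a\<in>A - {e}. \<mu> a)"
      using Suc(3) e(1) by (simp add: sum.remove)
    ultimately show ?case by (simp add: Suc(2)[symmetric])
  qed
  have "\<mu> summable_on E"
  proof (rule nonneg_bounded_summable_on)
    fix F assume "finite F" "F \<subseteq> E"
    then have "(\<Sum>e\<in>F. \<mu> e) \<le> (\<Sum>n<card F. v n)" by (rule part)
    also have "\<dots> \<le> suminf v" using sv v0 by (intro sum_le_suminf) auto
    finally show "(\<Sum>e\<in>F. \<mu> e) \<le> suminf v" .
  qed (use eig in blast)
  then have "(\<lambda>e. \<mu> e powr 1) summable_on E"
    using eig by (subst summable_on_cong[of E _ \<mu>]) auto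
  then show ?thesis unfolding schatten_def using TB E eig by blast
qed

section \<open>The trace: independence of the basis, linearity, and invariance under cyclic
  exchange\<close>

section \<open>The trace\<close>

text \<open>The diagonal sums in \<open>E\<close> and in \<open>F\<close> are the two iterated sums
  of one double series. Cauchy-Schwarz and Bessel bound the row of \<open>e\<close> by
  \<open>hnorm H (T e)\<close>, so the series is absolutely summable and the order can be
  exchanged.\<close>

lemma trace_has_sum:
  assumes H: "hilbert_space H" and T: "T \<in> carrier (bop H H)"
    and E: "orthonormal_basis H E" and s: "(\<lambda>e. hnorm H (T e)) summable_on E"
    and F: "orthonormal_basis H F"
  shows "((\<lambda>f. hinner H (T f) f) has_sum (\<Sum>\<^sub>\<infinity>e\<in>E. hinner H (T e) e)) F"
proof -
  have oE: "orthonormal H E" and EH: "E \<subseteq> carrier H" and oF: "orthonormal H F" and FH: "F \<subseteq> carrier H"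
    using E F by (auto simp: orthonormal_basis_alt orthonormal_def)
  define g where "g e f = hinner H (T e) f * hinner H f e" for e f
  have bound: "(\<Sum>f\<in>A. cmod (g e f)) \<le> hnorm H (T e)" if e: "e \<in> E" and A: "finite A" "A \<subseteq> F" for e A
  proof -
    have eH: "e \<in> carrier H" using e EH by blast
    have "(\<Sum>f\<in>A. cmod (g e f)) = (\<Sum>f\<in>A. \<bar>cmod (hinner H (T e) f)\<bar> * \<bar>cmod (hinner H e f)\<bar>)"
    proof (rule sum.cong)
      fix f assume "f \<in> A"
      then have "cmod (hinner H f e) = cmod (hinner H e f)"
        using A FH hinner_commute[OF H eH, of f] by auto
      then show "cmod (g e f) = \<bar>cmod (hinner H (T e) f)\<bar> * \<bar>cmod (hinner H e f)\<bar>"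
        by (simp add: g_def norm_mult)
    qed simp
    also have "\<dots> \<le> L2_set (\<lambda>f. cmod (hinner H (T e) f)) A * L2_set (\<lambda>f. cmod (hinner H e f)) A"
      by (rule L2_set_mult_ineq)
    also have "\<dots> \<le> hnorm H (T e) * hnorm H e"
    proof (rule mult_mono)
      show "L2_set (\<lambda>f. cmod (hinner H (T e) f)) A \<le> hnorm H (T e)"
        unfolding L2_set_def
        by (rule real_le_lsqrt) (use bessel[OF H oF _ A, of "T e"] H T eH in auto)
      show "L2_set (\<lambda>f. cmod (hinner H e f)) A \<le> hnorm H e"
        unfolding L2_set_def
        by (rule real_le_lsqrt) (use bessel[OF H oF eH A] H eH in auto)
    qed (use H T eH in \<open>auto simp: L2_set_nonneg\<close>)
    finally show ?thesis using orthonormal_hnorm[OF oE e] by simp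
  qed
  have s1: "(\<lambda>f. cmod (g e f)) summable_on F" if "e \<in> E" for e
    by (rule nonneg_bounded_summable_on[OF _ bound[OF that]]) auto
  have "(\<lambda>e. \<Sum>\<^sub>\<infinity>f\<in>F. cmod (g e f)) summable_on E"
    by (rule summable_on_comparison_test[OF s])
      (auto intro!: infsum_le_finite_sums[OF s1 bound] infsum_nonneg)
  moreover have "norm (\<Sum>\<^sub>\<infinity>f\<in>F. cmod (g e f)) = (\<Sum>\<^sub>\<infinity>f\<in>F. cmod (g e f))" for e
    by (simp add: infsum_nonneg)
  ultimately have "(\<lambda>x. norm (case x of (e, f) \<Rightarrow> g e f)) summable_on E \<times> F"
    using s1 by (simp add: Infinite_Sum.abs_summable_on_Sigma_iff)
  then have "(\<lambda>(e, f). g e f) summable_on E \<times> F" by (rule abs_summable_summable)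
  then obtain t where t: "((\<lambda>(e, f). g e f) has_sum t) (E \<times> F)" by (auto simp: summable_on_def)
  have 1: "((\<lambda>e. hinner H (T e) e) has_sum t) E"
  proof (rule has_sum_SigmaD[OF t])
    fix e assume "e \<in> E"
    then have "e \<in> carrier H" using EH by blast
    then show "((\<lambda>f. case (e, f) of (e, f) \<Rightarrow> g e f) has_sum hinner H (T e) e) F"
      using parseval_hinner[OF H F, of "T e" e] T by (simp add: g_def)
  qed
  have "((\<lambda>(f, e). g e f) has_sum t) (F \<times> E)"
    using t has_sum_swap[of "\<lambda>(e, f). g e f" E F t] by simp
  then have "((\<lambda>f. hinner H (T f) f) has_sum t) F"
  proof (rule has_sum_SigmaD)
    fix f assume "f \<in> F"
    then have f: "f \<in> carrier H" using FH by blast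
    \<comment> \<open>In the other order \<open>e\<close> varies in the argument of
      \<open>T\<close>, and the adjoint turns the inner sum into a Parseval expansion.\<close>
    have *: "hinner H e (adjoint_op H H T f) = hinner H (T e) f" if "e \<in> carrier H" for e
      by (rule adjoint_op) (use H T f that in auto)
    have "((\<lambda>e. hinner H f e * hinner H e (adjoint_op H H T f)) has_sum hinner H (T f) f) E"
      unfolding *[OF f, symmetric] by (rule parseval_hinner) (use H E f T in auto)
    then show "((\<lambda>e. case (f, e) of (f, e) \<Rightarrow> g e f) has_sum hinner H (T f) f) E"
      using EH f * by (simp add: g_def mult.commute subset_iff cong: has_sum_cong)
  qed
  moreover have "t = (\<Sum>\<^sub>\<infinity>e\<in>E. hinner H (T e) e)" using infsumI[OF 1] by simp
  ultimately show ?thesis by simp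
qed

text \<open>Uniqueness in the definite description relies on the existence of at least one
  basis.\<close>

lemma op_trace_eqI:
  assumes "hilbert_space H"
    and "\<And>E. orthonormal_basis H E \<Longrightarrow> ((\<lambda>e. hinner H (T e) e) has_sum t) E"
  shows "op_trace H T = t"
  unfolding op_trace_def
proof (rule the_equality)
  obtain E where "orthonormal_basis H E" using ex_orthonormal_basis[OF assms(1)] by blast
  then show "s = t" if "\<forall>E. orthonormal_basis H E \<longrightarrow> ((\<lambda>e. hinner H (T e) e) has_sum s) E" for s
    using that assms(2) has_sum_unique by blast
qed (use assms in blast)

lemma hinner_eigenbasis:
  assumes H: "hilbert_space H" and K: "hilbert_space K" and T: "T \<in> carrier (bop H K)"
    and e: "e \<in> carrier H" "adjoint_op H K T (T e) = c \<odot>\<^bsub>H\<^esub> e" and x: "x \<in> carrier H"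
  shows "hinner K (T e) (T x) = c * hinner H e x"
  using adjoint_op_left[OF H K T x, of "T e"] e x H T by simp

text \<open>In an eigenbasis of \<open>T* T\<close> the norm of \<open>T e\<close> is
  \<open>\<mu> e\<close>, so the Schatten condition of exponent 1 is the summability hypothesis of
  \<open>trace_has_sum\<close>.\<close>

lemma op_trace_has_sum:
  assumes H: "hilbert_space H" and T: "T \<in> schatten 1 H H" and F: "orthonormal_basis H F"
  shows "((\<lambda>f. hinner H (T f) f) has_sum op_trace H T) F"
proof -
  obtain E \<mu> where TB: "T \<in> carrier (bop H H)" and E: "orthonormal_basis H E"
    and eig: "\<And>e. e \<in> E \<Longrightarrow> \<mu> e \<ge> 0 \<and> adjoint_op H H T (T e) = complex_of_real ((\<mu> e)\<^sup>2) \<odot>\<^bsub>H\<^esub> e"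
    and s: "(\<lambda>e. \<mu> e powr 1) summable_on E"
    using T unfolding schatten_def by blast
  have "hnorm H (T e) = \<mu> e powr 1" if e: "e \<in> E" for e
  proof -
    have "e \<in> carrier H" "hinner H e e = 1" using e E by (auto simp: orthonormal_basis_def)
    then have "(hnorm H (T e))\<^sup>2 = (\<mu> e)\<^sup>2"
      using hinner_eigenbasis[OF H H TB, of e "of_real ((\<mu> e)\<^sup>2)" e] eig[OF e] H TB
      by (simp add: hnorm_sq flip: of_real_power)
    then show ?thesis using H TB \<open>e \<in> carrier H\<close> eig[OF e] by (simp add: power2_eq_iff_nonneg)
  qed
  then have s': "(\<lambda>e. hnorm H (T e)) summable_on E" using s by (simp cong: summable_on_cong)
  have "op_trace H T = (\<Sum>\<^sub>\<infinity>e\<in>E. hinner H (T e) e)"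
    by (rule op_trace_eqI[OF H]) (rule trace_has_sum[OF H TB E s'])
  with trace_has_sum[OF H TB E s' F] show ?thesis by simp
qed

lemma op_trace_add:
  assumes H: "hilbert_space H" and S: "S \<in> schatten 1 H H" and T: "T \<in> schatten 1 H H"
  shows "op_trace H (S \<oplus>\<^bsub>bop H H\<^esub> T) = op_trace H S + op_trace H T"
proof (rule op_trace_eqI[OF H])
  fix E assume E: "orthonormal_basis H E"
  have EH: "E \<subseteq> carrier H" using E by (simp add: orthonormal_basis_def)
  have B: "S \<in> carrier (bop H H)" "T \<in> carrier (bop H H)" using S T by (auto simp: schatten_def)
  have "((\<lambda>e. hinner H (S e) e + hinner H (T e) e) has_sum (op_trace H S + op_trace H T)) E"
    by (intro has_sum_add op_trace_has_sum H S T E)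
  moreover have "hinner H ((S \<oplus>\<^bsub>bop H H\<^esub> T) e) e = hinner H (S e) e + hinner H (T e) e" if "e \<in> E" for e
    using that EH H B subsetD[OF EH that] by simp
  ultimately show "((\<lambda>e. hinner H ((S \<oplus>\<^bsub>bop H H\<^esub> T) e) e) has_sum (op_trace H S + op_trace H T)) E"
    by (simp cong: has_sum_cong)
qed

lemma op_trace_smult:
  assumes H: "hilbert_space H" and T: "T \<in> schatten 1 H H"
  shows "op_trace H (c \<odot>\<^bsub>bop H H\<^esub> T) = c * op_trace H T"
proof (rule op_trace_eqI[OF H])
  fix E assume E: "orthonormal_basis H E"
  have EH: "E \<subseteq> carrier H" using E by (simp add: orthonormal_basis_def)
  have B: "T \<in> carrier (bop H H)" using T by (auto simp: schatten_def)
  have "((\<lambda>e. c * hinner H (T e) e) has_sum (c * op_trace H T)) E"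
    by (intro has_sum_cmult_right op_trace_has_sum H T E)
  moreover have "hinner H ((c \<odot>\<^bsub>bop H H\<^esub> T) e) e = c * hinner H (T e) e" if "e \<in> E" for e
    using H B subsetD[OF EH that] by simp
  ultimately show "((\<lambda>e. hinner H ((c \<odot>\<^bsub>bop H H\<^esub> T) e) e) has_sum (c * op_trace H T)) E"
    by (simp cong: has_sum_cong)
qed

lemma op_trace_zero:
  assumes H: "hilbert_space H"
  shows "op_trace H \<zero>\<^bsub>bop H H\<^esub> = 0"
proof (rule op_trace_eqI[OF H])
  fix E assume E: "orthonormal_basis H E"
  then have EH: "E \<subseteq> carrier H" by (simp add: orthonormal_basis_def)
  have "hinner H (\<zero>\<^bsub>bop H H\<^esub> e) e = 0" if "e \<in> E" for e
    using H subsetD[OF EH that] by simp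
  then show "((\<lambda>e. hinner H (\<zero>\<^bsub>bop H H\<^esub> e) e) has_sum 0) E" by (rule has_sum_0)
qed

text \<open>With \<open>E\<close> an eigenbasis of \<open>A* A\<close>, the traces of \<open>A B\<close> and \<open>B A\<close> agree term by term in \<open>E\<close> and a
  basis extending the normalized non-zero images \<open>A e\<close>.\<close>

lemma op_trace_commute:
  assumes H: "hilbert_space H" and K: "hilbert_space K"
    and A: "A \<in> decay \<theta> H K" "\<theta> > 0" and B: "B \<in> carrier (bop K H)"
    and AB: "compose (carrier K) A B \<in> schatten 1 K K" and BA: "compose (carrier H) B A \<in> schatten 1 H H"
  shows "op_trace K (compose (carrier K) A B) = op_trace H (compose (carrier H) B A)"
proof -
  have AO: "A \<in> carrier (bop H K)" by (rule decay_bop[OF A(1)])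
  obtain E \<mu> where E: "orthonormal_basis H E"
    and eig: "\<And>e. e \<in> E \<Longrightarrow> \<mu> e \<ge> 0 \<and> adjoint_op H K A (A e) = complex_of_real ((\<mu> e)\<^sup>2) \<odot>\<^bsub>H\<^esub> e"
    using decay_eigenbasis[OF H K A] by blast
  have oE: "orthonormal H E" and EH: "\<And>e. e \<in> E \<Longrightarrow> e \<in> carrier H"
    using E by (auto simp: orthonormal_basis_alt orthonormal_def)
  \<comment> \<open>Dropping the kernel of \<open>A\<close> allows the images to be divided by their
    norms, and these are orthonormal because the squares of \<open>\<mu>\<close> diagonalize
    \<open>A* A\<close>.\<close>
  define E' where "E' = {e \<in> E. \<mu> e > 0}"
  define k where "k e = complex_of_real (1 / \<mu> e) \<odot>\<^bsub>K\<^esub> A e" for e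
  have kK: "k e \<in> carrier K" if "e \<in> E" for e using K AO EH[OF that] by (simp add: k_def)
  have inner: "hinner K (A e) (A e') = (if e = e' then of_real ((\<mu> e)\<^sup>2) else 0)"
    if "e \<in> E" "e' \<in> E" for e e'
    using hinner_eigenbasis[OF H K AO EH[OF that(1)] _ EH[OF that(2)]] eig[OF that(1)] oE that
    unfolding orthonormal_def by auto
  have kk: "hinner K (k e) (k e') = (if e = e' then 1 else 0)" if "e \<in> E'" "e' \<in> E'" for e e'
    using that inner[of e e'] K AO EH[of e] EH[of e'] by (auto simp: k_def E'_def power2_eq_square)
  have inj: "inj_on k E'"
  proof (rule inj_onI)
    fix e e' assume "e \<in> E'" "e' \<in> E'" "k e = k e'"
    then show "e = e'" using kk[of e e'] kk[of e e] by (auto split: if_splits)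
  qed
  have "orthonormal K (k ` E')"
    unfolding orthonormal_def using kk kK inj by (auto simp: E'_def inj_on_def)
  then obtain G where G: "k ` E' \<subseteq> G" "orthonormal_basis K G"
    using orthonormal_extend_basis[OF K] by blast
  have oG: "orthonormal K G" and GK: "\<And>g. g \<in> G \<Longrightarrow> g \<in> carrier K"
    using G by (auto simp: orthonormal_basis_alt orthonormal_def)
  have A0: "A e = \<zero>\<^bsub>K\<^esub>" if "e \<in> E" "e \<notin> E'" for e
  proof -
    have "\<mu> e = 0" using that eig[OF that(1)] by (auto simp: E'_def)
    then have "hinner K (A e) (A e) = 0" using inner[OF that(1,1)] by simp
    then show ?thesis using hinner_self_zero_iff[OF K, of "A e"] AO EH[OF that(1)] by simp
  qed
  have "((\<lambda>e. hinner H (compose (carrier H) B A e) e) has_sum op_trace H (compose (carrier H) B A)) E"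
    by (rule op_trace_has_sum[OF H BA E])
  then have 1: "((\<lambda>e. hinner H (B (A e)) e) has_sum op_trace H (compose (carrier H) B A)) E'"
  proof (rule has_sum_cong_neutral[THEN iffD1, rotated 3])
    fix e assume "e \<in> E - E'"
    then show "hinner H (compose (carrier H) B A e) e = 0"
      using A0[of e] EH[of e] H K B by (simp add: compose_eq)
  qed (use EH in \<open>auto simp: E'_def compose_eq\<close>)
  have "((\<lambda>g. hinner K (compose (carrier K) A B g) g) has_sum op_trace K (compose (carrier K) A B)) G"
    by (rule op_trace_has_sum[OF K AB G(2)])
  then have "((\<lambda>g. hinner K (A (B g)) g) has_sum op_trace K (compose (carrier K) A B)) (k ` E')"
  proof (rule has_sum_cong_neutral[THEN iffD1, rotated 3])
    fix g assume g: "g \<in> G - k ` E'"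
    then have gK: "g \<in> carrier K" using GK by blast
    \<comment> \<open>A basis vector \<open>g\<close> outside the normalized images is orthogonal to
      the range of \<open>A\<close>, so the adjoint kills it and its diagonal term vanishes.\<close>
    have "hinner H (adjoint_op H K A g) e = 0" if e: "e \<in> E" for e
    proof (cases "e \<in> E'")
      case True
      have "hinner K g (k e) = 0"
        using g True G(1) oG unfolding orthonormal_def by (metis DiffD1 DiffD2 imageI subsetD)
      then have "hinner K g (A e) = 0"
        using True e K AO EH[OF e] gK by (simp add: k_def E'_def)
      then show ?thesis using adjoint_op_left[OF H K AO EH[OF e] gK] by simp
    next
      case False
      then show ?thesis using adjoint_op_left[OF H K AO EH[OF e] gK] A0[OF e] K gK by simp
    qed
    then have "adjoint_op H K A g = \<zero>\<^bsub>H\<^esub>"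
      using E H K AO gK by (simp add: orthonormal_basis_alt)
    then show "hinner K (compose (carrier K) A B g) g = 0"
      using adjoint_op[OF H K AO _ gK, of "B g"] B gK H by (simp add: compose_eq)
  qed (use G GK in \<open>auto simp: compose_eq\<close>)
  then have "((\<lambda>g. hinner K (A (B g)) g) \<circ> k has_sum op_trace K (compose (carrier K) A B)) E'"
    by (subst has_sum_reindex[OF inj, symmetric])
  moreover have "((\<lambda>g. hinner K (A (B g)) g) \<circ> k) e = hinner H (B (A e)) e" if "e \<in> E'" for e
  proof -
    have e: "e \<in> E" "\<mu> e > 0" using that by (auto simp: E'_def)
    \<comment> \<open>The factor \<open>\<mu> e\<close> produced here cancels the normalization
      \<open>1 / \<mu> e\<close> in the other argument, so the terms agree exactly.\<close>
    have "adjoint_op H K A (k e) = complex_of_real (1 / \<mu> e) \<odot>\<^bsub>H\<^esub> adjoint_op H K A (A e)"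
      unfolding k_def using bop_smult[OF adjoint_closed[OF H K AO], of "A e"] AO EH[OF e(1)] by simp
    also have "\<dots> = complex_of_real (\<mu> e) \<odot>\<^bsub>H\<^esub> e"
      using eig[OF e(1)] e H EH[OF e(1)] by (intro hs_eqI[OF H]) (auto simp: power2_eq_square)
    finally have "hinner K (A (B (k e))) (k e) = hinner H (B (k e)) (complex_of_real (\<mu> e) \<odot>\<^bsub>H\<^esub> e)"
      using adjoint_op[OF H K AO _ kK[OF e(1)], of "B (k e)"] B kK[OF e(1)] by simp
    also have "\<dots> = hinner H (B (A e)) e"
      using e B AO H K EH[OF e(1)] by (simp add: k_def)
    finally show ?thesis by simp
  qed
  ultimately have "((\<lambda>e. hinner H (B (A e)) e) has_sum op_trace K (compose (carrier K) A B)) E'"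
    by (simp cong: has_sum_cong)
  with 1 show ?thesis using has_sum_unique by blast
qed

lemma op_compose_assoc:
  assumes "R \<in> carrier (bop G H)" "S \<in> carrier (bop H K)" "T \<in> carrier (bop K L)"
  shows "compose (carrier G) T (compose (carrier G) S R) = compose (carrier G) (compose (carrier H) T S) R"
  using assms by (auto simp: compose_def fun_eq_iff)

lemma op_compose_id:
  assumes "hilbert_space G" "hilbert_space H" "R \<in> carrier (bop G H)"
  shows "compose (carrier G) (id_op H) R = R" "compose (carrier G) R (id_op G) = R"
  using assms by (auto intro!: bop_eqI[of _ G H] simp: compose_eq)

section \<open>The grading operator, and parity as a commutation rule\<close>

section \<open>Gradings\<close>

lemma gsh_hilbert: "graded_separable_hilbert H \<Longrightarrow> hilbert_space H"
  by (simp add: graded_separable_hilbert_def)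

lemma submodule_hs:
  assumes H: "hilbert_space H" and A: "submodule A cfield H"
  shows "A \<subseteq> carrier H" "\<And>x y. x \<in> A \<Longrightarrow> y \<in> A \<Longrightarrow> x \<oplus>\<^bsub>H\<^esub> y \<in> A"
    "\<And>c x. x \<in> A \<Longrightarrow> c \<odot>\<^bsub>H\<^esub> x \<in> A" "\<And>x y. x \<in> A \<Longrightarrow> y \<in> A \<Longrightarrow> x \<ominus>\<^bsub>H\<^esub> y \<in> A"
proof -
  interpret module cfield H by (rule hs_module[OF H])
  note * = submoduleE[OF A]
  show 1: "A \<subseteq> carrier H" "\<And>x y. x \<in> A \<Longrightarrow> y \<in> A \<Longrightarrow> x \<oplus>\<^bsub>H\<^esub> y \<in> A"
    "\<And>c x. x \<in> A \<Longrightarrow> c \<odot>\<^bsub>H\<^esub> x \<in> A" using * by auto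
  show "\<And>x y. x \<in> A \<Longrightarrow> y \<in> A \<Longrightarrow> x \<ominus>\<^bsub>H\<^esub> y \<in> A" using * by (simp add: a_minus_def)
qed

context
  fixes H :: "'v ghilb"
  assumes gr: "graded_separable_hilbert H"
begin

lemma gr_hilbert: "hilbert_space H"
  using gr by (rule gsh_hilbert)

lemma gr_even: "submodule (even_part H) cfield H" and gr_odd: "submodule (odd_part H) cfield H"
  using gr by (auto simp: graded_separable_hilbert_def)

lemma gr_in: "a \<in> even_part H \<Longrightarrow> a \<in> carrier H" "b \<in> odd_part H \<Longrightarrow> b \<in> carrier H"
  using submodule_hs(1)[OF gr_hilbert gr_even] submodule_hs(1)[OF gr_hilbert gr_odd] by auto

lemma gr_orth:
  assumes "a \<in> even_part H" "b \<in> odd_part H" shows "hinner H a b = 0" "hinner H b a = 0"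
proof -
  show "hinner H a b = 0" using gr assms by (simp add: graded_separable_hilbert_def)
  then show "hinner H b a = 0" using hinner_commute[OF gr_hilbert, of a b] assms gr_in by simp
qed

lemma gr_decomp: "x \<in> carrier H \<Longrightarrow> \<exists>a\<in>even_part H. \<exists>b\<in>odd_part H. x = a \<oplus>\<^bsub>H\<^esub> b"
  using gr unfolding graded_separable_hilbert_def by blast

text \<open>The difference of the even parts equals a difference of odd parts, so it is orthogonal
  to itself.\<close>

lemma gr_unique:
  assumes "a \<in> even_part H" "b \<in> odd_part H" "a' \<in> even_part H" "b' \<in> odd_part H"
    and eq: "a \<oplus>\<^bsub>H\<^esub> b = a' \<oplus>\<^bsub>H\<^esub> b'"
  shows "a = a'" "b = b'"
proof -
  note H = gr_hilbert
  have c: "a \<in> carrier H" "b \<in> carrier H" "a' \<in> carrier H" "b' \<in> carrier H"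
    using assms gr_in by auto
  have e: "a \<ominus>\<^bsub>H\<^esub> a' \<in> even_part H" and d: "b' \<ominus>\<^bsub>H\<^esub> b \<in> odd_part H"
    using assms submodule_hs(4)[OF H gr_even] submodule_hs(4)[OF H gr_odd] by auto
  have "a \<ominus>\<^bsub>H\<^esub> a' = b' \<ominus>\<^bsub>H\<^esub> b"
  proof (rule hs_eqI[OF H])
    fix z assume z: "z \<in> carrier H"
    have "hinner H (a \<oplus>\<^bsub>H\<^esub> b) z = hinner H (a' \<oplus>\<^bsub>H\<^esub> b') z" by (simp only: eq)
    then have "hinner H a z + hinner H b z = hinner H a' z + hinner H b' z" using H c z by simp
    then show "hinner H (a \<ominus>\<^bsub>H\<^esub> a') z = hinner H (b' \<ominus>\<^bsub>H\<^esub> b) z"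
      using H c z by (simp add: algebra_simps)
  qed (use H c in auto)
  then have z: "hinner H (a \<ominus>\<^bsub>H\<^esub> a') (a \<ominus>\<^bsub>H\<^esub> a') = 0"
    using gr_orth(1)[OF e d] by metis
  have "a \<ominus>\<^bsub>H\<^esub> a' = \<zero>\<^bsub>H\<^esub>"
    using z hinner_self_zero_iff[OF H, of "a \<ominus>\<^bsub>H\<^esub> a'"] H c by (simp del: hinner_minus_left hinner_minus_right)
  then have "hnorm H (a \<ominus>\<^bsub>H\<^esub> a') = 0" "hnorm H (b' \<ominus>\<^bsub>H\<^esub> b) = 0"
    using H \<open>a \<ominus>\<^bsub>H\<^esub> a' = b' \<ominus>\<^bsub>H\<^esub> b\<close> by auto
  moreover have "x = y" if "x \<in> carrier H" "y \<in> carrier H" "hnorm H (x \<ominus>\<^bsub>H\<^esub> y) = 0" for x y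
  proof (rule hs_eqI[OF H that(1,2)])
    fix z assume z: "z \<in> carrier H"
    have "x \<ominus>\<^bsub>H\<^esub> y = \<zero>\<^bsub>H\<^esub>" using that H by simp
    then have "hinner H (x \<ominus>\<^bsub>H\<^esub> y) z = 0" using H z by (simp del: hinner_minus_left)
    then show "hinner H x z = hinner H y z" using H that z by simp
  qed
  ultimately show "a = a'" "b = b'" using c by blast+
qed

lemma grading_op_eq:
  assumes "a \<in> even_part H" "b \<in> odd_part H"
  shows "grading_op H (a \<oplus>\<^bsub>H\<^esub> b) = a \<ominus>\<^bsub>H\<^esub> b"
proof -
  have "(THE y. \<exists>a'\<in>even_part H. \<exists>b'\<in>odd_part H. a \<oplus>\<^bsub>H\<^esub> b = a' \<oplus>\<^bsub>H\<^esub> b' \<and> y = a' \<ominus>\<^bsub>H\<^esub> b') = a \<ominus>\<^bsub>H\<^esub> b"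
  proof (rule the_equality)
    fix y assume "\<exists>a'\<in>even_part H. \<exists>b'\<in>odd_part H. a \<oplus>\<^bsub>H\<^esub> b = a' \<oplus>\<^bsub>H\<^esub> b' \<and> y = a' \<ominus>\<^bsub>H\<^esub> b'"
    then show "y = a \<ominus>\<^bsub>H\<^esub> b" using gr_unique[OF assms] by metis
  qed (use assms in blast)
  then show ?thesis using assms gr_hilbert gr_in by (simp add: grading_op_def)
qed

lemma grading_op_bop: "grading_op H \<in> carrier (bop H H)"
proof (rule bopI[where B = 1])
  note H = gr_hilbert
  show "grading_op H \<in> extensional (carrier H)" by (simp add: grading_op_def)
  fix x assume x: "x \<in> carrier H"
  then obtain a b where ab: "a \<in> even_part H" "b \<in> odd_part H" "x = a \<oplus>\<^bsub>H\<^esub> b"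
    using gr_decomp by blast
  have abH: "a \<in> carrier H" "b \<in> carrier H" using ab gr_in by auto
  show "grading_op H x \<in> carrier H" using grading_op_eq[OF ab(1,2)] ab H abH by simp
  \<comment> \<open>Even and odd parts are orthogonal, so flipping the sign of one leaves the norm
    unchanged: the grading operator is isometric.\<close>
  have "(hnorm H (a \<ominus>\<^bsub>H\<^esub> b))\<^sup>2 = (hnorm H (a \<oplus>\<^bsub>H\<^esub> b))\<^sup>2"
    using H abH gr_orth[OF ab(1,2)] by (simp add: hnorm_minus_sq hnorm_add_sq)
  then have "hnorm H (a \<ominus>\<^bsub>H\<^esub> b) = hnorm H (a \<oplus>\<^bsub>H\<^esub> b)"
    using H abH by (simp add: power2_eq_iff_nonneg)
  then show "hnorm H (grading_op H x) \<le> 1 * hnorm H x"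
    using grading_op_eq[OF ab(1,2)] ab by simp
  show "grading_op H (c \<odot>\<^bsub>H\<^esub> x) = c \<odot>\<^bsub>H\<^esub> grading_op H x" for c
  proof -
    have "c \<odot>\<^bsub>H\<^esub> x = c \<odot>\<^bsub>H\<^esub> a \<oplus>\<^bsub>H\<^esub> c \<odot>\<^bsub>H\<^esub> b"
      using H abH ab(3) by (auto intro!: hs_eqI[OF H] simp: algebra_simps)
    then have "grading_op H (c \<odot>\<^bsub>H\<^esub> x) = c \<odot>\<^bsub>H\<^esub> a \<ominus>\<^bsub>H\<^esub> c \<odot>\<^bsub>H\<^esub> b"
      using grading_op_eq[OF submodule_hs(3)[OF H gr_even ab(1)] submodule_hs(3)[OF H gr_odd ab(2)], of c c]
      by simp
    also have "\<dots> = c \<odot>\<^bsub>H\<^esub> (a \<ominus>\<^bsub>H\<^esub> b)"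
      using H abH by (auto intro!: hs_eqI[OF H] simp: algebra_simps)
    finally show ?thesis using grading_op_eq[OF ab(1,2)] ab by simp
  qed
  fix y assume y: "y \<in> carrier H"
  then obtain a' b' where ab': "a' \<in> even_part H" "b' \<in> odd_part H" "y = a' \<oplus>\<^bsub>H\<^esub> b'"
    using gr_decomp by blast
  have abH': "a' \<in> carrier H" "b' \<in> carrier H" using ab' gr_in by auto
  have "x \<oplus>\<^bsub>H\<^esub> y = (a \<oplus>\<^bsub>H\<^esub> a') \<oplus>\<^bsub>H\<^esub> (b \<oplus>\<^bsub>H\<^esub> b')"
    using H abH abH' ab(3) ab'(3) by (auto intro!: hs_eqI[OF H])
  then have "grading_op H (x \<oplus>\<^bsub>H\<^esub> y) = (a \<oplus>\<^bsub>H\<^esub> a') \<ominus>\<^bsub>H\<^esub> (b \<oplus>\<^bsub>H\<^esub> b')"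
    using grading_op_eq[OF submodule_hs(2)[OF H gr_even ab(1) ab'(1)] submodule_hs(2)[OF H gr_odd ab(2) ab'(2)]]
    by simp
  also have "\<dots> = (a \<ominus>\<^bsub>H\<^esub> b) \<oplus>\<^bsub>H\<^esub> (a' \<ominus>\<^bsub>H\<^esub> b')"
    using H abH abH' by (auto intro!: hs_eqI[OF H])
  finally show "grading_op H (x \<oplus>\<^bsub>H\<^esub> y) = grading_op H x \<oplus>\<^bsub>H\<^esub> grading_op H y"
    using grading_op_eq[OF ab(1,2)] grading_op_eq[OF ab'(1,2)] ab(3) ab'(3) by simp
qed

end

text \<open>Parity is recorded as commutation with the grading up to a sign, which composes and adds
  by calculation and is the form in which it is used for moving operators under the trace.\<close>

definition homogeneous :: "nat \<Rightarrow> 'v ghilb \<Rightarrow> 'v ghilb \<Rightarrow> ('v \<Rightarrow> 'v) \<Rightarrow> bool" where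
  "homogeneous k H K T \<longleftrightarrow>
     (\<forall>x\<in>carrier H. T (grading_op H x) = (- 1) ^ k \<odot>\<^bsub>K\<^esub> grading_op K (T x))"

lemma hs_smult_one [simp]: "hilbert_space H \<Longrightarrow> x \<in> carrier H \<Longrightarrow> 1 \<odot>\<^bsub>H\<^esub> x = x"
  using module.smult_one[OF hs_module, of H x] by simp

lemma degree0_homogeneous:
  assumes H: "graded_separable_hilbert H" and K: "graded_separable_hilbert K"
    and T: "T \<in> carrier (bop H K)" and d: "degree0_op H K T"
  shows "homogeneous 0 H K T"
  unfolding homogeneous_def
proof
  note hs = gsh_hilbert[OF H] gsh_hilbert[OF K]
  fix x assume x: "x \<in> carrier H"
  obtain a b where ab: "a \<in> even_part H" "b \<in> odd_part H" "x = a \<oplus>\<^bsub>H\<^esub> b"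
    using gr_decomp[OF H x] by blast
  have abH: "a \<in> carrier H" "b \<in> carrier H" using ab gr_in[OF H] by auto
  have t: "T a \<in> even_part K" "T b \<in> odd_part K" using d ab by (auto simp: degree0_op_def)
  show "T (grading_op H x) = (- 1) ^ 0 \<odot>\<^bsub>K\<^esub> grading_op K (T x)"
    using grading_op_eq[OF H ab(1,2)] grading_op_eq[OF K t] T abH hs ab(3) by simp
qed

lemma degree1_homogeneous:
  assumes H: "graded_separable_hilbert H" and K: "graded_separable_hilbert K"
    and T: "T \<in> carrier (bop H K)" and d: "degree1_op H K T"
  shows "homogeneous 1 H K T"
  unfolding homogeneous_def
proof
  note hs = gsh_hilbert[OF H] gsh_hilbert[OF K]
  fix x assume x: "x \<in> carrier H"
  obtain a b where ab: "a \<in> even_part H" "b \<in> odd_part H" "x = a \<oplus>\<^bsub>H\<^esub> b"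
    using gr_decomp[OF H x] by blast
  have abH: "a \<in> carrier H" "b \<in> carrier H" using ab gr_in[OF H] by auto
  have t: "T a \<in> odd_part K" "T b \<in> even_part K" using d ab by (auto simp: degree1_op_def)
  have "T x = T b \<oplus>\<^bsub>K\<^esub> T a" using T abH hs ab(3) by (auto intro!: hs_eqI[of K])
  then have "grading_op K (T x) = T b \<ominus>\<^bsub>K\<^esub> T a" using grading_op_eq[OF K t(2,1)] by simp
  moreover have "T (grading_op H x) = T a \<ominus>\<^bsub>K\<^esub> T b"
    using grading_op_eq[OF H ab(1,2)] T abH hs ab(3) by simp
  ultimately show "T (grading_op H x) = (- 1) ^ 1 \<odot>\<^bsub>K\<^esub> grading_op K (T x)"
    using T abH hs by (auto intro!: hs_eqI[of K])
qed

lemma homogeneous_compose: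
  assumes "graded_separable_hilbert H" "graded_separable_hilbert K" "graded_separable_hilbert L"
    and S: "S \<in> carrier (bop H K)" and T: "T \<in> carrier (bop K L)"
    and hS: "homogeneous i H K S" and hT: "homogeneous j K L T"
  shows "homogeneous (i + j) H L (compose (carrier H) T S)"
  unfolding homogeneous_def
proof
  note hs = gsh_hilbert[OF assms(1)] gsh_hilbert[OF assms(2)] gsh_hilbert[OF assms(3)]
  note gr = assms(1-3)[THEN grading_op_bop]
  fix x assume x: "x \<in> carrier H"
  have gx: "grading_op H x \<in> carrier H" using gr(1) x by simp
  have "T (S (grading_op H x)) = T ((- 1) ^ i \<odot>\<^bsub>K\<^esub> grading_op K (S x))"
    using hS x by (simp add: homogeneous_def)
  also have "\<dots> = (- 1) ^ i \<odot>\<^bsub>L\<^esub> ((- 1) ^ j \<odot>\<^bsub>L\<^esub> grading_op L (T (S x)))"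
    using hT S T x gr by (simp add: homogeneous_def)
  also have "\<dots> = (- 1) ^ (i + j) \<odot>\<^bsub>L\<^esub> grading_op L (T (S x))"
    using S T x gr hs by (auto intro!: hs_eqI[of L] simp: power_add)
  finally show "compose (carrier H) T S (grading_op H x) =
      (- 1) ^ (i + j) \<odot>\<^bsub>L\<^esub> grading_op L (compose (carrier H) T S x)"
    using gx x by (simp add: compose_eq)
qed

lemma homogeneous_add:
  assumes "graded_separable_hilbert H" "graded_separable_hilbert K"
    and S: "S \<in> carrier (bop H K)" and T: "T \<in> carrier (bop H K)"
    and hS: "homogeneous i H K S" and hT: "homogeneous i H K T"
  shows "homogeneous i H K (S \<oplus>\<^bsub>bop H K\<^esub> T)"
  unfolding homogeneous_def
proof
  note hs = gsh_hilbert[OF assms(1)] gsh_hilbert[OF assms(2)]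
  note gr = assms(1-2)[THEN grading_op_bop]
  fix x assume x: "x \<in> carrier H"
  have gx: "grading_op H x \<in> carrier H" using gr(1) x by simp
  show "(S \<oplus>\<^bsub>bop H K\<^esub> T) (grading_op H x) = (- 1) ^ i \<odot>\<^bsub>K\<^esub> grading_op K ((S \<oplus>\<^bsub>bop H K\<^esub> T) x)"
    using hS hT S T x gx gr hs by (auto intro!: hs_eqI[of K] simp: homogeneous_def algebra_simps)
qed

lemma homogeneous_smult:
  assumes "graded_separable_hilbert H" "graded_separable_hilbert K"
    and T: "T \<in> carrier (bop H K)" and hT: "homogeneous i H K T"
  shows "homogeneous i H K (c \<odot>\<^bsub>bop H K\<^esub> T)"
  unfolding homogeneous_def
proof
  note hs = gsh_hilbert[OF assms(1)] gsh_hilbert[OF assms(2)]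
  note gr = assms(1-2)[THEN grading_op_bop]
  fix x assume x: "x \<in> carrier H"
  have gx: "grading_op H x \<in> carrier H" using gr(1) x by simp
  show "(c \<odot>\<^bsub>bop H K\<^esub> T) (grading_op H x) = (- 1) ^ i \<odot>\<^bsub>K\<^esub> grading_op K ((c \<odot>\<^bsub>bop H K\<^esub> T) x)"
    using hT T x gx gr hs by (auto intro!: hs_eqI[of K] simp: homogeneous_def algebra_simps)
qed

lemma homogeneous_zero:
  assumes "graded_separable_hilbert H" "graded_separable_hilbert K"
  shows "homogeneous i H K \<zero>\<^bsub>bop H K\<^esub>"
  unfolding homogeneous_def
proof
  note hs = gsh_hilbert[OF assms(1)] gsh_hilbert[OF assms(2)]
  note gr = assms(1-2)[THEN grading_op_bop]
  fix x assume x: "x \<in> carrier H"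
  have gx: "grading_op H x \<in> carrier H" using gr(1) x by simp
  show "\<zero>\<^bsub>bop H K\<^esub> (grading_op H x) = (- 1) ^ i \<odot>\<^bsub>K\<^esub> grading_op K (\<zero>\<^bsub>bop H K\<^esub> x)"
    using x gx gr hs by (auto intro!: hs_eqI[of K])
qed

lemma homogeneous_id:
  assumes "graded_separable_hilbert H"
  shows "homogeneous 0 H H (id_op H)"
  unfolding homogeneous_def
  using grading_op_bop[OF assms] gsh_hilbert[OF assms] by simp

section \<open>Linear spans and induction over them\<close>

section \<open>Linear spans\<close>

lemma lin_span_submodule:
  assumes V: "module cfield V" and S: "S \<subseteq> carrier V"
  shows "submodule (lin_span V S) cfield V"
proof -
  interpret module cfield V by (rule V)
  have mem: "x \<in> lin_span V S \<longleftrightarrow> (\<forall>N. submodule N cfield V \<and> S \<subseteq> N \<longrightarrow> x \<in> N)" for x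
    by (auto simp: lin_span_def hull_def)
  show ?thesis
  proof (rule submoduleI)
    show "lin_span V S \<subseteq> carrier V" using mem carrier_is_submodule S by blast
    show "\<zero>\<^bsub>V\<^esub> \<in> lin_span V S"
      unfolding mem by (auto dest!: submodule.axioms(1) subgroup.one_closed)
  qed (unfold mem, (blast dest: submoduleE)+)
qed

text \<open>The predicate is intersected with the span, so that the closure steps may also use
  membership in the span.\<close>

lemma lin_span_induct [consumes 1, case_names module carrier gen zero add smult]:
  assumes T: "T \<in> lin_span V S" and V: "module cfield V" and S: "S \<subseteq> carrier V"
    and gen: "\<And>T. T \<in> S \<Longrightarrow> P T" and zero: "P \<zero>\<^bsub>V\<^esub>"
    and add: "\<And>T T'. T \<in> lin_span V S \<Longrightarrow> T' \<in> lin_span V S \<Longrightarrow> P T \<Longrightarrow> P T' \<Longrightarrow> P (T \<oplus>\<^bsub>V\<^esub> T')"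
    and smult: "\<And>c T. T \<in> lin_span V S \<Longrightarrow> P T \<Longrightarrow> P (c \<odot>\<^bsub>V\<^esub> T)"
  shows "P T"
proof -
  interpret module cfield V by (rule V)
  note sub = lin_span_submodule[OF V S]
  note E = submoduleE[OF sub]
  have "submodule {T \<in> lin_span V S. P T} cfield V"
  proof (rule submoduleI)
    have "\<zero>\<^bsub>V\<^esub> \<in> lin_span V S" using subgroup.one_closed[OF submodule.axioms(1)[OF sub]] by simp
    then show "\<zero>\<^bsub>V\<^esub> \<in> {T \<in> lin_span V S. P T}" using zero by blast
    fix a assume a: "a \<in> {T \<in> lin_span V S. P T}"
    then have "a \<in> carrier V" using E(1) by blast
    then have "\<ominus>\<^bsub>V\<^esub> a = (- 1) \<odot>\<^bsub>V\<^esub> a"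
      using smult_l_minus[of 1 a] smult_one[of a] by simp
    then show "\<ominus>\<^bsub>V\<^esub> a \<in> {T \<in> lin_span V S. P T}" using a E(3,4) smult by auto
  qed (use E add smult in auto)
  moreover have "S \<subseteq> {T \<in> lin_span V S. P T}"
    using gen hull_subset unfolding lin_span_def by fastforce
  ultimately have "lin_span V S \<subseteq> {T \<in> lin_span V S. P T}"
    by (subst (1) lin_span_def) (rule hull_minimal)
  then show ?thesis using T by blast
qed

section \<open>Operator calculus of a fixed Fredholm module\<close>

section \<open>Fredholm modules\<close>

locale fredholm_setting =
  fixes C :: "('o, 'm) semicat" and M :: "('o, 'm, 'v) fredholm" and p :: real
  assumes cat: "linear_category C" and p1: "p \<ge> 1" and fmod: "even_fredholm_module p C M"
begin

abbreviation comp :: "'o \<Rightarrow> ('v \<Rightarrow> 'v) \<Rightarrow> ('v \<Rightarrow> 'v) \<Rightarrow> ('v \<Rightarrow> 'v)" where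
  "comp X \<equiv> compose (carrier (fob M X))"

abbreviation B :: "'o \<Rightarrow> 'o \<Rightarrow> (complex, 'v \<Rightarrow> 'v) module" where
  "B X Y \<equiv> bop (fob M X) (fob M Y)"

lemma gsh: "X \<in> Ob C \<Longrightarrow> graded_separable_hilbert (fob M X)"
  using fmod by (auto simp: even_fredholm_module_def linear_functor_def linear_semifunctor_def SHilb_def Pi_iff)

lemma hs [simp]: "X \<in> Ob C \<Longrightarrow> hilbert_space (fob M X)"
  using gsh by (rule gsh_hilbert)

lemma fmor_linear: "X \<in> Ob C \<Longrightarrow> Y \<in> Ob C \<Longrightarrow> linear_map (Hom C X Y) (B X Y) (fmor M X Y)"
  using fmod by (auto simp: even_fredholm_module_def linear_functor_def linear_semifunctor_def SHilb_def)

lemma fmor_closed [simp]: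
  "X \<in> Ob C \<Longrightarrow> Y \<in> Ob C \<Longrightarrow> f \<in> carrier (Hom C X Y) \<Longrightarrow> fmor M X Y f \<in> carrier (B X Y)"
  using fmor_linear[of X Y] unfolding linear_map_def by blast

lemma fmor_comp:
  "X \<in> Ob C \<Longrightarrow> Y \<in> Ob C \<Longrightarrow> Z \<in> Ob C \<Longrightarrow> f \<in> carrier (Hom C X Y) \<Longrightarrow> g \<in> carrier (Hom C Y Z) \<Longrightarrow>
    fmor M X Z (Comp C X Y Z g f) = comp X (fmor M Y Z g) (fmor M X Y f)"
  using fmod by (simp add: even_fredholm_module_def linear_functor_def linear_semifunctor_def SHilb_def)

lemma fmor_homogeneous:
  assumes "X \<in> Ob C" "Y \<in> Ob C" "f \<in> carrier (Hom C X Y)"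
  shows "homogeneous 0 (fob M X) (fob M Y) (fmor M X Y f)"
  using assms fmod by (intro degree0_homogeneous gsh) (auto simp: even_fredholm_module_def)

lemma fop_closed [simp]: "X \<in> Ob C \<Longrightarrow> fop M X \<in> carrier (B X X)"
  using fmod by (simp add: even_fredholm_module_def)

lemma fop_homogeneous: "X \<in> Ob C \<Longrightarrow> homogeneous 1 (fob M X) (fob M X) (fop M X)"
  using fmod by (intro degree1_homogeneous gsh) (auto simp: even_fredholm_module_def)

lemma fop_fop [simp]: 
  assumes "X \<in> Ob C" "x \<in> carrier (fob M X)" shows "fop M X (fop M X x) = x"
proof -
  have "comp X (fop M X) (fop M X) = id_op (fob M X)"
    using fmod assms by (simp add: even_fredholm_module_def)
  then have "comp X (fop M X) (fop M X) x = id_op (fob M X) x" by simp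
  then show ?thesis using assms by (simp add: compose_eq)
qed

lemma fop_apply [simp]:
  assumes "X \<in> Ob C" "x \<in> carrier (fob M X)"
  shows "fop M X x \<in> carrier (fob M X)" "fop M X (c \<odot>\<^bsub>fob M X\<^esub> x) = c \<odot>\<^bsub>fob M X\<^esub> fop M X x"
    "y \<in> carrier (fob M X) \<Longrightarrow> fop M X (x \<oplus>\<^bsub>fob M X\<^esub> y) = fop M X x \<oplus>\<^bsub>fob M X\<^esub> fop M X y"
    "y \<in> carrier (fob M X) \<Longrightarrow> fop M X (x \<ominus>\<^bsub>fob M X\<^esub> y) = fop M X x \<ominus>\<^bsub>fob M X\<^esub> fop M X y"
  using assms bop_closed[OF fop_closed] bop_smult[OF fop_closed] bop_add[OF fop_closed]
    bop_minus[OF fop_closed hs hs] by auto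

lemma fop_zero [simp]: "X \<in> Ob C \<Longrightarrow> fop M X \<zero>\<^bsub>fob M X\<^esub> = \<zero>\<^bsub>fob M X\<^esub>"
  by (rule bop_zero) auto

lemma op_compose_closed [simp]:
  assumes "X \<in> Ob C" "Y \<in> Ob C" "Z \<in> Ob C" "S \<in> carrier (B X Y)" "T \<in> carrier (B Y Z)"
  shows "comp X T S \<in> carrier (B X Z)"
  using assms by (intro bop_compose[of _ "fob M Y"]) auto

lemma comp_zero_right: "X \<in> Ob C \<Longrightarrow> Y \<in> Ob C \<Longrightarrow> Z \<in> Ob C \<Longrightarrow> S \<in> carrier (B Y Z) \<Longrightarrow>
    comp X S \<zero>\<^bsub>B X Y\<^esub> = \<zero>\<^bsub>B X Z\<^esub>"
  by (intro bop_eqI[of _ "fob M X" "fob M Z"]) (auto simp: compose_eq op_compose_closed[of X Y Z])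

lemma comp_add_right: "X \<in> Ob C \<Longrightarrow> Y \<in> Ob C \<Longrightarrow> Z \<in> Ob C \<Longrightarrow> S \<in> carrier (B Y Z) \<Longrightarrow>
    T \<in> carrier (B X Y) \<Longrightarrow> T' \<in> carrier (B X Y) \<Longrightarrow>
    comp X S (T \<oplus>\<^bsub>B X Y\<^esub> T') = comp X S T \<oplus>\<^bsub>B X Z\<^esub> comp X S T'"
  by (intro bop_eqI[of _ "fob M X" "fob M Z"]) (auto simp: compose_eq op_compose_closed[of X Y Z])

lemma comp_smult_right: "X \<in> Ob C \<Longrightarrow> Y \<in> Ob C \<Longrightarrow> Z \<in> Ob C \<Longrightarrow> S \<in> carrier (B Y Z) \<Longrightarrow>
    T \<in> carrier (B X Y) \<Longrightarrow> comp X S (c \<odot>\<^bsub>B X Y\<^esub> T) = c \<odot>\<^bsub>B X Z\<^esub> comp X S T"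
  by (intro bop_eqI[of _ "fob M X" "fob M Z"]) (auto simp: compose_eq op_compose_closed[of X Y Z])

lemma comp_zero_left: "X \<in> Ob C \<Longrightarrow> Y \<in> Ob C \<Longrightarrow> Z \<in> Ob C \<Longrightarrow> T \<in> carrier (B X Y) \<Longrightarrow>
    comp X \<zero>\<^bsub>B Y Z\<^esub> T = \<zero>\<^bsub>B X Z\<^esub>"
  by (intro bop_eqI[of _ "fob M X" "fob M Z"]) (auto simp: compose_eq op_compose_closed[of X Y Z])

lemma comp_add_left: "X \<in> Ob C \<Longrightarrow> Y \<in> Ob C \<Longrightarrow> Z \<in> Ob C \<Longrightarrow> S \<in> carrier (B Y Z) \<Longrightarrow>
    S' \<in> carrier (B Y Z) \<Longrightarrow> T \<in> carrier (B X Y) \<Longrightarrow>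
    comp X (S \<oplus>\<^bsub>B Y Z\<^esub> S') T = comp X S T \<oplus>\<^bsub>B X Z\<^esub> comp X S' T"
  by (intro bop_eqI[of _ "fob M X" "fob M Z"]) (auto simp: compose_eq op_compose_closed[of X Y Z])

lemma comp_smult_left: "X \<in> Ob C \<Longrightarrow> Y \<in> Ob C \<Longrightarrow> Z \<in> Ob C \<Longrightarrow> S \<in> carrier (B Y Z) \<Longrightarrow>
    T \<in> carrier (B X Y) \<Longrightarrow> comp X (c \<odot>\<^bsub>B Y Z\<^esub> S) T = c \<odot>\<^bsub>B X Z\<^esub> comp X S T"
  by (intro bop_eqI[of _ "fob M X" "fob M Z"]) (auto simp: compose_eq op_compose_closed[of X Y Z])

lemma comp_assoc: "W \<in> Ob C \<Longrightarrow> X \<in> Ob C \<Longrightarrow> Y \<in> Ob C \<Longrightarrow> Z \<in> Ob C \<Longrightarrow> R \<in> carrier (B W X) \<Longrightarrow>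
    S \<in> carrier (B X Y) \<Longrightarrow> T \<in> carrier (B Y Z) \<Longrightarrow> comp W T (comp W S R) = comp W (comp X T S) R"
  by (rule op_compose_assoc[where K = "fob M Y" and L = "fob M Z"]) auto

lemma comp_id_right: "X \<in> Ob C \<Longrightarrow> Y \<in> Ob C \<Longrightarrow> T \<in> carrier (B X Y) \<Longrightarrow> comp X T (id_op (fob M X)) = T"
  by (rule op_compose_id(2)[of _ "fob M Y"]) auto

lemma comp_id_left: "X \<in> Ob C \<Longrightarrow> Y \<in> Ob C \<Longrightarrow> T \<in> carrier (B X Y) \<Longrightarrow> comp X (id_op (fob M Y)) T = T"
  by (rule op_compose_id(1)) auto

section \<open>The graded commutator as a differential\<close>

subsection \<open>The graded commutator\<close>

lemma gcomm_closed [simp]: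
  assumes "X \<in> Ob C" "Y \<in> Ob C" "T \<in> carrier (B X Y)"
  shows "gcomm M k X Y T \<in> carrier (B X Y)"
  unfolding gcomm_def Let_def using assms
    op_compose_closed[of X Y Y T "fop M Y"] op_compose_closed[of X X Y "fop M X" T] by simp

lemma gcomm_apply:
  assumes "X \<in> Ob C" "Y \<in> Ob C" "T \<in> carrier (B X Y)" "x \<in> carrier (fob M X)"
  shows "gcomm M k X Y T x = fop M Y (T x) \<ominus>\<^bsub>fob M Y\<^esub> (- 1) ^ k \<odot>\<^bsub>fob M Y\<^esub> T (fop M X x)"
  unfolding gcomm_def Let_def using assms
    op_compose_closed[of X Y Y T "fop M Y"] op_compose_closed[of X X Y "fop M X" T] by (simp add: compose_eq)

text \<open>The graded Leibniz rule: the terms with \<open>F\<close> between \<open>S\<close> and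
  \<open>T\<close> occur twice, with opposite signs, and the degrees enter through signs
  alone.\<close>

lemma gcomm_compose:
  assumes ob: "X \<in> Ob C" "Y \<in> Ob C" "Z \<in> Ob C" and S: "S \<in> carrier (B Y Z)" and T: "T \<in> carrier (B X Y)"
  shows "gcomm M (i + j) X Z (comp X S T) =
    comp X (gcomm M i Y Z S) T \<oplus>\<^bsub>B X Z\<^esub> (- 1) ^ i \<odot>\<^bsub>B X Z\<^esub> comp X S (gcomm M j X Y T)"
proof (rule bop_eqI[of _ "fob M X" "fob M Z"])
  have c: "comp X S T \<in> carrier (B X Z)" "comp X (gcomm M i Y Z S) T \<in> carrier (B X Z)"
    "comp X S (gcomm M j X Y T) \<in> carrier (B X Z)"
    by (rule op_compose_closed[of X Y Z]; use assms in simp)+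
  then show "gcomm M (i + j) X Z (comp X S T) \<in> carrier (B X Z)"
    "comp X (gcomm M i Y Z S) T \<oplus>\<^bsub>B X Z\<^esub> (- 1) ^ i \<odot>\<^bsub>B X Z\<^esub> comp X S (gcomm M j X Y T) \<in> carrier (B X Z)"
    using ob by auto
  fix x assume x: "x \<in> carrier (fob M X)"
  show "gcomm M (i + j) X Z (comp X S T) x =
    (comp X (gcomm M i Y Z S) T \<oplus>\<^bsub>B X Z\<^esub> (- 1) ^ i \<odot>\<^bsub>B X Z\<^esub> comp X S (gcomm M j X Y T)) x"
    using ob S T x c
    by (auto intro!: hs_eqI[of "fob M Z"] simp: gcomm_apply compose_eq power_add algebra_simps)
qed

text \<open>Since \<open>F\<close> squares to the identity, the outer terms are \<open>T\<close> and
  minus \<open>T\<close>; the two terms \<open>F T F\<close> cancel because the signs for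
  \<open>k\<close> and \<open>k + 1\<close> are opposite.\<close>

lemma gcomm_gcomm:
  assumes ob: "X \<in> Ob C" "Y \<in> Ob C" and T: "T \<in> carrier (B X Y)"
  shows "gcomm M (Suc k) X Y (gcomm M k X Y T) = \<zero>\<^bsub>B X Y\<^esub>"
proof (rule bop_eqI[of _ "fob M X" "fob M Y"])
  fix x assume x: "x \<in> carrier (fob M X)"
  have s: "(- 1) ^ k * ((- 1) ^ k * c) = (c :: complex)" for c
    by (cases "even k") auto
  show "gcomm M (Suc k) X Y (gcomm M k X Y T) x = \<zero>\<^bsub>B X Y\<^esub> x"
    using ob T x by (auto intro!: hs_eqI[of "fob M Y"] simp: gcomm_apply algebra_simps s)
qed (use ob T in auto)

lemma gcomm_add:
  assumes ob: "X \<in> Ob C" "Y \<in> Ob C" and S: "S \<in> carrier (B X Y)" and T: "T \<in> carrier (B X Y)"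
  shows "gcomm M k X Y (S \<oplus>\<^bsub>B X Y\<^esub> T) = gcomm M k X Y S \<oplus>\<^bsub>B X Y\<^esub> gcomm M k X Y T"
proof (rule bop_eqI[of _ "fob M X" "fob M Y"])
  fix x assume x: "x \<in> carrier (fob M X)"
  show "gcomm M k X Y (S \<oplus>\<^bsub>B X Y\<^esub> T) x = (gcomm M k X Y S \<oplus>\<^bsub>B X Y\<^esub> gcomm M k X Y T) x"
    using ob S T x by (auto intro!: hs_eqI[of "fob M Y"] simp: gcomm_apply algebra_simps)
qed (use ob S T in auto)

lemma gcomm_smult:
  assumes ob: "X \<in> Ob C" "Y \<in> Ob C" and T: "T \<in> carrier (B X Y)"
  shows "gcomm M k X Y (c \<odot>\<^bsub>B X Y\<^esub> T) = c \<odot>\<^bsub>B X Y\<^esub> gcomm M k X Y T"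
proof (rule bop_eqI[of _ "fob M X" "fob M Y"])
  fix x assume x: "x \<in> carrier (fob M X)"
  show "gcomm M k X Y (c \<odot>\<^bsub>B X Y\<^esub> T) x = (c \<odot>\<^bsub>B X Y\<^esub> gcomm M k X Y T) x"
    using ob T x by (auto intro!: hs_eqI[of "fob M Y"] simp: gcomm_apply algebra_simps)
qed (use ob T in auto)

lemma gcomm_zero:
  assumes ob: "X \<in> Ob C" "Y \<in> Ob C"
  shows "gcomm M k X Y \<zero>\<^bsub>B X Y\<^esub> = \<zero>\<^bsub>B X Y\<^esub>"
proof (rule bop_eqI[of _ "fob M X" "fob M Y"])
  fix x assume x: "x \<in> carrier (fob M X)"
  show "gcomm M k X Y \<zero>\<^bsub>B X Y\<^esub> x = \<zero>\<^bsub>B X Y\<^esub> x"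
    using ob x by (auto intro!: hs_eqI[of "fob M Y"] simp: gcomm_apply)
qed (use ob in auto)

lemma gcomm_id:
  assumes ob: "X \<in> Ob C"
  shows "gcomm M 0 X X (id_op (fob M X)) = \<zero>\<^bsub>B X X\<^esub>"
proof (rule bop_eqI[of _ "fob M X" "fob M X"])
  fix x assume x: "x \<in> carrier (fob M X)"
  show "gcomm M 0 X X (id_op (fob M X)) x = \<zero>\<^bsub>B X X\<^esub> x"
    using ob x by (auto intro!: hs_eqI[of "fob M X"] simp: gcomm_apply)
qed (use ob in auto)

lemma mcomm_closed [simp]:
  "X \<in> Ob C \<Longrightarrow> Y \<in> Ob C \<Longrightarrow> f \<in> carrier (Hom C X Y) \<Longrightarrow> mcomm M X Y f \<in> carrier (B X Y)"
  by (simp add: mcomm_def)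

lemma gcomm_mcomm:
  "X \<in> Ob C \<Longrightarrow> Y \<in> Ob C \<Longrightarrow> f \<in> carrier (Hom C X Y) \<Longrightarrow> gcomm M 1 X Y (mcomm M X Y f) = \<zero>\<^bsub>B X Y\<^esub>"
  using gcomm_gcomm[of X Y "fmor M X Y f" 0] by (simp add: mcomm_def)

lemma mcomm_comp:
  assumes "X \<in> Ob C" "Y \<in> Ob C" "Z \<in> Ob C" "f \<in> carrier (Hom C X Y)" "g \<in> carrier (Hom C Y Z)"
  shows "mcomm M X Z (Comp C X Y Z g f) =
    comp X (mcomm M Y Z g) (fmor M X Y f) \<oplus>\<^bsub>B X Z\<^esub> comp X (fmor M Y Z g) (mcomm M X Y f)"
proof -
  have "comp X (fmor M Y Z g) (mcomm M X Y f) \<in> carrier (B X Z)"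
    by (rule op_compose_closed[of X Y Z]) (use assms in auto)
  then have "1 \<odot>\<^bsub>B X Z\<^esub> comp X (fmor M Y Z g) (mcomm M X Y f) = comp X (fmor M Y Z g) (mcomm M X Y f)"
    using module.smult_one[OF bop_module] assms by (metis cfield_simps(3) hs)
  then show ?thesis
    using gcomm_compose[of X Y Z "fmor M Y Z g" "fmor M X Y f" 0 0] assms
    by (simp add: mcomm_def fmor_comp)
qed

text \<open>The summability hypothesis on the module enters the estimates here.\<close>

lemma mcomm_decay:
  assumes "X \<in> Ob C" "Y \<in> Ob C" "f \<in> carrier (Hom C X Y)"
  shows "mcomm M X Y f \<in> decay (1 / p) (fob M X) (fob M Y)"
  using assms fmod p1 by (intro schatten_decay) (auto simp: even_fredholm_module_def)

lemma mcomm_homogeneous: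
  assumes "X \<in> Ob C" "Y \<in> Ob C" "f \<in> carrier (Hom C X Y)"
  shows "homogeneous 1 (fob M X) (fob M Y) (mcomm M X Y f)"
  unfolding mcomm_def gcomm_def Let_def
proof -
  let ?T = "fmor M X Y f"
  have c: "comp X (fop M Y) ?T \<in> carrier (B X Y)" "comp X ?T (fop M X) \<in> carrier (B X Y)"
    using assms op_compose_closed[of X Y Y ?T "fop M Y"] op_compose_closed[of X X Y "fop M X" ?T] by auto
  have h: "homogeneous 1 (fob M X) (fob M Y) (comp X (fop M Y) ?T)"
    "homogeneous 1 (fob M X) (fob M Y) (comp X ?T (fop M X))"
    using homogeneous_compose[OF gsh gsh gsh fmor_closed fop_closed fmor_homogeneous fop_homogeneous, of X Y f]
      homogeneous_compose[OF gsh gsh gsh fop_closed fmor_closed fop_homogeneous fmor_homogeneous, of X Y f] assms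
    by auto
  have e: "S \<ominus>\<^bsub>B X Y\<^esub> (- 1) ^ 0 \<odot>\<^bsub>B X Y\<^esub> S' = S \<oplus>\<^bsub>B X Y\<^esub> (- 1) \<odot>\<^bsub>B X Y\<^esub> S'"
    if "S \<in> carrier (B X Y)" "S' \<in> carrier (B X Y)" for S S'
    using that assms by (intro bop_eqI[of _ "fob M X" "fob M Y"]) (auto intro!: hs_eqI[of "fob M Y"])
  show "homogeneous 1 (fob M X) (fob M Y)
    (comp X (fop M Y) ?T \<ominus>\<^bsub>B X Y\<^esub> (- 1) ^ 0 \<odot>\<^bsub>B X Y\<^esub> comp X ?T (fop M X))"
    unfolding e[OF c] by (intro homogeneous_add homogeneous_smult gsh h c bop_smult_closed hs assms)
qed

section \<open>Spaces of forms: a recursive description and closure properties\<close>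

section \<open>The spaces of forms\<close>

lemma hom_module: "X \<in> Ob C \<Longrightarrow> Y \<in> Ob C \<Longrightarrow> module cfield (Hom C X Y)"
  using cat by (simp add: linear_category_def linear_semicategory_def)

lemma hom_closed [simp]:
  assumes "X \<in> Ob C" "Y \<in> Ob C"
  shows "\<zero>\<^bsub>Hom C X Y\<^esub> \<in> carrier (Hom C X Y)"
    "f \<in> carrier (Hom C X Y) \<Longrightarrow> c \<odot>\<^bsub>Hom C X Y\<^esub> f \<in> carrier (Hom C X Y)"
    "f \<in> carrier (Hom C X Y) \<Longrightarrow> g \<in> carrier (Hom C X Y) \<Longrightarrow> f \<oplus>\<^bsub>Hom C X Y\<^esub> g \<in> carrier (Hom C X Y)"
proof -
  interpret module cfield "Hom C X Y" by (rule hom_module) fact+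
  show "\<zero>\<^bsub>Hom C X Y\<^esub> \<in> carrier (Hom C X Y)"
    "f \<in> carrier (Hom C X Y) \<Longrightarrow> c \<odot>\<^bsub>Hom C X Y\<^esub> f \<in> carrier (Hom C X Y)"
    "f \<in> carrier (Hom C X Y) \<Longrightarrow> g \<in> carrier (Hom C X Y) \<Longrightarrow> f \<oplus>\<^bsub>Hom C X Y\<^esub> g \<in> carrier (Hom C X Y)"
    by auto
qed

lemma Comp_closed [simp]:
  assumes "X \<in> Ob C" "Y \<in> Ob C" "Z \<in> Ob C" "f \<in> carrier (Hom C X Y)" "g \<in> carrier (Hom C Y Z)"
  shows "Comp C X Y Z g f \<in> carrier (Hom C X Z)"
proof -
  have "linear_map (Hom C X Y) (Hom C X Z) (\<lambda>f. Comp C X Y Z g f)"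
    using cat assms unfolding linear_category_def linear_semicategory_def by blast
  then show ?thesis using assms unfolding linear_map_def by blast
qed

lemma fmor_add:
  "X \<in> Ob C \<Longrightarrow> Y \<in> Ob C \<Longrightarrow> f \<in> carrier (Hom C X Y) \<Longrightarrow> g \<in> carrier (Hom C X Y) \<Longrightarrow>
    fmor M X Y (f \<oplus>\<^bsub>Hom C X Y\<^esub> g) = fmor M X Y f \<oplus>\<^bsub>B X Y\<^esub> fmor M X Y g"
  using fmor_linear[of X Y] unfolding linear_map_def by blast

lemma fmor_smult:
  "X \<in> Ob C \<Longrightarrow> Y \<in> Ob C \<Longrightarrow> f \<in> carrier (Hom C X Y) \<Longrightarrow>
    fmor M X Y (c \<odot>\<^bsub>Hom C X Y\<^esub> f) = c \<odot>\<^bsub>B X Y\<^esub> fmor M X Y f"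
  using fmor_linear[of X Y] unfolding linear_map_def by blast

lemma B_smult_zero: "X \<in> Ob C \<Longrightarrow> Y \<in> Ob C \<Longrightarrow> T \<in> carrier (B X Y) \<Longrightarrow> 0 \<odot>\<^bsub>B X Y\<^esub> T = \<zero>\<^bsub>B X Y\<^esub>"
  by (rule bop_eqI[of _ "fob M X" "fob M Y"]) (auto simp: hs_smult_zero)

lemma B_smult_zero_right: "X \<in> Ob C \<Longrightarrow> Y \<in> Ob C \<Longrightarrow> c \<odot>\<^bsub>B X Y\<^esub> \<zero>\<^bsub>B X Y\<^esub> = \<zero>\<^bsub>B X Y\<^esub>"
  by (auto intro!: bop_eqI[of _ "fob M X" "fob M Y"] hs_eqI[of "fob M Y"])

lemma B_simps:
  assumes "X \<in> Ob C" "Y \<in> Ob C" "T \<in> carrier (B X Y)"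
  shows "1 \<odot>\<^bsub>B X Y\<^esub> T = T" "T \<oplus>\<^bsub>B X Y\<^esub> \<zero>\<^bsub>B X Y\<^esub> = T" "\<zero>\<^bsub>B X Y\<^esub> \<oplus>\<^bsub>B X Y\<^esub> T = T"
  using assms by (auto intro!: bop_eqI[of _ "fob M X" "fob M Y"] hs_eqI[of "fob M Y"])

lemma fmor_zero:
  assumes "X \<in> Ob C" "Y \<in> Ob C" shows "fmor M X Y \<zero>\<^bsub>Hom C X Y\<^esub> = \<zero>\<^bsub>B X Y\<^esub>"
proof -
  have "\<zero>\<^bsub>Hom C X Y\<^esub> = 0 \<odot>\<^bsub>Hom C X Y\<^esub> \<zero>\<^bsub>Hom C X Y\<^esub>"
    using module.smult_l_null[OF hom_module[OF assms]] assms by simp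
  then show ?thesis using fmor_smult[of X Y "\<zero>\<^bsub>Hom C X Y\<^esub>" 0] assms B_smult_zero by simp
qed

lemma unital_mor_eq: "X \<noteq> Y \<Longrightarrow> unital_mor M X Y f \<mu> = fmor M X Y f"
  "unital_mor M X X f \<mu> = fmor M X X f \<oplus>\<^bsub>B X X\<^esub> \<mu> \<odot>\<^bsub>B X X\<^esub> id_op (fob M X)"
  by (auto simp: unital_mor_def Let_def)

lemma unital_mor_closed [simp]:
  "X \<in> Ob C \<Longrightarrow> Y \<in> Ob C \<Longrightarrow> f \<in> carrier (Hom C X Y) \<Longrightarrow> unital_mor M X Y f \<mu> \<in> carrier (B X Y)"
  by (cases "X = Y") (auto simp: unital_mor_eq)

lemma comm_prod_closed:
  assumes "\<forall>i\<in>{1..j + 1}. Z i \<in> Ob C" "\<forall>i\<in>{1..j}. f i \<in> carrier (Hom C (Z (i + 1)) (Z i))"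
  shows "comm_prod M Z f j \<in> carrier (B (Z (j + 1)) (Z 1))"
  using assms
proof (induction j)
  case (Suc j)
  have "comm_prod M Z f j \<in> carrier (B (Z (j + 1)) (Z 1))" using Suc by auto
  moreover have "mcomm M (Z (j + 2)) (Z (j + 1)) (f (j + 1)) \<in> carrier (B (Z (j + 2)) (Z (j + 1)))"
    using Suc.prems(1) Suc.prems(2)[rule_format, of "j + 1"] by (intro mcomm_closed) auto
  ultimately show ?case
    using op_compose_closed[of "Z (j + 2)" "Z (j + 1)" "Z 1"] Suc.prems(1) by simp
qed simp

lemma comm_prod_cong:
  assumes "\<And>i. 1 \<le> i \<Longrightarrow> i \<le> j + 1 \<Longrightarrow> Z i = Z' i" "\<And>i. 1 \<le> i \<Longrightarrow> i \<le> j \<Longrightarrow> f i = f' i"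
  shows "comm_prod M Z f j = comm_prod M Z' f' j"
  using assms
proof (induction j)
  case (Suc j)
  then have "comm_prod M Z f j = comm_prod M Z' f' j" by auto
  with Suc.prems show ?case by auto
qed auto

lemma generator_0:
  assumes "X \<in> Ob C" "Y \<in> Ob C"
  shows "omega_generators C M 0 X Y = {unital_mor M X Y f \<mu> | f \<mu>. f \<in> carrier (Hom C X Y)}"
proof -
  have *: "comp X (unital_mor M X Y f \<mu>) (id_op (fob M X)) = unital_mor M X Y f \<mu>"
    if "f \<in> carrier (Hom C X Y)" for f \<mu>
    using assms that by (intro comp_id_right[of X Y]) auto
  show ?thesis
  proof
    show "omega_generators C M 0 X Y \<subseteq> {unital_mor M X Y f \<mu> | f \<mu>. f \<in> carrier (Hom C X Y)}"
      using * by (auto simp: omega_generators_def)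
    show "{unital_mor M X Y f \<mu> | f \<mu>. f \<in> carrier (Hom C X Y)} \<subseteq> omega_generators C M 0 X Y"
    proof
      fix T assume "T \<in> {unital_mor M X Y f \<mu> | f \<mu>. f \<in> carrier (Hom C X Y)}"
      then obtain f \<mu> where f: "T = unital_mor M X Y f \<mu>" "f \<in> carrier (Hom C X Y)" by blast
      then show "T \<in> omega_generators C M 0 X Y"
        unfolding omega_generators_def mem_Collect_eq
        by (intro exI[of _ "\<lambda>_. X"] exI[of _ "\<lambda>_. f"] exI[of _ f] exI[of _ \<mu>])
           (use assms * in simp)
    qed
  qed
qed

text \<open>\<open>comm_prod\<close> grows at its right end, so the commutator at the source end can
  be peeled off. With \<open>generator_SucI\<close> this describes generators by recursion on the
  degree, which is what \<open>Om_induct\<close> rests on.\<close>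

lemma generator_SucD:
  assumes T: "T \<in> omega_generators C M (Suc j) X Y" and Y: "Y \<in> Ob C"
  obtains X' f S where "X' \<in> Ob C" "X \<in> Ob C" "f \<in> carrier (Hom C X X')"
    "S \<in> omega_generators C M j X' Y" "T = comp X S (mcomm M X X' f)"
proof -
  obtain Z f f0 \<mu> where Z: "\<forall>i\<in>{1..Suc j + 1}. Z i \<in> Ob C" "Z (Suc j + 1) = X"
    and f: "\<forall>i\<in>{1..Suc j}. f i \<in> carrier (Hom C (Z (i + 1)) (Z i))"
    and f0: "f0 \<in> carrier (Hom C (Z 1) Y)"
    and eq: "T = comp X (unital_mor M (Z 1) Y f0 \<mu>) (comm_prod M Z f (Suc j))"
    using T unfolding omega_generators_def by blast
  have ob: "Z (j + 1) \<in> Ob C" "Z 1 \<in> Ob C" "X \<in> Ob C" using Z by auto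
  have fj: "f (j + 1) \<in> carrier (Hom C X (Z (j + 1)))" using f Z by auto
  have c: "comm_prod M Z f j \<in> carrier (B (Z (j + 1)) (Z 1))"
    using Z f by (intro comm_prod_closed) auto
  show thesis
  proof (rule that)
    show "comp (Z (j + 1)) (unital_mor M (Z 1) Y f0 \<mu>) (comm_prod M Z f j) \<in> omega_generators C M j (Z (j + 1)) Y"
      unfolding omega_generators_def mem_Collect_eq
      by (intro exI[of _ Z] exI[of _ f] exI[of _ f0] exI[of _ \<mu>]) (use Z f f0 in auto)
    have "T = comp X (unital_mor M (Z 1) Y f0 \<mu>)
        (comp X (comm_prod M Z f j) (mcomm M X (Z (j + 1)) (f (j + 1))))"
      unfolding eq using Z(2) by simp
    also have "\<dots> = comp X (comp (Z (j + 1)) (unital_mor M (Z 1) Y f0 \<mu>) (comm_prod M Z f j))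
        (mcomm M X (Z (j + 1)) (f (j + 1)))"
      by (rule op_compose_assoc[where K = "fob M (Z 1)" and L = "fob M Y"]) (use ob Y c f0 fj in auto)
    finally show "T = comp X (comp (Z (j + 1)) (unital_mor M (Z 1) Y f0 \<mu>) (comm_prod M Z f j))
        (mcomm M X (Z (j + 1)) (f (j + 1)))" .
  qed (use ob fj in auto)
qed

lemma generator_SucI:
  assumes S: "S \<in> omega_generators C M j X' Y" and ob: "X' \<in> Ob C" "X \<in> Ob C" "Y \<in> Ob C"
    and g: "g \<in> carrier (Hom C X X')"
  shows "comp X S (mcomm M X X' g) \<in> omega_generators C M (Suc j) X Y"
proof -
  obtain Z f f0 \<mu> where Z: "\<forall>i\<in>{1..j + 1}. Z i \<in> Ob C" "Z (j + 1) = X'"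
    and f: "\<forall>i\<in>{1..j}. f i \<in> carrier (Hom C (Z (i + 1)) (Z i))"
    and f0: "f0 \<in> carrier (Hom C (Z 1) Y)"
    and eq: "S = comp X' (unital_mor M (Z 1) Y f0 \<mu>) (comm_prod M Z f j)"
    using S unfolding omega_generators_def by blast
  \<comment> \<open>The new commutator has index \<open>j + 1\<close> and goes from object
    \<open>j + 2\<close> to object \<open>j + 1\<close>.\<close>
  define Z' where "Z' = Z(j + 2 := X)"
  define f' where "f' = f(j + 1 := g)"
  have c: "comm_prod M Z f j \<in> carrier (B (Z (j + 1)) (Z 1))"
    using Z f by (intro comm_prod_closed) auto
  have e: "comm_prod M Z' f' j = comm_prod M Z f j"
    by (rule comm_prod_cong) (auto simp: Z'_def f'_def)
  have "comp X S (mcomm M X X' g) =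
      comp X (unital_mor M (Z 1) Y f0 \<mu>) (comp X (comm_prod M Z f j) (mcomm M X X' g))"
    unfolding eq
    by (rule op_compose_assoc[where K = "fob M (Z 1)" and L = "fob M Y", symmetric]) (use ob Z c f0 g in auto)
  also have "\<dots> = comp X (unital_mor M (Z' 1) Y f0 \<mu>) (comm_prod M Z' f' (Suc j))"
    using Z(2) e by (simp add: Z'_def f'_def)
  finally have T: "comp X S (mcomm M X X' g) =
    comp X (unital_mor M (Z' 1) Y f0 \<mu>) (comm_prod M Z' f' (Suc j))" .
  have "\<forall>i\<in>{1..Suc j + 1}. Z' i \<in> Ob C"
    using Z ob by (auto simp: Z'_def)
  moreover have "\<forall>i\<in>{1..Suc j}. f' i \<in> carrier (Hom C (Z' (i + 1)) (Z' i))"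
    using Z f g by (auto simp: Z'_def f'_def)
  ultimately show ?thesis
    unfolding omega_generators_def mem_Collect_eq
    by (intro exI[of _ Z'] exI[of _ f'] exI[of _ f0] exI[of _ \<mu>]) (use T f0 in \<open>auto simp: Z'_def\<close>)
qed

definition Om :: "nat \<Rightarrow> 'o \<Rightarrow> 'o \<Rightarrow> ('v \<Rightarrow> 'v) set" where
  "Om j X Y = lin_span (B X Y) (omega_generators C M j X Y)"

lemma generators_bop:
  "X \<in> Ob C \<Longrightarrow> Y \<in> Ob C \<Longrightarrow> omega_generators C M j X Y \<subseteq> carrier (B X Y)"
proof (induction j arbitrary: X)
  case 0
  then show ?case by (auto simp: generator_0)
next
  case (Suc j)
  show ?case
  proof
    fix T assume "T \<in> omega_generators C M (Suc j) X Y"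
    then obtain X' f S where "X' \<in> Ob C" "X \<in> Ob C" "f \<in> carrier (Hom C X X')"
      "S \<in> omega_generators C M j X' Y" "T = comp X S (mcomm M X X' f)"
      using Suc.prems(2) by (rule generator_SucD)
    then show "T \<in> carrier (B X Y)"
      using Suc.IH[of X'] Suc.prems op_compose_closed[of X X' Y "mcomm M X X' f" S] by auto
  qed
qed

lemma B_module: "X \<in> Ob C \<Longrightarrow> Y \<in> Ob C \<Longrightarrow> module cfield (B X Y)"
  by (rule bop_module) auto

lemma Om_submodule: "X \<in> Ob C \<Longrightarrow> Y \<in> Ob C \<Longrightarrow> submodule (Om j X Y) cfield (B X Y)"
  unfolding Om_def by (intro lin_span_submodule B_module generators_bop)

lemma Om_bop: "X \<in> Ob C \<Longrightarrow> Y \<in> Ob C \<Longrightarrow> T \<in> Om j X Y \<Longrightarrow> T \<in> carrier (B X Y)"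
  using module.submoduleE(1)[OF B_module Om_submodule] by blast

lemma Om_zero: "X \<in> Ob C \<Longrightarrow> Y \<in> Ob C \<Longrightarrow> \<zero>\<^bsub>B X Y\<^esub> \<in> Om j X Y"
  using subgroup.one_closed[OF submodule.axioms(1)[OF Om_submodule]] by simp

lemma Om_add:
  "X \<in> Ob C \<Longrightarrow> Y \<in> Ob C \<Longrightarrow> S \<in> Om j X Y \<Longrightarrow> T \<in> Om j X Y \<Longrightarrow> S \<oplus>\<^bsub>B X Y\<^esub> T \<in> Om j X Y"
  using module.submoduleE(5)[OF B_module Om_submodule] by blast

lemma Om_smult: "X \<in> Ob C \<Longrightarrow> Y \<in> Ob C \<Longrightarrow> T \<in> Om j X Y \<Longrightarrow> c \<odot>\<^bsub>B X Y\<^esub> T \<in> Om j X Y"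
  using module.submoduleE(4)[OF B_module Om_submodule] by simp

lemma Om_gen: "T \<in> omega_generators C M j X Y \<Longrightarrow> T \<in> Om j X Y"
  unfolding Om_def lin_span_def by (rule hull_inc)

text \<open>Two inductions in one, over the span and over the number of commutators. The source and
  the degree vary while the target \<open>Y\<close> stays fixed, because factors are peeled off at
  the source.\<close>

lemma Om_induct [consumes 3, case_names base step zero add smult]:
  assumes T: "T \<in> Om j X Y" and X: "X \<in> Ob C" and Y: "Y \<in> Ob C"
    and base: "\<And>X f \<mu>. X \<in> Ob C \<Longrightarrow> f \<in> carrier (Hom C X Y) \<Longrightarrow> P 0 X (unital_mor M X Y f \<mu>)"
    and step: "\<And>j X X' f S. X \<in> Ob C \<Longrightarrow> X' \<in> Ob C \<Longrightarrow> f \<in> carrier (Hom C X X') \<Longrightarrow> S \<in> Om j X' Y \<Longrightarrow>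
      P j X' S \<Longrightarrow> P (Suc j) X (comp X S (mcomm M X X' f))"
    and zero: "\<And>j X. X \<in> Ob C \<Longrightarrow> P j X \<zero>\<^bsub>B X Y\<^esub>"
    and add: "\<And>j X S T. X \<in> Ob C \<Longrightarrow> S \<in> Om j X Y \<Longrightarrow> T \<in> Om j X Y \<Longrightarrow> P j X S \<Longrightarrow> P j X T \<Longrightarrow>
      P j X (S \<oplus>\<^bsub>B X Y\<^esub> T)"
    and smult: "\<And>j X c T. X \<in> Ob C \<Longrightarrow> T \<in> Om j X Y \<Longrightarrow> P j X T \<Longrightarrow> P j X (c \<odot>\<^bsub>B X Y\<^esub> T)"
  shows "P j X T"
proof -
  have gen: "P j X T" if "T \<in> omega_generators C M j X Y" "X \<in> Ob C" for j X T
    using that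
  proof (induction j arbitrary: X T)
    case 0
    then show ?case using generator_0[of X Y] Y base by auto
  next
    case (Suc j)
    obtain X' f S where "X' \<in> Ob C" "X \<in> Ob C" "f \<in> carrier (Hom C X X')"
      "S \<in> omega_generators C M j X' Y" "T = comp X S (mcomm M X X' f)"
      using Suc.prems(1) Y by (rule generator_SucD)
    then show ?case using Suc.IH step Om_gen by blast
  qed
  show ?thesis
    using T unfolding Om_def
    by (rule lin_span_induct)
       (use gen zero add smult X Y B_module generators_bop in \<open>auto simp: Om_def\<close>)
qed

lemma Om_unital: "X \<in> Ob C \<Longrightarrow> Y \<in> Ob C \<Longrightarrow> f \<in> carrier (Hom C X Y) \<Longrightarrow> unital_mor M X Y f \<mu> \<in> Om 0 X Y"
  by (rule Om_gen) (auto simp: generator_0)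

lemma Om_mcomm_right:
  assumes "T \<in> Om j X' Y" and ob: "X \<in> Ob C" "X' \<in> Ob C" "Y \<in> Ob C" and f: "f \<in> carrier (Hom C X X')"
  shows "comp X T (mcomm M X X' f) \<in> Om (Suc j) X Y"
proof -
  have "T \<in> lin_span (B X' Y) (omega_generators C M j X' Y)" using assms by (simp add: Om_def)
  then show ?thesis
  proof (induction rule: lin_span_induct)
    case (gen T)
    then show ?case using ob f by (intro Om_gen generator_SucI)
  next
    case zero
    then show ?case using ob f by (simp add: comp_zero_left Om_zero)
  next
    case (add S T)
    then have "S \<in> carrier (B X' Y)" "T \<in> carrier (B X' Y)" using ob Om_bop unfolding Om_def by blast+
    then show ?case
      using ob f add by (simp add: comp_add_left Om_add)
  next
    case (smult c T)
    then have "T \<in> carrier (B X' Y)" using ob Om_bop unfolding Om_def by blast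
    then show ?case
      using ob f smult by (simp add: comp_smult_left Om_smult)
  qed (use ob B_module generators_bop in auto)
qed

lemma Om_fmor: "X \<in> Ob C \<Longrightarrow> Y \<in> Ob C \<Longrightarrow> f \<in> carrier (Hom C X Y) \<Longrightarrow> fmor M X Y f \<in> Om 0 X Y"
  using Om_unital[of X Y f 0] B_smult_zero[of X Y "id_op (fob M X)"] B_simps[of X Y "fmor M X Y f"]
  by (cases "X = Y") (auto simp: unital_mor_eq)

text \<open>The generator with zero morphism and scalar 1.\<close>

lemma Om_id: "X \<in> Ob C \<Longrightarrow> id_op (fob M X) \<in> Om 0 X X"
  using Om_unital[of X X "\<zero>\<^bsub>Hom C X X\<^esub>" 1] fmor_zero[of X X] B_simps[of X X "id_op (fob M X)"]
  by (simp add: unital_mor_eq)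

lemma Om_mcomm: "X \<in> Ob C \<Longrightarrow> Y \<in> Ob C \<Longrightarrow> f \<in> carrier (Hom C X Y) \<Longrightarrow> mcomm M X Y f \<in> Om 1 X Y"
  using Om_mcomm_right[OF Om_id, of Y X f] comp_id_left[of X Y "mcomm M X Y f"] by simp

text \<open>The morphism is absorbed by the leftmost factor, where a scalar summand turns into a
  multiple of \<open>a\<close>.\<close>

lemma Om_fmor_left:
  assumes T: "T \<in> Om j X Y" and ob: "X \<in> Ob C" "Y \<in> Ob C" "Z \<in> Ob C" and a: "a \<in> carrier (Hom C Y Z)"
  shows "comp X (fmor M Y Z a) T \<in> Om j X Z"
  using T ob(1,2)
proof (induction rule: Om_induct)
  case (base X f \<mu>)
  have 1: "comp X (fmor M Y Z a) (fmor M X Y f) \<in> Om 0 X Z"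
    using Om_fmor[of X Z "Comp C X Y Z a f"] base ob a by (simp add: fmor_comp)
  show ?case
  proof (cases "X = Y")
    case True
    then show ?thesis
      using 1 base ob a comp_id_right[of Y Z "fmor M Y Z a"]
      by (simp add: unital_mor_eq comp_add_right comp_smult_right Om_add Om_smult Om_fmor)
  qed (use 1 in \<open>simp add: unital_mor_eq\<close>)
next
  case (step j X X' f S)
  have S: "S \<in> carrier (B X' Y)" using step ob Om_bop by blast
  have "comp X (fmor M Y Z a) (comp X S (mcomm M X X' f)) = comp X (comp X' (fmor M Y Z a) S) (mcomm M X X' f)"
    by (rule comp_assoc[of X X' Y Z]) (use step ob a S in auto)
  then show ?case using Om_mcomm_right[of _ j X' Z X f] step ob by simp
qed (use ob a Om_bop in \<open>auto simp: comp_zero_right comp_add_right comp_smult_right intro: Om_zero Om_add Om_smult\<close>)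

lemma Om_minus:
  assumes ob: "X \<in> Ob C" "Y \<in> Ob C" and "S \<in> Om j X Y" "T \<in> Om j X Y" and R: "R \<in> carrier (B X Y)"
    and eq: "R \<oplus>\<^bsub>B X Y\<^esub> S = T"
  shows "R \<in> Om j X Y"
proof -
  have c: "S \<in> carrier (B X Y)" "T \<in> carrier (B X Y)" using assms Om_bop by blast+
  have "R = T \<oplus>\<^bsub>B X Y\<^esub> (- 1) \<odot>\<^bsub>B X Y\<^esub> S"
    unfolding eq[symmetric] using ob R c
    by (intro bop_eqI[of _ "fob M X" "fob M Y"]) (auto intro!: hs_eqI[of "fob M Y"])
  then show ?thesis using assms by (auto intro: Om_add Om_smult)
qed

text \<open>All content is in degree 0: the Leibniz rule expresses the commutator followed by a
  morphism through forms with the commutator on the right, and the scalar summand contributes a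
  multiple of the commutator itself. Later factors just ride along.\<close>

lemma Om_mcomm_left:
  assumes T: "T \<in> Om j X Y" and ob: "X \<in> Ob C" "Y \<in> Ob C" "Z \<in> Ob C" and a: "a \<in> carrier (Hom C Y Z)"
  shows "comp X (mcomm M Y Z a) T \<in> Om (Suc j) X Z"
  using T ob(1,2)
proof (induction rule: Om_induct)
  case (base X f \<mu>)
  have "comp X (mcomm M Y Z a) (fmor M X Y f) \<in> Om 1 X Z"
  proof (rule Om_minus)
    show "comp X (mcomm M Y Z a) (fmor M X Y f) \<oplus>\<^bsub>B X Z\<^esub> comp X (fmor M Y Z a) (mcomm M X Y f) =
        mcomm M X Z (Comp C X Y Z a f)"
      using base ob a by (simp add: mcomm_comp)
    show "comp X (fmor M Y Z a) (mcomm M X Y f) \<in> Om 1 X Z"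
      using Om_mcomm_right[OF Om_fmor, of Y Z a X f] base ob a by simp
    show "mcomm M X Z (Comp C X Y Z a f) \<in> Om 1 X Z" using base ob a by (intro Om_mcomm) auto
    show "comp X (mcomm M Y Z a) (fmor M X Y f) \<in> carrier (B X Z)"
      using base ob a by (intro op_compose_closed[of X Y Z]) auto
  qed (use base ob in auto)
  then have 1: "comp X (mcomm M Y Z a) (fmor M X Y f) \<in> Om (Suc 0) X Z" by simp
  show ?case
  proof (cases "X = Y")
    case True
    then show ?thesis
      using 1 base ob a comp_id_right[of Y Z "mcomm M Y Z a"] Om_mcomm[of Y Z a]
      by (simp add: unital_mor_eq comp_add_right comp_smult_right Om_add Om_smult)
  qed (use 1 in \<open>simp add: unital_mor_eq\<close>)
next
  case (step j X X' f S)
  have S: "S \<in> carrier (B X' Y)" using step ob Om_bop by blast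
  have "comp X (mcomm M Y Z a) (comp X S (mcomm M X X' f)) = comp X (comp X' (mcomm M Y Z a) S) (mcomm M X X' f)"
    by (rule comp_assoc[of X X' Y Z]) (use step ob a S in auto)
  then show ?case using Om_mcomm_right[of _ "Suc j" X' Z X f] step ob by simp
qed (use ob a Om_bop in \<open>auto simp: comp_zero_right comp_add_right comp_smult_right intro: Om_zero Om_add Om_smult\<close>)

lemma Om_comp:
  assumes S: "S \<in> Om i Y Z" and T: "T \<in> Om j X Y" and ob: "X \<in> Ob C" "Y \<in> Ob C" "Z \<in> Ob C"
  shows "comp X S T \<in> Om (i + j) X Z"
proof -
  \<comment> \<open>The right factor is quantified, with its source and degree, since moving the
    last commutator of \<open>S\<close> over to it raises its degree.\<close>
  have "\<forall>j X T. X \<in> Ob C \<longrightarrow> T \<in> Om j X Y \<longrightarrow> comp X S T \<in> Om (i + j) X Z"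
    using S ob(2,3)
  proof (induction rule: Om_induct)
    case (base Y a \<mu>)
    show ?case
    proof (intro allI impI)
      fix j X T assume X: "X \<in> Ob C" and T: "T \<in> Om j X Y"
      have TB: "T \<in> carrier (B X Y)" using T X base Om_bop by blast
      have 1: "comp X (fmor M Y Z a) T \<in> Om j X Z" using Om_fmor_left[OF T] X base ob by blast
      show "comp X (unital_mor M Y Z a \<mu>) T \<in> Om (0 + j) X Z"
      proof (cases "Y = Z")
        case True
        then show ?thesis
          using 1 base ob X T TB
          by (simp add: unital_mor_eq comp_add_left comp_smult_left comp_id_left Om_add Om_smult)
      qed (use 1 in \<open>simp add: unital_mor_eq\<close>)
    qed
  next
    case (step i Y Y' f S)
    show ?case
    proof (intro allI impI)
      fix j X T assume X: "X \<in> Ob C" and T: "T \<in> Om j X Y"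
      have c: "T \<in> carrier (B X Y)" "S \<in> carrier (B Y' Z)" using T X step ob Om_bop by blast+
      have "comp X (mcomm M Y Y' f) T \<in> Om (Suc j) X Y'"
        using Om_mcomm_left[OF T X] step by blast
      then have "comp X S (comp X (mcomm M Y Y' f) T) \<in> Om (i + Suc j) X Z" using step.IH X by blast
      then show "comp X (comp Y S (mcomm M Y Y' f)) T \<in> Om (Suc i + j) X Z"
        using comp_assoc[of X Y Y' Z T "mcomm M Y Y' f" S] X step ob c by simp
    qed
  qed (use ob Om_bop in \<open>auto simp: comp_zero_left comp_add_left comp_smult_left intro!: Om_zero Om_add Om_smult\<close>)
  then show ?thesis using T ob by blast
qed

text \<open>The second Leibniz term contains an iterated commutator and vanishes, so differentiation
  passes by all commutators and reaches only the leading factor.\<close>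

lemma gcomm_comp_mcomm:
  assumes "X \<in> Ob C" "X' \<in> Ob C" "Y \<in> Ob C" "f \<in> carrier (Hom C X X')" "S \<in> carrier (B X' Y)"
  shows "gcomm M (Suc j) X Y (comp X S (mcomm M X X' f)) = comp X (gcomm M j X' Y S) (mcomm M X X' f)"
proof -
  have "gcomm M (j + 1) X Y (comp X S (mcomm M X X' f)) = comp X (gcomm M j X' Y S) (mcomm M X X' f)
      \<oplus>\<^bsub>B X Y\<^esub> (- 1) ^ j \<odot>\<^bsub>B X Y\<^esub> comp X S (gcomm M 1 X X' (mcomm M X X' f))"
    using assms by (intro gcomm_compose) auto
  also have "\<dots> = comp X (gcomm M j X' Y S) (mcomm M X X' f)"
    using assms op_compose_closed[of X X' Y "mcomm M X X' f" "gcomm M j X' Y S"]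
      gcomm_mcomm[of X X' f] comp_zero_right[of X X' Y S]
      B_simps[of X Y "comp X (gcomm M j X' Y S) (mcomm M X X' f)"] B_smult_zero_right[of X Y] by simp
  finally show ?thesis by simp
qed

lemma Om_gcomm:
  assumes T: "T \<in> Om j X Y" and ob: "X \<in> Ob C" "Y \<in> Ob C"
  shows "gcomm M j X Y T \<in> Om (Suc j) X Y"
  using T ob
proof (induction rule: Om_induct)
  case (base X f \<mu>)
  have 1: "gcomm M 0 X Y (fmor M X Y f) \<in> Om (Suc 0) X Y"
    using Om_mcomm[of X Y f] base ob by (simp add: mcomm_def)
  show ?case
  proof (cases "X = Y")
    case True
    then show ?thesis
      using 1 base by (simp add: unital_mor_eq gcomm_add gcomm_smult gcomm_id B_simps B_smult_zero_right)
  qed (use 1 in \<open>simp add: unital_mor_eq\<close>)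
next
  case (step j X X' f S)
  have S: "S \<in> carrier (B X' Y)" using step ob Om_bop by blast
  then show ?case
    using Om_mcomm_right[of _ "Suc j" X' Y X f] gcomm_comp_mcomm[of X X' Y f S j] step ob by simp
qed (use ob Om_bop in \<open>auto simp: gcomm_zero gcomm_add gcomm_smult intro!: Om_zero Om_add Om_smult\<close>)

lemma Om_homogeneous:
  assumes T: "T \<in> Om j X Y" and ob: "X \<in> Ob C" "Y \<in> Ob C"
  shows "homogeneous j (fob M X) (fob M Y) T"
  using T ob
proof (induction rule: Om_induct)
  case (base X f \<mu>)
  then show ?case
    using ob fmor_homogeneous[of X Y f] gsh[of X] homogeneous_id[OF gsh[of X]]
    by (cases "X = Y") (auto simp: unital_mor_eq intro!: homogeneous_add homogeneous_smult)
next
  case (step j X X' f S)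
  then show ?case
    using homogeneous_compose[OF gsh gsh gsh _ _ mcomm_homogeneous, of X X' Y f S j] Om_bop[of X' Y S] ob by simp
qed (use ob Om_bop gsh in \<open>auto intro!: homogeneous_zero homogeneous_add homogeneous_smult\<close>)

text \<open>Each commutator contributes \<open>1 / p\<close> to the exponent, and the bounded
  leading factor contributes 0.\<close>

lemma Om_decay:
  assumes T: "T \<in> Om j X Y" and ob: "X \<in> Ob C" "Y \<in> Ob C"
  shows "T \<in> decay (j / p) (fob M X) (fob M Y)"
  using T ob
proof (induction rule: Om_induct)
  case (base X f \<mu>)
  then show ?case using ob bop_decay_0[of "fob M X" "unital_mor M X Y f \<mu>" "fob M Y"] by simp
next
  case (step j X X' f S)
  then have "comp X S (mcomm M X X' f) \<in> decay (j / p + 1 / p) (fob M X) (fob M Y)"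
    using ob p1 by (intro decay_compose[of _ "fob M X'"] mcomm_decay) auto
  then show ?case by (simp add: add_divide_distrib add.commute)
qed (use ob p1 in \<open>auto intro!: zero_decay decay_add decay_smult\<close>)

section \<open>The supertrace and its graded trace property\<close>

section \<open>The supertrace\<close>

abbreviation gr :: "'o \<Rightarrow> 'v \<Rightarrow> 'v" where
  "gr X \<equiv> grading_op (fob M X)"

text \<open>Separating this functional from the commutator lets its trace property be stated for the
  individual terms of a Leibniz expansion.\<close>

definition \<tau> :: "'o \<Rightarrow> ('v \<Rightarrow> 'v) \<Rightarrow> complex" where
  "\<tau> X T = op_trace (fob M X) (comp X (gr X) (comp X (fop M X) T))"

lemma supertrace_eq: "supertrace M k X T = 1 / 2 * \<tau> X (gcomm M k X X T)"
  by (simp add: supertrace_def \<tau>_def)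

lemma gr_closed [simp]: "X \<in> Ob C \<Longrightarrow> gr X \<in> carrier (B X X)"
  by (rule grading_op_bop[OF gsh])

lemma gr_fop_decay:
  assumes "X \<in> Ob C" "Y \<in> Ob C" "T \<in> decay \<theta> (fob M X) (fob M Y)" "\<theta> \<ge> 0"
  shows "comp X (gr Y) (comp X (fop M Y) T) \<in> decay \<theta> (fob M X) (fob M Y)"
proof -
  have "comp X (fop M Y) T \<in> decay (0 + \<theta>) (fob M X) (fob M Y)"
    by (rule decay_compose[of _ "fob M Y"]) (use assms in \<open>auto intro: bop_decay_0\<close>)
  then have "comp X (gr Y) (comp X (fop M Y) T) \<in> decay (0 + \<theta>) (fob M X) (fob M Y)"
    by (intro decay_compose[of _ "fob M Y"]) (use assms in \<open>auto intro: bop_decay_0\<close>)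
  then show ?thesis by simp
qed

lemma gr_fop_schatten:
  assumes "X \<in> Ob C" "T \<in> decay 1 (fob M X) (fob M X)"
  shows "comp X (gr X) (comp X (fop M X) T) \<in> schatten 1 (fob M X) (fob M X)"
  using assms by (intro decay_schatten[where \<theta> = 1] gr_fop_decay) auto

lemma \<tau>_add:
  assumes "X \<in> Ob C" "S \<in> decay 1 (fob M X) (fob M X)" "T \<in> decay 1 (fob M X) (fob M X)"
  shows "\<tau> X (S \<oplus>\<^bsub>B X X\<^esub> T) = \<tau> X S + \<tau> X T"
proof -
  have c: "S \<in> carrier (B X X)" "T \<in> carrier (B X X)" using assms decay_bop by blast+
  have "comp X (gr X) (comp X (fop M X) (S \<oplus>\<^bsub>B X X\<^esub> T)) =
      comp X (gr X) (comp X (fop M X) S) \<oplus>\<^bsub>B X X\<^esub> comp X (gr X) (comp X (fop M X) T)"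
    using assms c by (simp add: comp_add_right)
  then show ?thesis
    unfolding \<tau>_def using assms by (simp add: op_trace_add gr_fop_schatten)
qed

lemma \<tau>_smult:
  assumes "X \<in> Ob C" "T \<in> decay 1 (fob M X) (fob M X)"
  shows "\<tau> X (c \<odot>\<^bsub>B X X\<^esub> T) = c * \<tau> X T"
proof -
  have c: "T \<in> carrier (B X X)" using assms decay_bop by blast
  have "comp X (gr X) (comp X (fop M X) (c \<odot>\<^bsub>B X X\<^esub> T)) =
      c \<odot>\<^bsub>B X X\<^esub> comp X (gr X) (comp X (fop M X) T)"
    using assms c by (simp add: comp_smult_right)
  then show ?thesis
    unfolding \<tau>_def using assms by (simp add: op_trace_smult gr_fop_schatten)
qed

lemma \<tau>_zero: "X \<in> Ob C \<Longrightarrow> \<tau> X \<zero>\<^bsub>B X X\<^esub> = 0"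
  by (simp add: \<tau>_def comp_zero_right op_trace_zero)

text \<open>\<open>A\<close> commutes with \<open>F\<close> and with the grading up to the same sign, so it commutes with
  their product and can be moved to the right by the trace property.\<close>

lemma \<tau>_commute:
  assumes ob: "X \<in> Ob C" "Y \<in> Ob C" and A: "A \<in> Om a Y X" "a > 0" "gcomm M a Y X A = \<zero>\<^bsub>B Y X\<^esub>"
    and D: "D \<in> Om b X Y" and ab: "real (a + b) \<ge> p"
  shows "\<tau> X (comp X A D) = \<tau> Y (comp Y D A)"
proof -
  have c: "A \<in> carrier (B Y X)" "D \<in> carrier (B X Y)" using A D ob Om_bop by blast+
  have dA: "A \<in> decay (a / p) (fob M Y) (fob M X)" using Om_decay[OF A(1)] ob by simp
  have dD: "D \<in> decay (b / p) (fob M X) (fob M Y)" using Om_decay[OF D] ob by simp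
  \<comment> \<open>Grading and \<open>F\<close> are attached to \<open>D\<close>; both products
    with \<open>A\<close> then keep the exponent of the original ones, since bounded factors cost
    nothing.\<close>
  let ?D = "comp X (gr Y) (comp X (fop M Y) D)"
  have dD': "?D \<in> decay (b / p) (fob M X) (fob M Y)"
    using gr_fop_decay[OF ob dD] p1 by simp
  have cD': "?D \<in> carrier (B X Y)" by (rule decay_bop[OF dD'])
  have pab: "a / p + b / p \<ge> 1" using ab p1 by (simp add: field_simps)
  have s1: "comp X A ?D \<in> schatten 1 (fob M X) (fob M X)"
    by (rule decay_schatten[OF _ _ decay_compose[OF _ _ _ _ _ dD' dA] pab]) (use ob p1 in auto)
  have pba: "b / p + a / p \<ge> 1" using pab by (simp add: add.commute)
  have s2: "comp Y ?D A \<in> schatten 1 (fob M Y) (fob M Y)"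
    by (rule decay_schatten[OF _ _ decay_compose[OF _ _ _ _ _ dA dD'] pba]) (use ob p1 in auto)
  have hom: "A (gr Y y) = (- 1) ^ a \<odot>\<^bsub>fob M X\<^esub> gr X (A y)" if "y \<in> carrier (fob M Y)" for y
    using Om_homogeneous[OF A(1)] ob that by (simp add: homogeneous_def)
  \<comment> \<open>The vanishing commutator, read as a commutation rule with the same sign as
    \<open>hom\<close>.\<close>
  have FA: "fop M X (A y) = (- 1) ^ a \<odot>\<^bsub>fob M X\<^esub> A (fop M Y y)" if y: "y \<in> carrier (fob M Y)" for y
  proof (rule hs_eqI[of "fob M X"])
    fix z assume z: "z \<in> carrier (fob M X)"
    have "gcomm M a Y X A y = \<zero>\<^bsub>fob M X\<^esub>" using A(3) ob y by simp
    then have "hinner (fob M X) (gcomm M a Y X A y) z = 0" using ob z by simp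
    then show "hinner (fob M X) (fop M X (A y)) z
        = hinner (fob M X) ((- 1) ^ a \<odot>\<^bsub>fob M X\<^esub> A (fop M Y y)) z"
      using ob c y z by (simp add: gcomm_apply)
  qed (use ob c y in auto)
  have gg: "gr X x \<in> carrier (fob M X)" "gr X (k \<odot>\<^bsub>fob M X\<^esub> x) = k \<odot>\<^bsub>fob M X\<^esub> gr X x"
    if "X \<in> Ob C" "x \<in> carrier (fob M X)" for x k X
    using that bop_closed[OF gr_closed] bop_smult[OF gr_closed] by auto
  have sgn: "(- 1) ^ a * ((- 1) ^ a * z) = (z :: complex)" for z by (cases "even a") auto
  have "comp X (gr X) (comp X (fop M X) (comp X A D)) = comp X A ?D"
  proof (rule bop_eqI[of _ "fob M X" "fob M X"])
    have "comp X A D \<in> carrier (B X X)" "comp X A ?D \<in> carrier (B X X)"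
      by (rule op_compose_closed[of X Y X]; use ob c cD' in simp)+
    then show "comp X A ?D \<in> carrier (B X X)" "comp X (gr X) (comp X (fop M X) (comp X A D)) \<in> carrier (B X X)"
      using ob by auto
    fix x assume x: "x \<in> carrier (fob M X)"
    have Dx: "D x \<in> carrier (fob M Y)" using c x by simp
    have AF: "A (fop M Y (D x)) \<in> carrier (fob M X)" using ob c Dx by simp
    have "comp X A ?D x = A (gr Y (fop M Y (D x)))" using x by (simp add: compose_eq)
    also have "\<dots> = (- 1) ^ a \<odot>\<^bsub>fob M X\<^esub> gr X (A (fop M Y (D x)))"
      using hom Dx ob by simp
    also have "\<dots> = gr X (fop M X (A (D x)))"
      unfolding FA[OF Dx] by (rule gg(2)[OF ob(1) AF, symmetric])
    finally show "comp X (gr X) (comp X (fop M X) (comp X A D)) x = comp X A ?D x"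
      using x by (simp add: compose_eq)
  qed
  then have "\<tau> X (comp X A D) = op_trace (fob M X) (comp X A ?D)" by (simp add: \<tau>_def)
  \<comment> \<open>Positivity of \<open>a\<close> makes the exponent of \<open>A\<close> positive,
    which provides the eigenbasis behind \<open>op_trace_commute\<close>.\<close>
  also have "\<dots> = op_trace (fob M Y) (comp Y ?D A)"
    by (rule op_trace_commute[OF _ _ dA _ cD' s1 s2]) (use ob A p1 in auto)
  also have "comp Y ?D A = comp Y (gr Y) (comp Y (fop M Y) (comp Y D A))"
    by (auto simp: compose_def fun_eq_iff bop_closed[OF c(1)])
  finally show ?thesis by (simp add: \<tau>_def)
qed

lemma Om_decay_1: "X \<in> Ob C \<Longrightarrow> Y \<in> Ob C \<Longrightarrow> T \<in> Om j X Y \<Longrightarrow> real j \<ge> p \<Longrightarrow> T \<in> decay 1 (fob M X) (fob M Y)"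
  using decay_mono[OF _ _ Om_decay, of X 1 j T Y] p1 by simp

text \<open>The commutator raises the degree to \<open>n + 1\<close>, so this is the number that has
  to reach \<open>p\<close> for the trace to be additive.\<close>

lemma supertrace_add:
  assumes "X \<in> Ob C" "S \<in> Om n X X" "T \<in> Om n X X" "real n + 1 \<ge> p"
  shows "supertrace M n X (S \<oplus>\<^bsub>B X X\<^esub> T) = supertrace M n X S + supertrace M n X T"
  using assms Om_gcomm[of S n X X] Om_gcomm[of T n X X] Om_bop[of X X]
  by (simp add: supertrace_eq gcomm_add \<tau>_add Om_decay_1[of X X _ "Suc n"])

lemma supertrace_smult:
  assumes "X \<in> Ob C" "T \<in> Om n X X" "real n + 1 \<ge> p"
  shows "supertrace M n X (c \<odot>\<^bsub>B X X\<^esub> T) = c * supertrace M n X T"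
  using assms Om_gcomm[of T n X X] Om_bop[of X X]
  by (simp add: supertrace_eq gcomm_smult \<tau>_smult Om_decay_1[of X X _ "Suc n"])

lemma supertrace_closed:
  assumes "X \<in> Ob C" "T \<in> Om k X X"
  shows "supertrace M (Suc k) X (gcomm M k X X T) = 0"
  using assms Om_bop[of X X T k] by (simp add: supertrace_eq gcomm_gcomm \<tau>_zero)

text \<open>Each Leibniz term of the commutator with a product contains a factor
  \<open>[F, g]\<close> or \<open>[F, g']\<close>, annihilated by a further commutator, and
  \<open>\<tau>_commute\<close> moves that factor around. The two orders give
  \<open>s + (-1) ^ i * t\<close> and \<open>t + (-1) ^ j * s\<close>; for even \<open>n\<close> the
  parities of \<open>i\<close> and \<open>j\<close> agree, and these differ by the sign
  \<open>(-1) ^ (i * j)\<close>.\<close>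

lemma supertrace_graded:
  assumes ob: "X \<in> Ob C" "Y \<in> Ob C" and g: "g \<in> Om i Y X" and g': "g' \<in> Om j X Y"
    and n: "i + j = n" "even n" "real n + 1 \<ge> p"
  shows "supertrace M n X (comp X g g') = (- 1) ^ (i * j) * supertrace M n Y (comp Y g' g)"
proof -
  have c: "g \<in> carrier (B Y X)" "g' \<in> carrier (B X Y)" using g g' ob Om_bop by blast+
  have dg: "gcomm M i Y X g \<in> Om (Suc i) Y X" and dg': "gcomm M j X Y g' \<in> Om (Suc j) X Y"
    using g g' ob by (auto intro: Om_gcomm)
  have dd: "gcomm M (Suc i) Y X (gcomm M i Y X g) = \<zero>\<^bsub>B Y X\<^esub>" "gcomm M (Suc j) X Y (gcomm M j X Y g') = \<zero>\<^bsub>B X Y\<^esub>"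
    using c ob by (auto intro: gcomm_gcomm)
  define s where "s = \<tau> X (comp X (gcomm M i Y X g) g')"
  define t where "t = \<tau> Y (comp Y (gcomm M j X Y g') g)"
  have s: "s = \<tau> Y (comp Y g' (gcomm M i Y X g))"
    unfolding s_def by (rule \<tau>_commute[OF ob dg _ dd(1) g']) (use n in auto)
  have t: "t = \<tau> X (comp X g (gcomm M j X Y g'))"
    unfolding t_def by (rule \<tau>_commute[OF ob(2,1) dg' _ dd(2) g]) (use n in auto)
  have om: "comp X (gcomm M i Y X g) g' \<in> Om (Suc n) X X" "comp X g (gcomm M j X Y g') \<in> Om (Suc n) X X"
    "comp Y (gcomm M j X Y g') g \<in> Om (Suc n) Y Y" "comp Y g' (gcomm M i Y X g) \<in> Om (Suc n) Y Y"
    using Om_comp[OF dg g' ob ob(1)] Om_comp[OF g dg' ob ob(1)] Om_comp[OF dg' g ob(2,1,2)]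
      Om_comp[OF g' dg ob(2,1,2)] n(1) by (auto simp: add.commute)
  have dc: "T \<in> decay 1 (fob M Z) (fob M Z)" if "Z \<in> Ob C" "T \<in> Om (Suc n) Z Z" for T Z
    using Om_decay_1[OF that(1,1,2)] n by simp
  have X: "supertrace M n X (comp X g g') = 1 / 2 * (s + (- 1) ^ i * t)"
    unfolding supertrace_eq n(1)[symmetric] gcomm_compose[OF ob ob(1) c]
    using ob om dc by (simp add: \<tau>_add \<tau>_smult decay_smult flip: s_def t)
  have "supertrace M n Y (comp Y g' g) = 1 / 2 * (t + (- 1) ^ j * s)"
    unfolding supertrace_eq n(1)[symmetric] add.commute[of i j] gcomm_compose[OF ob(2,1,2) c(2,1)]
    using ob om dc by (simp add: \<tau>_add \<tau>_smult decay_smult flip: t_def s)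
  moreover have "even i \<longleftrightarrow> even j" using n by auto
  ultimately show ?thesis unfolding X by (cases "even j") auto
qed

section \<open>Assembly of the cycle\<close>

section \<open>The cycle\<close>

lemma Omega_simps [simp]:
  "gOb (Omega C M) = Ob C"
  "gHom (Omega C M) j X Y = (B X Y)\<lparr>carrier := Om j X Y\<rparr>"
  "gComp (Omega C M) i j X Y Z = comp X"
  by (simp_all add: Omega_def Om_def)

lemma dg_semicategory_Omega: "dg_semicategory (Omega C M) (gcomm M)"
proof -
  have mod: "module cfield (gHom (Omega C M) n X Y)" if "X \<in> Ob C" "Y \<in> Ob C" for n X Y
    using submodule.submodule_is_module[OF Om_submodule B_module] that by simp
  have 1: "linear_map (gHom (Omega C M) n X Y) (gHom (Omega C M) (Suc n) X Y) (gcomm M n X Y)"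
    if "X \<in> Ob C" "Y \<in> Ob C" for n X Y
    using that Om_bop[OF that] by (auto simp: linear_map_def gcomm_add gcomm_smult Om_gcomm)
  have 2: "linear_map (gHom (Omega C M) j X Y) (gHom (Omega C M) (i + j) X Z) (\<lambda>f. comp X g f)"
    if "X \<in> Ob C" "Y \<in> Ob C" "Z \<in> Ob C" "g \<in> Om i Y Z" for i j X Y Z g
    using that Om_bop[OF that(1,2)] Om_bop[OF that(2,3)]
    by (auto simp: linear_map_def comp_add_right comp_smult_right intro: Om_comp)
  have 3: "linear_map (gHom (Omega C M) i Y Z) (gHom (Omega C M) (i + j) X Z) (\<lambda>g. comp X g f)"
    if "X \<in> Ob C" "Y \<in> Ob C" "Z \<in> Ob C" "f \<in> Om j X Y" for i j X Y Z f
    using that Om_bop[OF that(1,2)] Om_bop[OF that(2,3)]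
    by (auto simp: linear_map_def comp_add_left comp_smult_left intro: Om_comp)
  have 4: "gcomm M (i + j) X Z (comp X g f) = comp X (gcomm M i Y Z g) f \<oplus>\<^bsub>B X Z\<^esub>
      (- 1) ^ i \<odot>\<^bsub>B X Z\<^esub> comp X g (gcomm M j X Y f)"
    if "X \<in> Ob C" "Y \<in> Ob C" "Z \<in> Ob C" "g \<in> Om i Y Z" "f \<in> Om j X Y" for i j X Y Z f g
    using that Om_bop by (intro gcomm_compose) auto
  have 5: "comp W h (comp W g f) = comp W (comp X h g) f"
    if "W \<in> Ob C" "X \<in> Ob C" "Y \<in> Ob C" "Z \<in> Ob C" "f \<in> Om k W X" "g \<in> Om j X Y" "h \<in> Om i Y Z"
    for W X Y Z f g h i j k
    by (rule comp_assoc[of W X Y Z]) (use that Om_bop in auto)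
  have 6: "gcomm M (Suc n) X Y (gcomm M n X Y f) = \<zero>\<^bsub>B X Y\<^esub>" if "X \<in> Ob C" "Y \<in> Ob C" "f \<in> Om n X Y" for X Y n f
    using that Om_bop by (intro gcomm_gcomm) auto
  show ?thesis
    unfolding dg_semicategory_def using mod 1 2 3 4 5 6 by simp
qed

lemma linear_category_Omega: "linear_category (degree0_part (Omega C M))"
proof -
  note dg = dg_semicategory_Omega[unfolded dg_semicategory_def]
  have "linear_semicategory (degree0_part (Omega C M))"
    using dg[THEN conjunct1, THEN spec[of _ 0]]
      dg[THEN conjunct2, THEN conjunct1, THEN spec[of _ 0], THEN spec[of _ 0]]
      dg[THEN conjunct2, THEN conjunct2, THEN spec[of _ 0], THEN spec[of _ 0], THEN spec[of _ 0]]
    unfolding linear_semicategory_def degree0_part_def by simp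
  moreover have "is_identity (degree0_part (Omega C M)) X (id_op (fob M X))" if "X \<in> Ob C" for X
    unfolding is_identity_def degree0_part_def
    using that Om_id comp_id_left comp_id_right Om_bop by simp
  ultimately show ?thesis unfolding linear_category_def by (auto simp: degree0_part_def)
qed

lemma linear_semifunctor_Omega:
  "linear_semifunctor C (degree0_part (Omega C M)) (\<lambda>X. X) (fmor M)"
  unfolding linear_semifunctor_def degree0_part_def
  using fmor_comp Om_fmor fmor_add fmor_smult by (auto simp: linear_map_def)

lemma cycle_Omega:
  assumes "even n" "real n + 1 \<ge> p"
  shows "cycle_over n C (Omega C M) (gcomm M) (supertrace M n) (\<lambda>X. X) (fmor M)"
proof -
  have "closed_graded_trace n (Omega C M) (gcomm M) (supertrace M n)"
    unfolding closed_graded_trace_def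
  proof (intro conjI ballI allI impI)
    fix X assume "X \<in> gOb (Omega C M)"
    then show "linear_map (gHom (Omega C M) n X X) cfield (supertrace M n X)"
      using assms by (auto simp: linear_map_def supertrace_add supertrace_smult)
  next
    fix X k f assume "X \<in> gOb (Omega C M)" "Suc k = n" "f \<in> carrier (gHom (Omega C M) k X X)"
    then show "supertrace M n X (gcomm M k X X f) = 0"
      using supertrace_closed by auto
  next
    fix X Y i j g g'
    assume "X \<in> gOb (Omega C M)" "Y \<in> gOb (Omega C M)" "i + j = n"
      "g \<in> carrier (gHom (Omega C M) i Y X)" "g' \<in> carrier (gHom (Omega C M) j X Y)"
    then show "supertrace M n X (gComp (Omega C M) i j X Y X g g') =
        (- 1) ^ (i * j) * supertrace M n Y (gComp (Omega C M) j i Y X Y g' g)"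
      using assms supertrace_graded[of X Y g i g' j n] by simp
  qed
  then show ?thesis
    unfolding cycle_over_def
    using dg_semicategory_Omega linear_category_Omega linear_semifunctor_Omega by blast
qed

lemma gcomm_schatten:
  assumes "real n + 1 \<ge> p" "X \<in> Ob C" "T \<in> Om n X X"
  shows "gcomm M n X X T \<in> schatten 1 (fob M X) (fob M X)"
  by (rule decay_schatten[OF _ _ Om_decay_1[of X X _ "Suc n"]]) (use assms in \<open>auto intro: Om_gcomm\<close>)

section \<open>The cocycle, in terms of words of morphisms and commutators\<close>

section \<open>The cocycle\<close>

text \<open>The chain is open: \<open>X (Suc k)\<close> is the source of the last morphism, and its
  coincidence with \<open>X 0\<close> is assumed separately where the chain is cyclic. Induction on
  \<open>k\<close> is then possible.\<close>

definition typed :: "(nat \<Rightarrow> 'o) \<Rightarrow> (nat \<Rightarrow> 'm) \<Rightarrow> nat \<Rightarrow> bool" where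
  "typed X f k \<longleftrightarrow> (\<forall>i\<le>Suc k. X i \<in> Ob C) \<and> (\<forall>i\<le>k. f i \<in> carrier (Hom C (X (Suc i)) (X i)))"

text \<open>\<open>word X f i k\<close> is \<open>f 0 [F, f 1] \<dots> [F, f k]\<close> with the commutator \<open>[F, f i]\<close> replaced by \<open>f i\<close> when
  \<open>1 \<le> i \<le> k\<close>.\<close>

primrec word :: "(nat \<Rightarrow> 'o) \<Rightarrow> (nat \<Rightarrow> 'm) \<Rightarrow> nat \<Rightarrow> nat \<Rightarrow> ('v \<Rightarrow> 'v)" where
  "word X f i 0 = fmor M (X (Suc 0)) (X 0) (f 0)"
| "word X f i (Suc k) = comp (X (Suc (Suc k))) (word X f i k)
     (if Suc k = i then fmor M (X (Suc (Suc k))) (X (Suc k)) (f (Suc k))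
      else mcomm M (X (Suc (Suc k))) (X (Suc k)) (f (Suc k)))"

lemma typed_Suc: "typed X f (Suc k) \<Longrightarrow> typed X f k"
  by (simp add: typed_def)

lemma typedD: "typed X f k \<Longrightarrow> i \<le> Suc k \<Longrightarrow> X i \<in> Ob C"
  "typed X f k \<Longrightarrow> i \<le> k \<Longrightarrow> f i \<in> carrier (Hom C (X (Suc i)) (X i))"
  by (auto simp: typed_def)

text \<open>A replaced commutator lowers the degree by one. An index \<open>i\<close> outside
  \<open>1, ..., k\<close>, in particular 0, means that nothing is replaced.\<close>

lemma word_Om: "typed X f k \<Longrightarrow> word X f i k \<in> Om (if 1 \<le> i \<and> i \<le> k then k - 1 else k) (X (Suc k)) (X 0)"
proof (induction k)
  case 0
  then show ?case using Om_fmor[of "X (Suc 0)" "X 0" "f 0"] typedD[OF 0] by simp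
next
  case (Suc k)
  note t = typedD[OF Suc.prems]
  have IH: "word X f i k \<in> Om (if 1 \<le> i \<and> i \<le> k then k - 1 else k) (X (Suc k)) (X 0)"
    using Suc typed_Suc by blast
  show ?case
  proof (cases "Suc k = i")
    case True
    have "comp (X (Suc (Suc k))) (word X f i k) (fmor M (X (Suc (Suc k))) (X (Suc k)) (f (Suc k)))
        \<in> Om (k + 0) (X (Suc (Suc k))) (X 0)"
      using IH True t Om_fmor[of "X (Suc (Suc k))" "X (Suc k)" "f (Suc k)"] by (intro Om_comp) auto
    then show ?thesis using True by auto
  next
    case False
    have "comp (X (Suc (Suc k))) (word X f i k) (mcomm M (X (Suc (Suc k))) (X (Suc k)) (f (Suc k)))
        \<in> Om (Suc (if 1 \<le> i \<and> i \<le> k then k - 1 else k)) (X (Suc (Suc k))) (X 0)"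
      using IH t by (intro Om_mcomm_right) auto
    then show ?thesis using False by (auto split: if_splits)
  qed
qed

lemma word_bop: "typed X f k \<Longrightarrow> word X f i k \<in> carrier (B (X (Suc k)) (X 0))"
  using word_Om Om_bop typedD(1) by blast

lemma word_cong:
  assumes "\<And>l. l \<le> Suc k \<Longrightarrow> X l = X' l" "\<And>l. l \<le> k \<Longrightarrow> f l = f' l"
    "\<And>l. 1 \<le> l \<Longrightarrow> l \<le> k \<Longrightarrow> l = i \<longleftrightarrow> l = i'"
  shows "word X f i k = word X' f' i' k"
  using assms
proof (induction k)
  case (Suc k)
  have "word X f i k = word X' f' i' k" using Suc by auto
  moreover have "Suc k = i \<longleftrightarrow> Suc k = i'" using Suc.prems(3)[of "Suc k"] by simp
  ultimately show ?case using Suc.prems(1,2) by simp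
qed auto

lemma word_comm_prod:
  "typed X f k \<Longrightarrow> comp (X (Suc k)) (fmor M (X 1) (X 0) (f 0)) (comm_prod M X f k) = word X f 0 k"
proof (induction k)
  case 0
  then show ?case using comp_id_right[of "X 1" "X 0"] typedD[OF 0] by simp
next
  case (Suc k)
  note t = typedD[OF Suc.prems]
  have c: "comm_prod M X f k \<in> carrier (B (X (k + 1)) (X 1))"
    using t by (intro comm_prod_closed) auto
  have "comp (X (Suc (Suc k))) (fmor M (X 1) (X 0) (f 0)) (comm_prod M X f (Suc k)) =
    comp (X (Suc (Suc k))) (comp (X (Suc k)) (fmor M (X 1) (X 0) (f 0)) (comm_prod M X f k))
      (mcomm M (X (Suc (Suc k))) (X (Suc k)) (f (Suc k)))"
    using comp_assoc[of "X (Suc (Suc k))" "X (Suc k)" "X 1" "X 0"] t c by simp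
  then show ?case using Suc typed_Suc by simp
qed

text \<open>A bridge from lists with cyclic indexing to indexed families: the only index that wraps
  around is \<open>n + 1\<close>.\<close>

lemma fredholm_cocycle_eq:
  assumes t: "typed X f n" and X: "\<And>i. i \<le> n \<Longrightarrow> Xs ! i = X i" "X (Suc n) = X 0"
    and f: "\<And>i. i \<le> n \<Longrightarrow> fs ! i = f i"
  shows "fredholm_cocycle M n Xs fs = supertrace M n (X 0) (word X f 0 n)"
proof -
  let ?X = "\<lambda>i. Xs ! (i mod (n + 1))"
  have eq: "?X i = X i" if "i \<le> Suc n" for i
    using that X by (cases "i = Suc n") auto
  have "comm_prod M ?X (\<lambda>i. fs ! i) n = comm_prod M X f n"
    using eq f by (intro comm_prod_cong) auto
  then have "fredholm_cocycle M n Xs fs =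
      supertrace M n (X 0) (comp (X 0) (fmor M (X 1) (X 0) (f 0)) (comm_prod M X f n))"
    unfolding fredholm_cocycle_def Let_def using eq[of 0] eq[of 1] f[of 0] by simp
  then show ?thesis using word_comm_prod[OF t] X(2) by simp
qed

section \<open>Linearity of the cocycle in each morphism\<close>

subsection \<open>Multilinearity\<close>

lemma linear_map_compose:
  "linear_map U V f \<Longrightarrow> linear_map V W g \<Longrightarrow> linear_map U W (\<lambda>x. g (f x))"
  unfolding linear_map_def Pi_iff by simp

lemma mcomm_linear:
  "X \<in> Ob C \<Longrightarrow> Y \<in> Ob C \<Longrightarrow> linear_map (Hom C X Y) (B X Y) (mcomm M X Y)"
  by (auto simp: linear_map_def mcomm_def fmor_add fmor_smult gcomm_add gcomm_smult)

lemma typed_upd: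
  "typed X f k \<Longrightarrow> g \<in> carrier (Hom C (X (Suc i)) (X i)) \<Longrightarrow> typed X (f(i := g)) k"
  by (auto simp: typed_def)

lemma word_linear:
  assumes "typed X f k" "i \<le> k"
  shows "linear_map (Hom C (X (Suc i)) (X i)) (B (X (Suc k)) (X 0)) (\<lambda>g. word X (f(i := g)) 0 k)"
  using assms
proof (induction k)
  case 0
  then show ?case using typedD[OF 0(1)] fmor_linear[of "X (Suc 0)" "X 0"] by simp
next
  case (Suc k)
  note t = typedD[OF Suc.prems(1)] and t' = typed_Suc[OF Suc.prems(1)]
  have ob: "X (Suc (Suc k)) \<in> Ob C" "X (Suc k) \<in> Ob C" "X 0 \<in> Ob C" using t by auto
  show ?case
  proof (cases "i = Suc k")
    case True
    have w: "word X (f(i := g)) 0 k = word X f 0 k" for g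
      using True by (intro word_cong) auto
    have "linear_map (B (X (Suc (Suc k))) (X (Suc k))) (B (X (Suc (Suc k))) (X 0))
        (comp (X (Suc (Suc k))) (word X f 0 k))"
      using ob word_bop[OF t', of 0] op_compose_closed[of _ "X (Suc k)"]
      by (auto simp: linear_map_def comp_add_right comp_smult_right)
    from linear_map_compose[OF mcomm_linear this] show ?thesis
      using True w ob by (simp add: fun_upd_same del: fun_upd_apply)
  next
    case False
    then have i: "i \<le> k" using Suc.prems by simp
    have "linear_map (B (X (Suc k)) (X 0)) (B (X (Suc (Suc k))) (X 0))
        (\<lambda>S. comp (X (Suc (Suc k))) S (mcomm M (X (Suc (Suc k))) (X (Suc k)) (f (Suc k))))"
      using ob t op_compose_closed[of _ "X (Suc k)"]
      by (auto simp: linear_map_def comp_add_left comp_smult_left)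
    from linear_map_compose[OF Suc.IH[OF t' i] this] show ?thesis
      using False by (simp add: fun_upd_other[of "Suc k"] del: fun_upd_apply)
  qed
qed

lemma chain_typed:
  assumes "cyclic_chain n C Xs fs"
  shows "typed (\<lambda>i. Xs ! (i mod (n + 1))) (\<lambda>i. fs ! i) n"
  unfolding typed_def
proof (intro conjI allI impI)
  fix i
  have "i mod (n + 1) < length Xs" using assms by (simp add: cyclic_chain_def)
  then show "Xs ! (i mod (n + 1)) \<in> Ob C" using assms unfolding cyclic_chain_def by (meson nth_mem subsetD)
next
  fix i assume "i \<le> n"
  then show "fs ! i \<in> carrier (Hom C (Xs ! (Suc i mod (n + 1))) (Xs ! (i mod (n + 1))))"
    using assms by (simp add: cyclic_chain_def)
qed

lemma cochain_fredholm:
  assumes n: "real n + 1 \<ge> p"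
  shows "cochain n C (fredholm_cocycle M n)"
  unfolding cochain_def
proof (intro allI impI)
  fix Xs fs i
  assume ch: "cyclic_chain n C Xs fs" and i: "i \<le> n"
  define X where "X = (\<lambda>i. Xs ! (i mod (n + 1)))"
  define f where "f = (\<lambda>i. fs ! i)"
  have t: "typed X f n" using chain_typed[OF ch] by (simp add: X_def f_def)
  have Xn: "X (Suc n) = X 0" by (simp add: X_def)
  have X0: "X 0 \<in> Ob C" using typedD(1)[OF t] by simp
  have eq: "fredholm_cocycle M n Xs (fs[i := g]) = supertrace M n (X 0) (word X (f(i := g)) 0 n)"
    if "g \<in> carrier (Hom C (X (Suc i)) (X i))" for g
    by (rule fredholm_cocycle_eq[OF typed_upd[OF t that]])
      (use ch i in \<open>auto simp: X_def f_def cyclic_chain_def\<close>)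
  have Om: "word X (f(i := g)) 0 n \<in> Om n (X 0) (X 0)" if "g \<in> carrier (Hom C (X (Suc i)) (X i))" for g
    using word_Om[OF typed_upd[OF t that], of 0] Xn by simp
  have ob: "X (Suc i) \<in> Ob C" "X i \<in> Ob C" using typedD(1)[OF t] i by auto
  have "linear_map (Hom C (X (Suc i)) (X i)) cfield (\<lambda>g. fredholm_cocycle M n Xs (fs[i := g]))"
    using word_linear[OF t i] ob Xn
    by (auto simp: linear_map_def eq Om n supertrace_add[OF X0] supertrace_smult[OF X0] simp del: fun_upd_apply)
  then show "linear_map (Hom C (Xs ! ((i + 1) mod (n + 1))) (Xs ! i)) cfield
      (\<lambda>g. fredholm_cocycle M n Xs (fs[i := g]))"
    using i by (simp add: X_def)
qed

section \<open>Vanishing of the Hochschild coboundary\<close>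

subsection \<open>The Hochschild coboundary\<close>

text \<open>With \<open>merge_mor\<close>, this is the indexed form of the list surgery in
  \<open>hochschild_b\<close>: composing morphisms \<open>i\<close> and \<open>i + 1\<close> removes
  the object between them.\<close>

definition merge_ob :: "(nat \<Rightarrow> 'o) \<Rightarrow> nat \<Rightarrow> nat \<Rightarrow> 'o" where
  "merge_ob X i = (\<lambda>k. if k \<le> i then X k else X (Suc k))"

definition merge_mor :: "(nat \<Rightarrow> 'o) \<Rightarrow> (nat \<Rightarrow> 'm) \<Rightarrow> nat \<Rightarrow> nat \<Rightarrow> 'm" where
  "merge_mor X f i = (\<lambda>k. if k < i then f k
     else if k = i then Comp C (X (Suc (Suc i))) (X (Suc i)) (X i) (f i) (f (Suc i)) else f (Suc k))"

lemma typed_merge: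
  assumes "typed X f (Suc k)" "i \<le> k"
  shows "typed (merge_ob X i) (merge_mor X f i) k"
  using assms typedD[OF assms(1)] unfolding typed_def merge_ob_def merge_mor_def by auto

text \<open>The leading morphism stands outside the commutators, so merging it with the next one
  leaves a plain morphism in position 1 and creates no second term.\<close>

lemma word_merge_0:
  "typed X f (Suc k) \<Longrightarrow> word (merge_ob X 0) (merge_mor X f 0) 0 k = word X f 1 (Suc k)"
proof (induction k)
  case 0
  then show ?case using typedD[OF 0] by (simp add: merge_ob_def merge_mor_def fmor_comp)
next
  case (Suc k)
  then have "word (merge_ob X 0) (merge_mor X f 0) 0 k = word X f 1 (Suc k)" using typed_Suc by blast
  then show ?case by (simp add: merge_ob_def merge_mor_def)
qed

text \<open>The Leibniz rule for the merged commutator leaves the undifferentiated factor in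
  position \<open>i + 1\<close> or in position \<open>i\<close>. Neighbouring values of
  \<open>i\<close> therefore share a term.\<close>

lemma word_merge:
  assumes "i \<le> k" "1 \<le> i" "typed X f (Suc k)"
  shows "word (merge_ob X i) (merge_mor X f i) 0 k =
    word X f (Suc i) (Suc k) \<oplus>\<^bsub>B (X (Suc (Suc k))) (X 0)\<^esub> word X f i (Suc k)"
  using assms
proof (induction k rule: dec_induct)
  case base
  obtain j where j: "i = Suc j" using base by (cases i) auto
  note t = typedD[OF base(2)]
  let ?w = "word X f 0 j"
  have w: "?w \<in> carrier (B (X i) (X 0))" using word_bop[of X f j 0] base(2) typed_Suc j by blast
  have ob: "X i \<in> Ob C" "X (Suc i) \<in> Ob C" "X (Suc (Suc i)) \<in> Ob C" "X 0 \<in> Ob C" using t by auto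
  have f: "f i \<in> carrier (Hom C (X (Suc i)) (X i))" "f (Suc i) \<in> carrier (Hom C (X (Suc (Suc i))) (X (Suc i)))"
    using t by auto
  \<comment> \<open>To the left of the merged pair nothing is replaced, so all three words agree
    there.\<close>
  have 1: "word (merge_ob X i) (merge_mor X f i) 0 j = ?w" "word X f (Suc i) j = ?w" "word X f i j = ?w"
    by (rule word_cong; use j in \<open>simp add: merge_ob_def merge_mor_def\<close>)+
  have c: "comp (X (Suc (Suc i))) (mcomm M (X (Suc i)) (X i) (f i)) (fmor M (X (Suc (Suc i))) (X (Suc i)) (f (Suc i)))
      \<in> carrier (B (X (Suc (Suc i))) (X i))"
    "comp (X (Suc (Suc i))) (fmor M (X (Suc i)) (X i) (f i)) (mcomm M (X (Suc (Suc i))) (X (Suc i)) (f (Suc i)))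
      \<in> carrier (B (X (Suc (Suc i))) (X i))"
    by (rule op_compose_closed[of _ "X (Suc i)"]; use ob f in simp)+
  have "word (merge_ob X i) (merge_mor X f i) 0 i = comp (X (Suc (Suc i))) ?w
      (mcomm M (X (Suc (Suc i))) (X i) (Comp C (X (Suc (Suc i))) (X (Suc i)) (X i) (f i) (f (Suc i))))"
    using 1(1) j by (simp add: merge_ob_def merge_mor_def)
  also have "\<dots> = comp (X (Suc (Suc i))) ?w
        (comp (X (Suc (Suc i))) (mcomm M (X (Suc i)) (X i) (f i)) (fmor M (X (Suc (Suc i))) (X (Suc i)) (f (Suc i))))
      \<oplus>\<^bsub>B (X (Suc (Suc i))) (X 0)\<^esub> comp (X (Suc (Suc i))) ?w
        (comp (X (Suc (Suc i))) (fmor M (X (Suc i)) (X i) (f i)) (mcomm M (X (Suc (Suc i))) (X (Suc i)) (f (Suc i))))"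
    using ob f w c by (simp add: mcomm_comp comp_add_right)
  also have "\<dots> = word X f (Suc i) (Suc i) \<oplus>\<^bsub>B (X (Suc (Suc i))) (X 0)\<^esub> word X f i (Suc i)"
    using comp_assoc[of "X (Suc (Suc i))" "X (Suc i)" "X i" "X 0"] ob f w 1(2,3) j by simp
  finally show ?case .
next
  case (step k)
  note t = typedD[OF step.prems(2)] and t' = typed_Suc[OF step.prems(2)]
  have IH: "word (merge_ob X i) (merge_mor X f i) 0 k =
    word X f (Suc i) (Suc k) \<oplus>\<^bsub>B (X (Suc (Suc k))) (X 0)\<^esub> word X f i (Suc k)"
    using step t' by blast
  have "word (merge_ob X i) (merge_mor X f i) 0 (Suc k) = comp (X (Suc (Suc (Suc k))))
      (word X f (Suc i) (Suc k) \<oplus>\<^bsub>B (X (Suc (Suc k))) (X 0)\<^esub> word X f i (Suc k))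
      (mcomm M (X (Suc (Suc (Suc k)))) (X (Suc (Suc k))) (f (Suc (Suc k))))"
    unfolding word.simps IH using step.hyps by (simp add: merge_ob_def merge_mor_def)
  also have "\<dots> = word X f (Suc i) (Suc (Suc k)) \<oplus>\<^bsub>B (X (Suc (Suc (Suc k)))) (X 0)\<^esub> word X f i (Suc (Suc k))"
    using comp_add_left[of "X (Suc (Suc (Suc k)))" "X (Suc (Suc k))" "X 0"] t word_bop[OF t'] step.hyps
    by (simp del: word.simps add: word.simps(2)[of _ _ _ "Suc k"])
  finally show ?case .
qed

lemma word_prepend:
  assumes "typed X f k" "A \<in> Ob C" "a \<in> carrier (Hom C (X 0) A)"
  shows "word (X(0 := A)) (f(0 := Comp C (X 1) (X 0) A a (f 0))) 0 k =
    comp (X (Suc k)) (fmor M (X 0) A a) (word X f 0 k)"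
  using assms
proof (induction k)
  case 0
  then show ?case using typedD[OF 0(1)] by (simp add: fmor_comp)
next
  case (Suc k)
  note t = typedD[OF Suc.prems(1)] and t' = typed_Suc[OF Suc.prems(1)]
  have "comp (X (Suc (Suc k))) (fmor M (X 0) A a) (comp (X (Suc (Suc k))) (word X f 0 k)
      (mcomm M (X (Suc (Suc k))) (X (Suc k)) (f (Suc k)))) =
    comp (X (Suc (Suc k))) (comp (X (Suc k)) (fmor M (X 0) A a) (word X f 0 k))
      (mcomm M (X (Suc (Suc k))) (X (Suc k)) (f (Suc k)))"
    using t word_bop[OF t', of 0] Suc.prems by (intro comp_assoc[of _ "X (Suc k)" "X 0" A]) auto
  then show ?case using Suc t' by simp
qed

text \<open>Each \<open>s i\<close> with \<open>1 \<le> i \<le> n\<close> occurs in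
  \<open>a (i - 1)\<close> and in \<open>a i\<close>, under opposite signs.\<close>

lemma telescope:
  fixes s a :: "nat \<Rightarrow> complex"
  assumes "a 0 = s 1" "\<And>i. 1 \<le> i \<Longrightarrow> i \<le> n \<Longrightarrow> a i = s (Suc i) + s i"
  shows "(\<Sum>i\<le>n. (- 1) ^ i * a i) = (- 1) ^ n * s (Suc n)"
  using assms by (induction n) (auto simp: algebra_simps)

text \<open>Telescoping leaves the word whose last factor is the plain morphism
  \<open>f (n + 1)\<close>. The remaining term of the coboundary has that morphism in front; by the
  trace property its value is the same, and its sign is opposite.\<close>

lemma hochschild_fredholm:
  assumes n: "real n + 1 \<ge> p" "even n" and ch: "cyclic_chain (n + 1) C Xs fs"
  shows "hochschild_b n C (fredholm_cocycle M n) Xs fs = 0"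
proof -
  define X where "X = (\<lambda>i. Xs ! (i mod (n + 2)))"
  define f where "f = (\<lambda>i. fs ! i)"
  have t: "typed X f (Suc n)" using chain_typed[OF ch] by (simp add: X_def f_def)
  have len: "length Xs = n + 2" "length fs = n + 2" using ch by (auto simp: cyclic_chain_def)
  have Xn: "X (Suc (Suc n)) = X 0" by (simp add: X_def)
  have X: "Xs ! i = X i" if "i \<le> Suc n" for i using that by (simp add: X_def)
  have X0: "X 0 \<in> Ob C" using typedD(1)[OF t] by simp
  define s where "s i = supertrace M n (X 0) (word X f i (Suc n))" for i
  define a where "a i = fredholm_cocycle M n (take (i + 1) Xs @ drop (i + 2) Xs)
      (take i fs @ [Comp C (Xs ! ((i + 2) mod (n + 2))) (Xs ! (i + 1)) (Xs ! i) (fs ! i) (fs ! (i + 1))]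
        @ drop (i + 2) fs)" for i
  have a: "a i = supertrace M n (X 0) (word (merge_ob X i) (merge_mor X f i) 0 n)" if i: "i \<le> n" for i
  proof -
    have "a i = supertrace M n (merge_ob X i 0) (word (merge_ob X i) (merge_mor X f i) 0 n)"
      unfolding a_def
    proof (rule fredholm_cocycle_eq)
      show "typed (merge_ob X i) (merge_mor X f i) n" by (rule typed_merge[OF t i])
      show "merge_ob X i (Suc n) = merge_ob X i 0" using i Xn by (simp add: merge_ob_def)
      fix k assume k: "k \<le> n"
      show "(take (i + 1) Xs @ drop (i + 2) Xs) ! k = merge_ob X i k"
        using i k len by (auto simp: nth_append merge_ob_def X_def min_def)
      show "(take i fs @ [Comp C (Xs ! ((i + 2) mod (n + 2))) (Xs ! (i + 1)) (Xs ! i) (fs ! i) (fs ! (i + 1))]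
          @ drop (i + 2) fs) ! k = merge_mor X f i k"
      proof (cases k i rule: linorder_cases)
        case greater
        then obtain d where "k = Suc (i + d)" using less_imp_Suc_add by blast
        then show ?thesis using k len by (simp add: nth_append merge_mor_def f_def)
      qed (use i k len in \<open>auto simp: nth_append merge_mor_def X_def f_def\<close>)
    qed
    then show ?thesis by (simp add: merge_ob_def)
  qed
  have Om: "word X f i (Suc n) \<in> Om n (X 0) (X 0)" if "1 \<le> i" "i \<le> Suc n" for i
    using word_Om[OF t, of i] that Xn by simp
  have "(\<Sum>i\<le>n. (- 1) ^ i * a i) = (- 1) ^ n * s (Suc n)"
  proof (rule telescope)
    show "a 0 = s 1" using a[of 0] word_merge_0[OF t] by (simp add: s_def del: word.simps)
    fix i assume i: "1 \<le> i" "i \<le> n"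
    show "a i = s (Suc i) + s i"
      unfolding a[OF i(2)] word_merge[OF i(2,1) t] Xn s_def
      using supertrace_add[OF X0 Om Om n(1), of "Suc i" i] i by simp
  qed
  moreover have "fredholm_cocycle M n ((Xs ! (n + 1)) # drop 1 (take (n + 1) Xs))
      (Comp C (Xs ! 1) (Xs ! 0) (Xs ! (n + 1)) (fs ! (n + 1)) (fs ! 0) # drop 1 (take (n + 1) fs)) = s (Suc n)"
  proof -
    let ?X = "X(0 := X (Suc n))" and ?f = "f(0 := Comp C (X 1) (X 0) (X (Suc n)) (f (Suc n)) (f 0))"
    have t': "typed X f n" by (rule typed_Suc[OF t])
    have fn: "f (Suc n) \<in> carrier (Hom C (X 0) (X (Suc n)))" using typedD(2)[OF t, of "Suc n"] Xn by simp
    have obn: "X (Suc n) \<in> Ob C" using typedD(1)[OF t] by simp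
    have "fredholm_cocycle M n ((Xs ! (n + 1)) # drop 1 (take (n + 1) Xs))
      (Comp C (Xs ! 1) (Xs ! 0) (Xs ! (n + 1)) (fs ! (n + 1)) (fs ! 0) # drop 1 (take (n + 1) fs)) =
      supertrace M n (?X 0) (word ?X ?f 0 n)"
    proof (rule fredholm_cocycle_eq)
      show "typed ?X ?f n"
        using t' typedD[OF t'] fn obn by (auto simp: typed_def)
      fix k assume k: "k \<le> n"
      show "((Xs ! (n + 1)) # drop 1 (take (n + 1) Xs)) ! k = ?X k"
        using k len by (cases k) (auto simp: X_def)
      show "(Comp C (Xs ! 1) (Xs ! 0) (Xs ! (n + 1)) (fs ! (n + 1)) (fs ! 0) # drop 1 (take (n + 1) fs)) ! k = ?f k"
        using k len X[of 0] X[of 1] X[of "Suc n"] by (cases k) (auto simp: f_def)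
    qed simp
    also have "\<dots> = supertrace M n (X (Suc n)) (comp (X (Suc n)) (fmor M (X 0) (X (Suc n)) (f (Suc n))) (word X f 0 n))"
      using word_prepend[OF t' obn fn] by simp
    \<comment> \<open>A morphism has degree 0, so the exchange is free of sign.\<close>
    also have "\<dots> = supertrace M n (X 0) (comp (X 0) (word X f 0 n) (fmor M (X 0) (X (Suc n)) (f (Suc n))))"
      using supertrace_graded[OF X0 obn _ Om_fmor[OF X0 obn fn], of "word X f 0 n" n n] word_Om[OF t', of 0] n
      by simp
    also have "comp (X 0) (word X f 0 n) (fmor M (X 0) (X (Suc n)) (f (Suc n))) = word X f (Suc n) (Suc n)"
      using word_cong[of n X X f f 0 "Suc n"] Xn by simp
    finally show ?thesis by (simp only: s_def)
  qed
  ultimately show ?thesis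
    unfolding hochschild_b_def a_def by simp
qed

section \<open>Invariance under cyclic permutation\<close>

subsection \<open>Cyclicity\<close>

text \<open>Differentiating a word turns its leading morphism into a commutator and leaves the rest
  alone, so a word one longer is a morphism times the differential of the shorter one.\<close>

lemma word_shift:
  assumes "typed X f k" "A \<in> Ob C" "a \<in> carrier (Hom C (X 0) A)"
  shows "word (case_nat A X) (case_nat a f) 0 (Suc k) =
    comp (X (Suc k)) (fmor M (X 0) A a) (gcomm M k (X (Suc k)) (X 0) (word X f 0 k))"
  using assms
proof (induction k)
  case 0
  then show ?case using typedD[OF 0(1)] by (simp add: mcomm_def)
next
  case (Suc k)
  note t = typedD[OF Suc.prems(1)] and t' = typed_Suc[OF Suc.prems(1)]
  let ?c = "mcomm M (X (Suc (Suc k))) (X (Suc k)) (f (Suc k))"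
  have IH: "word (case_nat A X) (case_nat a f) 0 (Suc k) =
    comp (X (Suc k)) (fmor M (X 0) A a) (gcomm M k (X (Suc k)) (X 0) (word X f 0 k))"
    using Suc t' by blast
  have "word (case_nat A X) (case_nat a f) 0 (Suc (Suc k)) =
    comp (X (Suc (Suc k))) (word (case_nat A X) (case_nat a f) 0 (Suc k)) ?c"
    by (simp del: word.simps add: word.simps(2)[of _ _ _ "Suc k"])
  also have "\<dots> = comp (X (Suc (Suc k))) (fmor M (X 0) A a)
      (comp (X (Suc (Suc k))) (gcomm M k (X (Suc k)) (X 0) (word X f 0 k)) ?c)"
    unfolding IH using t word_bop[OF t', of 0] Suc.prems
    by (intro comp_assoc[of _ "X (Suc k)" "X 0" A, symmetric]) auto
  also have "comp (X (Suc (Suc k))) (gcomm M k (X (Suc k)) (X 0) (word X f 0 k)) ?c =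
      gcomm M (Suc k) (X (Suc (Suc k))) (X 0) (word X f 0 (Suc k))"
    using gcomm_comp_mcomm[of "X (Suc (Suc k))" "X (Suc k)" "X 0" "f (Suc k)" "word X f 0 k" k] t word_bop[OF t', of 0]
    by simp
  finally show ?case .
qed

text \<open>With \<open>R\<close> the word of the first \<open>n\<close> morphisms, the trace
  vanishes on \<open>[F, f n R] = [F, f n] R + f n [F, R]\<close>. The last summand is the rotated
  word, and the first one becomes minus the original word when its two factors are
  exchanged.\<close>

lemma cyclic_fredholm:
  assumes n: "real n + 1 \<ge> p" "even n" and ch: "cyclic_chain n C Xs fs"
  shows "cyclic_op n (fredholm_cocycle M n) Xs fs = fredholm_cocycle M n Xs fs"
proof (cases n)
  \<comment> \<open>Rotating one-element lists does nothing; this case is separate because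
    \<open>R\<close> has degree \<open>n - 1\<close>.\<close>
  case 0
  then have "length Xs = Suc 0" "length fs = Suc 0" using ch by (auto simp: cyclic_chain_def)
  then show ?thesis using 0 by (auto simp: cyclic_op_def length_Suc_conv)
next
  case (Suc k)
  define X where "X = (\<lambda>i. Xs ! (i mod (n + 1)))"
  define f where "f = (\<lambda>i. fs ! i)"
  have t: "typed X f n" using chain_typed[OF ch] by (simp add: X_def f_def)
  have t': "typed X f k" using t Suc typed_Suc by blast
  have len: "length Xs = n + 1" "length fs = n + 1" using ch by (auto simp: cyclic_chain_def)
  have Xn: "X (Suc n) = X 0" by (simp add: X_def)
  have ob: "X 0 \<in> Ob C" "X n \<in> Ob C" using typedD(1)[OF t] by auto
  have fn: "f n \<in> carrier (Hom C (X 0) (X n))" using typedD(2)[OF t, of n] Xn by simp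
  let ?g = "fmor M (X 0) (X n) (f n)" and ?R = "word X f 0 k"
  have R: "?R \<in> Om k (X n) (X 0)" using word_Om[OF t', of 0] Suc by simp
  have RB: "?R \<in> carrier (B (X n) (X 0))" by (rule Om_bop[OF ob(2,1) R])
  have gR: "comp (X n) ?g ?R \<in> Om k (X n) (X n)"
    using Om_comp[OF Om_fmor[OF ob fn] R ob(2,1,2)] by simp
  have 1: "comp (X n) (mcomm M (X 0) (X n) (f n)) ?R \<in> Om n (X n) (X n)"
    using Om_comp[OF Om_mcomm[OF ob fn] R ob(2,1,2)] Suc by simp
  have 2: "comp (X n) ?g (gcomm M k (X n) (X 0) ?R) \<in> Om n (X n) (X n)"
    using Om_comp[OF Om_fmor[OF ob fn] Om_gcomm[OF R ob(2,1)] ob(2,1,2)] Suc by simp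
  have "gcomm M k (X n) (X n) (comp (X n) ?g ?R) = comp (X n) (mcomm M (X 0) (X n) (f n)) ?R
      \<oplus>\<^bsub>B (X n) (X n)\<^esub> comp (X n) ?g (gcomm M k (X n) (X 0) ?R)"
    using gcomm_compose[of "X n" "X 0" "X n" ?g ?R 0 k] ob fn RB
      B_simps(1)[OF ob(2,2) Om_bop[OF ob(2,2) 2]] by (simp add: mcomm_def)
  then have "supertrace M n (X n) (comp (X n) (mcomm M (X 0) (X n) (f n)) ?R)
      + supertrace M n (X n) (comp (X n) ?g (gcomm M k (X n) (X 0) ?R)) = 0"
    using supertrace_closed[OF ob(2) gR] supertrace_add[OF ob(2) 1 2 n(1)] Suc by simp
  \<comment> \<open>The degrees are 1 and \<open>k\<close>, and \<open>k\<close> is odd since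
    \<open>n\<close> is even, which gives the sign -1.\<close>
  moreover have "supertrace M n (X n) (comp (X n) (mcomm M (X 0) (X n) (f n)) ?R) =
      - supertrace M n (X 0) (comp (X 0) ?R (mcomm M (X 0) (X n) (f n)))"
    using supertrace_graded[OF ob(2,1) Om_mcomm[OF ob fn] R, of n] n Suc by simp
  moreover have "comp (X 0) ?R (mcomm M (X 0) (X n) (f n)) = word X f 0 n"
    using Suc Xn by simp
  ultimately have key: "supertrace M n (X n) (comp (X n) ?g (gcomm M k (X n) (X 0) ?R)) =
      supertrace M n (X 0) (word X f 0 n)" by (simp add: add_eq_0_iff)
  have "fredholm_cocycle M n ((Xs ! n) # take n Xs) ((fs ! n) # take n fs) =
      supertrace M n (case_nat (X n) X 0) (word (case_nat (X n) X) (case_nat (f n) f) 0 n)"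
  proof (rule fredholm_cocycle_eq)
    show "typed (case_nat (X n) X) (case_nat (f n) f) n"
      using typedD[OF t] fn ob by (auto simp: typed_def split: nat.splits)
    fix i assume i: "i \<le> n"
    show "((Xs ! n) # take n Xs) ! i = case_nat (X n) X i"
      using i len by (cases i) (auto simp: X_def)
    show "((fs ! n) # take n fs) ! i = case_nat (f n) f i"
      using i len by (cases i) (auto simp: f_def)
  qed simp
  also have "\<dots> = supertrace M n (X n) (comp (X n) ?g (gcomm M k (X n) (X 0) ?R))"
    using word_shift[OF t' ob(2) fn] Suc by simp
  also have "\<dots> = fredholm_cocycle M n Xs fs"
    unfolding key
    by (rule fredholm_cocycle_eq[symmetric]) (use t Xn in \<open>auto simp: X_def f_def\<close>)
  finally show ?thesis using n by (simp add: cyclic_op_def)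
qed

lemma cyclic_cocycle_fredholm:
  "real n + 1 \<ge> p \<Longrightarrow> even n \<Longrightarrow> cyclic_cocycle n C (fredholm_cocycle M n)"
  unfolding cyclic_cocycle_def using cochain_fredholm hochschild_fredholm cyclic_fredholm by blast

end

text \<open>The first conjunct records what the definition of the supertrace presupposes: the
  commutators under the trace are trace class, so that the definite description in
  \<open>op_trace\<close> has its intended meaning.\<close>

theorem theorem2p9:
  fixes C :: "('o, 'm) semicat" and M :: "('o, 'm, 'v) fredholm" and p :: real and m :: nat
  assumes "linear_category C"
    and "p \<ge> 1"
    and "even_fredholm_module p C M"
    and "real (2 * m) \<ge> p - 1"
  shows "(\<forall>X\<in>Ob C. \<forall>T\<in>carrier (gHom (Omega C M) (2 * m) X X).
            gcomm M (2 * m) X X T \<in> schatten 1 (fob M X) (fob M X)) \<and>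
         cycle_over (2 * m) C (Omega C M) (gcomm M) (supertrace M (2 * m)) (\<lambda>X. X) (fmor M) \<and>
         cyclic_cocycle (2 * m) C (fredholm_cocycle M (2 * m))"
proof -
  interpret fredholm_setting C M p by unfold_locales fact+
  have n: "real (2 * m) + 1 \<ge> p" "even (2 * m)" using assms(4) by auto
  show ?thesis
    using gcomm_schatten[OF n(1)] cycle_Omega[OF n(2,1)] cyclic_cocycle_fredholm[OF n] by simp
qed

end
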